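(* Let $n\geq 1$ be an integer, let $0<q\leq 1$, and let $g,g_1,g_2,g_3,g_4\in\mathbb{C}$ satisfy $$\operatorname{Re}\bigl(1+2(n-j)g+g_1+g_2+g_3+g_4\bigr)>0\qquad (j=1,\ldots,n).$$ Let $\mathbf{z}\in\mathbb{C}^n$ be such that $z_j+z_k$, $z_j-z_k$ ($1\leq j<k\leq n$) and $2z_j$ ($1\leq j\leq n$) are nonzero modulo the lattice $\Omega_q$. Then the series $$\sum_{\lambda\in\mathbb{Z}^n}\frac{1}{\mathcal{C}_{+,q}(\mathbf{z}+\lambda)\,\mathcal{C}_{+,q}(-\mathbf{z}-\lambda)}$$ converges in absolute value, and $$\sum_{\lambda\in\mathbb{Z}^n}\frac{1}{\mathcal{C}_{+,q}(\mathbf{z}+\lambda)\,\mathcal{C}_{+,q}(-\mathbf{z}-\lambda)}=\frac{\hat{\mathcal{C}}_{-,q}(\hat\rho)}{\hat{\mathcal{C}}_{+,q}(\hat\rho)}.$$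
   Context: Notation: for $|q|<1$, $(a;q)_\infty=\prod_{k\geq0}(1-aq^k)$ and $(a_1,\ldots,a_p;q)_\infty=(a_1;q)_\infty\cdots(a_p;q)_\infty$; $\Gamma$ is the gamma function. The lattice is $\Omega_q=\mathbb{Z}+\frac{2\pi}{i\log q}\mathbb{Z}$ for $0<q<1$ and $\Omega_1=\mathbb{Z}$. Fix a permutation $(a,b,c,d)$ of $(1,2,3,4)$ and define $\hat g_a=\tfrac12(g_a+g_b+g_c+g_d)$, $\hat g_b=\tfrac12(g_a+g_b-g_c-g_d)$, $\hat g_c=\tfrac12(g_a-g_b+g_c-g_d)$, $\hat g_d=\tfrac12(g_a-g_b-g_c+g_d)$. Let $\hat\rho\in\mathbb{C}^n$ have components $\hat\rho_j=(n-j)g+\hat g_a$, $j=1,\ldots,n$. For $\mathbf{x}\in\mathbb{C}^n$ and $0<q<1$: $$\mathcal{C}_{+,q}(\mathbf{x})=\prod_{1\leq j<k\leq n}\frac{(q^{1+x_j+x_k},q^{1+x_j-x_k};q)_\infty}{(q^{1+g+x_j+x_k},q^{1+g+x_j-x_k};q)_\infty}\prod_{j=1}^n\frac{(q^{1+2x_j};q)_\infty}{\prod_{r=1}^4(q^{1+g_r+x_j};q)_\infty},$$ $$\hat{\mathcal{C}}_{+,q}(\mathbf{x})=\prod_{1\leq j<k\leq n}\frac{(q^{1+x_j+x_k},q^{1+x_j-x_k};q)_\infty}{(q^{1+g+x_j+x_k},q^{1+g+x_j-x_k};q)_\infty}\prod_{j=1}^n\frac{(q^{1+2x_j};q)_\infty}{\prod_{r=1}^4(q^{1+\hat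 g_r+x_j};q)_\infty},$$ $$\hat{\mathcal{C}}_{-,q}(\mathbf{x})=\prod_{1\leq j<k\leq n}\frac{(q^{1-g+x_j+x_k},q^{1-g+x_j-x_k};q)_\infty}{(q^{1+x_j+x_k},q^{1+x_j-x_k};q)_\infty}\prod_{j=1}^n\frac{\prod_{r=1}^4(q^{1-\hat g_r+x_j};q)_\infty}{(q^{1+2x_j};q)_\infty}.$$ For $q=1$: $$\mathcal{C}_{+,1}(\mathbf{x})=\prod_{1\leq j<k\leq n}\frac{\Gamma(1+g+x_j+x_k)\Gamma(1+g+x_j-x_k)}{\Gamma(1+x_j+x_k)\Gamma(1+x_j-x_k)}\prod_{j=1}^n\frac{\prod_{r=1}^4\Gamma(1+g_r+x_j)}{\Gamma(1+2x_j)},$$ $$\hat{\mathcal{C}}_{+,1}(\mathbf{x})=\prod_{1\leq j<k\leq n}\frac{\Gamma(1+g+x_j+x_k)\Gamma(1+g+x_j-x_k)}{\Gamma(1+x_j+x_k)\Gamma(1+x_j-x_k)}\prod_{j=1}^n\frac{\prod_{r=1}^4\Gamma(1+\hat g_r+x_j)}{\Gamma(1+2x_j)},$$ $$\hat{\mathcal{C}}_{-,1}(\mathbf{x})=\prod_{1\leq j<k\leq n}\frac{\Gamma(1+x_j+x_k)\Gamma(1+x_j-x_k)}{\Gamma(1-g+x_j+x_k)\Gamma(1-g+x_j-x_k)}\prod_{j=1}^n\frac{\Gamma(1+2x_j)}{\prod_{r=1}^4\Gamma(1-\hat g_r+x_j)}.$$ *)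

theory Defs
  imports "HOL-Analysis.Analysis"
begin

text \<open>
  Vectors in \<open>\<complex>\<^sup>n\<close> are functions on \<open>nat\<close> of which only the components \<open>1, \<dots>, n\<close> are used,
  and the parameters \<open>g\<^sub>1, \<dots>, g\<^sub>4\<close> form a function \<open>gs\<close> on \<open>{1..4}\<close>.
\<close>

definition qpochhammer_inf :: "complex \<Rightarrow> real \<Rightarrow> complex" where
  "qpochhammer_inf a q = (\<Prod>k. 1 - a * of_real q ^ k)"

text \<open>The symbol \<open>(q\<^sup>u; q)\<^sub>\<infinity>\<close>, with \<open>q\<^sup>u = exp (u log q)\<close> for complex \<open>u\<close>.\<close>

definition qfac :: "real \<Rightarrow> complex \<Rightarrow> complex" where
  "qfac q u = qpochhammer_inf (of_real q powr u) q"

definition Omega :: "real \<Rightarrow> complex set" where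
  "Omega q = (if q = 1 then \<int>
     else {of_int l + of_int m * (2 * of_real pi / (\<i> * of_real (ln q))) | l m :: int. True})"

text \<open>
  The functions \<open>C\<^sub>+\<close> and \<open>C\<^sub>-\<close> with general parameters \<open>gs\<close>; the hatted functions are the
  instances with \<open>gs = ghat a b c d \<dots>\<close>.  Division by zero and \<open>Gamma\<close> at its poles are both \<open>0\<close>
  here. Hence \<open>1 / Cplus q n g gs x\<close> has its correct value (zero) where a factor in the
  denominator of \<open>C\<^sub>+\<close> vanishes (\<open>q < 1\<close>) or a \<open>Gamma\<close> in its numerator has a pole (\<open>q = 1\<close>).
\<close>

definition Cplus :: "real \<Rightarrow> nat \<Rightarrow> complex \<Rightarrow> (nat \<Rightarrow> complex) \<Rightarrow> (nat \<Rightarrow> complex) \<Rightarrow> complex" where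
  "Cplus q n g gs x =
    (if q = 1 then
      (\<Prod>j\<in>{1..n}. \<Prod>k\<in>{j+1..n}.
         (Gamma (1 + g + x j + x k) * Gamma (1 + g + x j - x k)) /
         (Gamma (1 + x j + x k) * Gamma (1 + x j - x k))) *
      (\<Prod>j\<in>{1..n}. (\<Prod>r\<in>{1..4}. Gamma (1 + gs r + x j)) / Gamma (1 + 2 * x j))
     else
      (\<Prod>j\<in>{1..n}. \<Prod>k\<in>{j+1..n}.
         (qfac q (1 + x j + x k) * qfac q (1 + x j - x k)) /
         (qfac q (1 + g + x j + x k) * qfac q (1 + g + x j - x k))) *
      (\<Prod>j\<in>{1..n}. qfac q (1 + 2 * x j) / (\<Prod>r\<in>{1..4}. qfac q (1 + gs r + x j))))"

definition Cminus :: "real \<Rightarrow> nat \<Rightarrow> complex \<Rightarrow> (nat \<Rightarrow> complex) \<Rightarrow> (nat \<Rightarrow> complex) \<Rightarrow> complex" where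
  "Cminus q n g gs x =
    (if q = 1 then
      (\<Prod>j\<in>{1..n}. \<Prod>k\<in>{j+1..n}.
         (Gamma (1 + x j + x k) * Gamma (1 + x j - x k)) /
         (Gamma (1 - g + x j + x k) * Gamma (1 - g + x j - x k))) *
      (\<Prod>j\<in>{1..n}. Gamma (1 + 2 * x j) / (\<Prod>r\<in>{1..4}. Gamma (1 - gs r + x j)))
     else
      (\<Prod>j\<in>{1..n}. \<Prod>k\<in>{j+1..n}.
         (qfac q (1 - g + x j + x k) * qfac q (1 - g + x j - x k)) /
         (qfac q (1 + x j + x k) * qfac q (1 + x j - x k))) *
      (\<Prod>j\<in>{1..n}. (\<Prod>r\<in>{1..4}. qfac q (1 - gs r + x j)) / qfac q (1 + 2 * x j)))"

text \<open>The dual parameters; \<open>(a, b, c, d)\<close> is meant to be a permutation of \<open>(1, 2, 3, 4)\<close>.\<close>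

definition ghat :: "nat \<Rightarrow> nat \<Rightarrow> nat \<Rightarrow> nat \<Rightarrow> (nat \<Rightarrow> complex) \<Rightarrow> nat \<Rightarrow> complex" where
  "ghat a b c d gs r =
    (if r = a then (gs a + gs b + gs c + gs d) / 2
     else if r = b then (gs a + gs b - gs c - gs d) / 2
     else if r = c then (gs a - gs b + gs c - gs d) / 2
     else (gs a - gs b - gs c + gs d) / 2)"

definition rhohat :: "nat \<Rightarrow> complex \<Rightarrow> complex \<Rightarrow> nat \<Rightarrow> complex" where
  "rhohat n g ga j = of_nat (n - j) * g + ga"

definition rhs_quotient ::
  "real \<Rightarrow> nat \<Rightarrow> nat \<Rightarrow> nat \<Rightarrow> nat \<Rightarrow> nat \<Rightarrow> (nat \<Rightarrow> complex) \<Rightarrow> complex \<Rightarrow> complex" where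
  "rhs_quotient q n a b c d gs g =
     (let gh = ghat a b c d gs; \<rho> = rhohat n g (gh a)
      in Cminus q n g gh \<rho> / Cplus q n g gh \<rho>)"

text \<open>
  No factor by which the quotient \<open>C\<^sub>- / C\<^sub>+\<close> at \<open>x\<close> divides is zero (\<open>q < 1\<close>), respectively no
  \<open>Gamma\<close> multiplying it is at a pole (\<open>q = 1\<close>), so that the quotient is literally meaningful.
  At \<open>x = rhohat n g \<dots>\<close> this can fail for exceptional \<open>g\<close> (e.g. \<open>g = -1\<close>, since
  \<open>x\<^sub>j - x\<^sub>k = (k - j) g\<close>), where the quotient has a removable singularity as a function of \<open>g\<close>.
\<close>

definition quotient_defined :: "real \<Rightarrow> nat \<Rightarrow> (nat \<Rightarrow> complex) \<Rightarrow> bool" where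
  "quotient_defined q n x \<longleftrightarrow>
    (let ok = (\<lambda>u. if q = 1 then 1 + u \<notin> \<int>\<^sub>\<le>\<^sub>0 else qfac q (1 + u) \<noteq> 0)
     in (\<forall>j\<in>{1..n}. \<forall>k\<in>{j+1..n}. ok (x j + x k) \<and> ok (x j - x k)) \<and>
        (\<forall>j\<in>{1..n}. ok (2 * x j)))"

text \<open>The functions on \<open>{1..n}\<close> representing \<open>\<int>\<^sup>n\<close>; they are \<open>undefined\<close> elsewhere.\<close>

definition int_vectors :: "nat \<Rightarrow> (nat \<Rightarrow> int) set" where
  "int_vectors n = {1..n} \<rightarrow>\<^sub>E UNIV"

definition lhs_term ::
  "real \<Rightarrow> nat \<Rightarrow> complex \<Rightarrow> (nat \<Rightarrow> complex) \<Rightarrow> (nat \<Rightarrow> complex) \<Rightarrow> (nat \<Rightarrow> int) \<Rightarrow> complex" where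
  "lhs_term q n g gs z l =
     1 / (Cplus q n g gs (\<lambda>j. z j + of_int (l j)) * Cplus q n g gs (\<lambda>j. - z j - of_int (l j)))"

end

theory Submission
  imports Defs "HOL-Complex_Analysis.Complex_Analysis"
begin

text \<open>The summand is a product of reciprocal gamma functions for q = 1 and of q-Pochhammer
  symbols for q < 1; for n = 1 the identities are Dougall's bilateral 5H5 sum and Bailey's 6psi6
  sum. Up to a Gaussian factor q^(u (u - 1) / 4), both symbols are an entire \<open>F\<close> with
  \<open>F u = br u * F (u + 1)\<close>, where the bracket \<open>br\<close> (u itself, or q^(-u/2)
  - q^(u/2)) is odd and br (s + t) br (s - t) is a difference Y s - Y t. The locale
  \<open>gamma_like\<close> keeps these facts and the growth along the integers. In it, the sum
  \<open>S\<close> is shown to equal an explicit product \<open>R\<close> for generic g as soon as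
  \<open>decay\<close> is positive (\<open>S_eq_R\<close>).

  Recurrence: the one-variable products \<open>basis\<close> are triangular for an Askey-Wilson type
  operator with step g. Interpolating the product of t - Y (x k) over k turns this into a polynomial
  identity (\<open>newton_ibp\<close>) one side of which, multiplied by the summand, cancels under
  unit translations of the coordinates. Summing over the lattice and comparing coefficients gives a
  first-order recurrence in a (\<open>S_recurrence\<close>), which \<open>R\<close> satisfies as
  well (\<open>R_recurrence\<close>).

  Periodicity: hence \<open>psi\<close> = S / R has period 1 in each parameter when the real parts
  are large. As a function of s, \<open>psi\<close> at (a + s, b - s, c, d) has period 1 and at most
  polynomial growth in a vertical strip, so it is constant (\<open>psi_strip\<close>). The growth
  bound comes from the reflection formula for q = 1, and from a common imaginary quasi-period of S
  and R for q < 1.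

  Induction on n: when a and b are minus and plus the last coordinate of z, zeros of
  \<open>F\<close> kill every term in which the last lattice coordinate is nonzero, and what is left
  is a sum with one variable less (\<open>S_reduction\<close>, \<open>R_reduction\<close>). The
  moves allowed for \<open>psi\<close> connect arbitrary parameters of large real part with this
  special choice (\<open>psi_eq_1\<close>), and analytic continuation in a common shift of the four
  parameters does the rest.

  Finally the quotient of the dual C-functions at \<open>rhohat\<close> telescopes to
  \<open>R\<close> (\<open>quot_eq_R\<close>), the Gaussian factors contribute the same constant on
  both sides (\<open>term_of_gauge\<close>, \<open>quot_gauge\<close>), and exceptional values of g
  are reached as limits (\<open>sum_term_of\<close>).\<close>

section \<open>Abstract reciprocal gamma functions and their size along the integers\<close>

lemma bounded_finite_extend:
  fixes f :: "'a \<Rightarrow> nat \<Rightarrow> real"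
  assumes "\<And>l. \<exists>B. \<forall>c\<in>A. f c l \<le> B" and "\<exists>C. \<forall>c\<in>A. \<forall>l\<ge>N. f c l \<le> C"
  shows "\<exists>C\<ge>0. \<forall>c\<in>A. \<forall>l. f c l \<le> C"
proof -
  obtain B where B: "\<And>l c. c \<in> A \<Longrightarrow> f c l \<le> B l" using assms(1) by metis
  obtain C where C: "\<And>l c. c \<in> A \<Longrightarrow> l \<ge> N \<Longrightarrow> f c l \<le> C" using assms(2) by metis
  have "f c l \<le> \<bar>C\<bar> + (\<Sum>i<N. \<bar>B i\<bar>)" if "c \<in> A" for c l
  proof (cases "l < N")
    case True
    then have "\<bar>B l\<bar> \<le> (\<Sum>i<N. \<bar>B i\<bar>)" by (intro member_le_sum) auto
    then show ?thesis using B[OF that, of l] by linarith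
  next
    case False
    have "0 \<le> (\<Sum>i<N. \<bar>B i\<bar>)" by (intro sum_nonneg) auto
    then show ?thesis using C[OF that, of l] False by linarith
  qed
  moreover have "0 \<le> \<bar>C\<bar> + (\<Sum>i<N. \<bar>B i\<bar>)" by (intro add_nonneg_nonneg sum_nonneg) auto
  ultimately show ?thesis by blast
qed

text \<open>\<open>F\<close> models \<open>rGamma\<close>, or the q-Pochhammer symbol with its
  Gaussian factor. The weight \<open>w\<close> measures growth along the integers, with
  \<open>br\<close> of size at most \<open>w\<close> to the power 1/2. The factor
  \<open>\<eta>\<close> records that doubling an argument costs less than a full power of
  \<open>w\<close> when \<open>br\<close> is linear; it is 1 in the q-case. The identity
  \<open>br_four\<close> is what makes the Askey-Wilson operator preserve polynomials in
  \<open>Y\<close>.\<close>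

locale gamma_like =
  fixes F br Y :: "complex \<Rightarrow> complex" and w \<eta> :: "int \<Rightarrow> real"
  assumes F_rec: "F u = br u * F (u + 1)"
    and F_holo: "F holomorphic_on UNIV"
    and F_zero: "F u = 0 \<Longrightarrow> \<exists>m::nat. br (u + of_nat m) = 0"
    and br_zero: "br u = 0 \<Longrightarrow> Re u = 0"
    and br_minus: "br (- u) = - br u"
    and br_Y: "br (s + t) * br (s - t) = Y s - Y t"
    and br_four: "br (b1 + s) * br (b2 + s) * br (b3 + s) * br (b4 + s)
        - br (b1 - s) * br (b2 - s) * br (b3 - s) * br (b4 - s)
        = br (2 * s) * (br (b1 + b4) * br (b2 + b4) * br (b3 + b4)
            - br (b1 + b2 + b3 + b4) * (br (b4 + s) * br (b4 - s)))"
    and w_ge_1: "w l \<ge> 1"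
    and w_minus: "w (- l) = w l"
    and w_add: "w (l + m) \<le> w l * w m"
    and w_double: "\<exists>C. \<forall>l. w (2 * l) powr (1/2) \<le> C * (w l * \<eta> l)"
    and eta_nonneg: "\<eta> l \<ge> 0"
    and eta_summable: "\<sigma> > 0 \<Longrightarrow> (\<lambda>l. w l powr (- \<sigma>) * \<eta> l) summable_on UNIV"
    and br_bound: "\<exists>C. \<forall>l. norm (br (u + of_int l)) \<le> C * w l powr (1/2)"
    and F_ratio: "\<exists>C. \<forall>u h. \<forall>l::nat. norm u \<le> R \<and> norm h \<le> R \<and> Re u + real l \<ge> 1 \<longrightarrow>
        norm (F (u + of_nat l + h)) \<le> C * w (int l) powr (- Re h / 2) * norm (F (u + of_nat l))"
begin

text \<open>In the two instances this follows from u lying outside \<open>Omega\<close>: no integer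
  translate of u is a zero of the bracket.\<close>

definition nz :: "complex \<Rightarrow> bool" where
  "nz u \<longleftrightarrow> (\<forall>l::int. br (u + of_int l) \<noteq> 0)"

definition W :: "complex \<Rightarrow> complex \<Rightarrow> complex" where
  "W c u = F (1 + c + u) * F (1 + c - u)"

text \<open>For \<open>F = rGamma\<close> this is sin (pi u) / pi. It changes sign under unit
  translation, so its modulus is constant along u + Z; this replaces the reflection formula in the
  estimates.\<close>

definition theta :: "complex \<Rightarrow> complex" where
  "theta u = F u * F (1 - u)"

lemma holomorphic_F [holomorphic_intros]:
  assumes "f holomorphic_on A"
  shows "(\<lambda>x. F (f x)) holomorphic_on A"
  using holomorphic_on_compose[OF assms holomorphic_on_subset[OF F_holo]] by (simp add: o_def)

lemma continuous_on_F [continuous_intros]: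
  assumes "continuous_on A f"
  shows "continuous_on A (\<lambda>x. F (f x))"
  using continuous_on_compose[OF assms holomorphic_on_imp_continuous_on[OF holomorphic_on_subset[OF F_holo]]]
  by (simp add: o_def)

lemma F_nonzero: "Re u > 0 \<Longrightarrow> F u \<noteq> 0"
proof
  assume "Re u > 0" "F u = 0"
  then obtain m :: nat where "br (u + of_nat m) = 0" using F_zero by blast
  with br_zero have "Re (u + of_nat m) = 0" by blast
  then show False using \<open>Re u > 0\<close> by simp
qed

lemma br_nonzero: "Re u \<noteq> 0 \<Longrightarrow> br u \<noteq> 0"
  using br_zero by blast

lemma br_0: "br 0 = 0"
  using br_minus[of 0] by simp

lemma Y_minus: "Y (- s) = Y s"
  using br_Y[of 0 s] br_Y[of 0 "- s"] br_minus[of s] by (simp add: mult.commute)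

lemma nz_add_int: "nz u \<Longrightarrow> nz (u + of_int l)"
  unfolding nz_def by (metis add.assoc of_int_add)

lemma nz_minus: "nz u \<Longrightarrow> nz (- u)"
  unfolding nz_def
proof
  fix l assume "\<forall>l. br (u + of_int l) \<noteq> 0"
  then have "br (u + of_int (- l)) \<noteq> 0" by blast
  moreover have "- u + of_int l = - (u + of_int (- l))" by simp
  ultimately show "br (- u + of_int l) \<noteq> 0" using br_minus by (metis neg_equal_0_iff_equal)
qed

lemma nz_br: "nz u \<Longrightarrow> br (u + of_int l) \<noteq> 0" "nz u \<Longrightarrow> br u \<noteq> 0"
  unfolding nz_def by (auto dest: spec[of _ 0])

lemma nz_F: assumes "nz u" shows "F (u + of_int l) \<noteq> 0"
proof
  assume "F (u + of_int l) = 0"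
  then obtain m :: nat where "br (u + of_int l + of_nat m) = 0" using F_zero by blast
  then have "br (u + of_int (l + int m)) = 0" by (simp add: add.assoc)
  then show False using assms unfolding nz_def by blast
qed

lemma nz_F_simps: assumes "nz u" shows "F u \<noteq> 0" "F (1 + u) \<noteq> 0" "F (1 - u) \<noteq> 0"
  using nz_F[OF assms, of 0] nz_F[OF assms, of 1] nz_F[OF nz_minus[OF assms], of 1]
  by (simp_all add: add.commute)

lemma theta_eq_W: "theta u = br u * W 0 u"
  unfolding theta_def W_def using F_rec[of u] by (simp add: add.commute)

lemma theta_step: "theta (u + 1) = - theta u"
  unfolding theta_def using F_rec[of u] F_rec[of "-u"] br_minus[of u] by (simp add: algebra_simps)

lemma norm_theta_nat: "norm (theta (u + of_nat l)) = norm (theta u)"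
proof (induction l)
  case (Suc l)
  then show ?case using theta_step[of "u + of_nat l"] by (simp add: add_ac)
qed simp

lemma norm_theta_int: "norm (theta (u + of_int l)) = norm (theta u)"
proof (cases "l \<ge> 0")
  case True
  then obtain k where "l = int k" using nonneg_int_cases by blast
  then show ?thesis using norm_theta_nat[of u k] by simp
next
  case False
  then obtain k where "l = - int k" using int_cases2 by (metis of_nat_0_le_iff)
  then show ?thesis using norm_theta_nat[of "u + of_int l" k] by simp
qed

lemma nz_W0: "nz u \<Longrightarrow> W 0 u \<noteq> 0" and nz_theta: "nz u \<Longrightarrow> theta u \<noteq> 0"
  unfolding W_def theta_def using nz_F_simps by auto

lemma W_minus: "W c (- u) = W c u"
  unfolding W_def by (simp add: mult.commute)

lemma W_step: "br (1 + c + u) * W c (u + 1) = br (c - u) * W c u"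
  unfolding W_def using F_rec[of "1 + c + u"] F_rec[of "c - u"] by (simp add: algebra_simps)

lemma W_pred: "W (c - 1) u = (Y c - Y u) * W c u"
  unfolding W_def br_Y[symmetric] using F_rec[of "c + u"] F_rec[of "c - u"] by (simp add: algebra_simps)

lemma w_pos: "w l > 0" and w_nonneg: "w l \<ge> 0"
  using w_ge_1[of l] by linarith+

text \<open>With x = z + l, the factor F (1 + c - x) is eliminated through F (x - c) F (1 + c - x) =
  theta (x - c), whose modulus does not depend on l. The remaining ratio of F (1 + c + x) to F (x -
  c) is controlled by \<open>F_ratio\<close> with shift 1 + 2c, which produces the exponent Re c +
  1/2. The finitely many small l are covered by compactness in c.\<close>

lemma W_bound_nat:
  "\<exists>C\<ge>0. \<forall>c\<in>cball 0 R. \<forall>l::nat. norm (W c (z + of_nat l)) * w (int l) powr (Re c + 1/2) \<le> C"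
proof (rule bounded_finite_extend)
  fix l :: nat
  have "continuous_on (cball 0 R) (\<lambda>c. norm (W c (z + of_nat l)) * w (int l) powr (Re c + 1/2))"
    unfolding W_def using w_pos[of "int l"] by (intro continuous_intros) auto
  then have "bounded ((\<lambda>c. norm (W c (z + of_nat l)) * w (int l) powr (Re c + 1/2)) ` cball 0 R)"
    by (intro compact_imp_bounded compact_continuous_image) auto
  then obtain B where "\<forall>x\<in>(\<lambda>c. norm (W c (z + of_nat l)) * w (int l) powr (Re c + 1/2)) ` cball 0 R. norm x \<le> B"
    unfolding bounded_iff by blast
  then show "\<exists>B. \<forall>c\<in>cball 0 R. norm (W c (z + of_nat l)) * w (int l) powr (Re c + 1/2) \<le> B"
    by (intro exI[of _ B]) auto
next
  \<comment> \<open>From \<open>N\<close> on, z - c + l has real part at least 1 for every c in the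
    ball; \<open>R'\<close> dominates both z - c and 1 + 2c.\<close>
  define N where "N = nat \<lceil>\<bar>R\<bar> + 1 - Re z\<rceil>"
  define R' where "R' = norm z + 2 * \<bar>R\<bar> + 1"
  obtain C where C: "\<And>u h. \<And>l::nat. norm u \<le> R' \<and> norm h \<le> R' \<and> Re u + real l \<ge> 1 \<Longrightarrow>
      norm (F (u + of_nat l + h)) \<le> C * w (int l) powr (- Re h / 2) * norm (F (u + of_nat l))"
    using F_ratio[of R'] by blast
  have "continuous_on (cball 0 R) (\<lambda>c. theta (z - c))"
    unfolding theta_def by (intro continuous_intros)
  then have "bounded ((\<lambda>c. theta (z - c)) ` cball 0 R)"
    by (intro compact_imp_bounded compact_continuous_image) auto
  then obtain T where T: "\<And>c. c \<in> cball 0 R \<Longrightarrow> norm (theta (z - c)) \<le> T"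
    unfolding bounded_iff by blast
  show "\<exists>C. \<forall>c\<in>cball 0 R. \<forall>l\<ge>N. norm (W c (z + of_nat l)) * w (int l) powr (Re c + 1/2) \<le> C"
  proof (intro exI ballI allI impI)
    fix c :: complex and l assume c: "c \<in> cball 0 R" and l: "N \<le> l"
    have cR: "norm c \<le> \<bar>R\<bar>" using c by simp
    have l': "Re (z - c) + real l \<ge> 1"
    proof -
      have "real l \<ge> \<bar>R\<bar> + 1 - Re z" using l unfolding N_def by linarith
      moreover have "Re c \<le> \<bar>R\<bar>" using cR complex_Re_le_cmod order_trans by blast
      ultimately show ?thesis by simp
    qed
    have "norm (z - c) \<le> R'" unfolding R'_def using norm_triangle_ineq4[of z c] cR by linarith
    moreover have "norm (1 + 2 * c) \<le> R'" unfolding R'_def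
      using norm_triangle_ineq[of 1 "2 * c"] cR norm_ge_zero[of z] unfolding norm_mult by (simp del: norm_ge_zero)
    ultimately have *: "norm (F ((z - c) + of_nat l + (1 + 2 * c)))
        \<le> C * w (int l) powr (- Re (1 + 2 * c) / 2) * norm (F ((z - c) + of_nat l))"
      using C l' by blast
    define x where "x = z + of_nat l"
    have Fx: "F (x - c) \<noteq> 0" using F_nonzero[of "x - c"] l' unfolding x_def by simp
    have th: "norm (theta (x - c)) \<le> T" using T[OF c] norm_theta_nat[of "z - c" l] unfolding x_def
      by (simp add: algebra_simps)
    have "norm (W c x) * norm (F (x - c)) = norm (F (1 + c + x)) * norm (theta (x - c))"
      unfolding W_def theta_def by (simp add: norm_mult algebra_simps)
    also have "\<dots> \<le> (C * w (int l) powr (- Re (1 + 2 * c) / 2) * norm (F (x - c))) * T"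
      using * th by (intro mult_mono) (auto simp: x_def algebra_simps intro: order_trans[OF norm_ge_zero])
    finally have "norm (W c x) \<le> C * T * w (int l) powr (- Re (1 + 2 * c) / 2)"
      using Fx by (simp add: field_simps)
    then have "norm (W c x) * w (int l) powr (Re c + 1/2)
        \<le> C * T * w (int l) powr (- Re (1 + 2 * c) / 2) * w (int l) powr (Re c + 1/2)"
      by (intro mult_right_mono) auto
    also have "\<dots> = C * T * w (int l) powr (- Re (1 + 2 * c) / 2 + (Re c + 1/2))"
      by (simp only: powr_add mult.assoc)
    also have "- Re (1 + 2 * c) / 2 + (Re c + 1/2) = 0" by (simp add: field_simps)
    also have "C * T * w (int l) powr 0 = C * T" using w_pos[of "int l"] by simp
    finally show "norm (W c (z + of_nat l)) * w (int l) powr (Re c + 1/2) \<le> C * T" unfolding x_def .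
  qed
qed

lemma W_bound:
  "\<exists>C\<ge>0. \<forall>c\<in>cball 0 R. \<forall>l::int. norm (W c (z + of_int l)) \<le> C * w l powr (- (Re c + 1/2))"
proof -
  obtain C1 where C1: "C1 \<ge> 0" "\<And>c. \<And>l::nat. c \<in> cball 0 R \<Longrightarrow>
      norm (W c (z + of_nat l)) * w (int l) powr (Re c + 1/2) \<le> C1" using W_bound_nat[of R z] by blast
  obtain C2 where C2: "C2 \<ge> 0" "\<And>c. \<And>l::nat. c \<in> cball 0 R \<Longrightarrow>
      norm (W c (- z + of_nat l)) * w (int l) powr (Re c + 1/2) \<le> C2" using W_bound_nat[of R "-z"] by blast
  have "norm (W c (z + of_int l)) * w l powr (Re c + 1/2) \<le> max C1 C2" if "c \<in> cball 0 R" for c l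
  proof (cases "l \<ge> 0")
    case True
    then obtain k where "l = int k" using nonneg_int_cases by blast
    then show ?thesis using C1(2)[OF that, of k] by simp
  next
    case False
    then obtain k where k: "l = - int k" using int_cases2 by (metis of_nat_0_le_iff)
    have "W c (z + of_int l) = W c (- z + of_nat k)" using W_minus[of c "z + of_int l"] k by simp
    then show ?thesis using C2(2)[OF that, of k] k w_minus by simp
  qed
  then have "norm (W c (z + of_int l)) \<le> max C1 C2 * w l powr (- (Re c + 1/2))" if "c \<in> cball 0 R" for c l
    using that w_pos[of l] unfolding powr_minus by (simp add: field_simps)
  then show ?thesis using C1(1) by (intro exI[of _ "max C1 C2"]) auto
qed

text \<open>Since theta = br * W 0, the reciprocal of W 0 is br / theta, and theta has constant
  nonzero modulus along the orbit.\<close>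

lemma inverse_W0_bound:
  assumes "nz z"
  shows "\<exists>C\<ge>0. \<forall>l. norm (1 / W 0 (z + of_int l)) \<le> C * w l powr (1/2)"
proof -
  obtain C where C: "\<And>l. norm (br (z + of_int l)) \<le> C * w l powr (1/2)" using br_bound by blast
  have th: "theta z \<noteq> 0" using nz_theta[OF assms] .
  have "norm (1 / W 0 (z + of_int l)) \<le> C / norm (theta z) * w l powr (1/2)" for l
  proof -
    have "1 / W 0 (z + of_int l) = br (z + of_int l) / theta (z + of_int l)"
      using theta_eq_W nz_br(1)[OF assms] nz_W0[OF nz_add_int[OF assms]] by simp
    then show ?thesis using C[of l] th by (simp add: norm_divide norm_theta_int divide_right_mono)
  qed
  moreover have "C \<ge> 0"
  proof -
    have "0 \<le> C * w 0 powr (1/2)" using C[of 0] norm_ge_zero order_trans by blast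
    moreover have "w 0 powr (1/2) > 0" using w_pos[of 0] by simp
    ultimately show ?thesis by (simp add: zero_le_mult_iff)
  qed
  ultimately show ?thesis by (intro exI[of _ "C / norm (theta z)"]) auto
qed

lemma inverse_br_bound:
  assumes "nz z"
  shows "\<exists>C\<ge>0. \<forall>l. norm (1 / br (z + of_int l)) \<le> C"
proof -
  obtain C where C: "C \<ge> 0" "\<And>l::int. norm (W 0 (z + of_int l)) \<le> C * w l powr (- (Re 0 + 1/2))"
    using W_bound[of 1 z] by (metis centre_in_cball zero_le_one)
  have th: "theta z \<noteq> 0" using nz_theta[OF assms] .
  have "norm (1 / br (z + of_int l)) \<le> C / norm (theta z)" for l
  proof -
    have "1 / br (z + of_int l) = W 0 (z + of_int l) / theta (z + of_int l)"
      using theta_eq_W nz_br(1)[OF assms] nz_W0[OF nz_add_int[OF assms]] by simp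
    moreover have "norm (W 0 (z + of_int l)) \<le> C"
    proof -
      have "w l powr (-1/2) \<le> 1" using w_ge_1[of l] powr_mono[of "-1/2" 0 "w l"] by simp
      then show ?thesis using C(2)[of l] C(1) mult_left_mono[of "w l powr (-1/2)" 1 C] by simp
    qed
    ultimately show ?thesis using th by (simp add: norm_divide norm_theta_int divide_right_mono)
  qed
  then show ?thesis using C(1) by (intro exI[of _ "C / norm (theta z)"]) auto
qed

section \<open>The factors of the summand and their bounds\<close>

definition pr :: "complex \<Rightarrow> complex \<Rightarrow> complex \<Rightarrow> complex" where
  "pr g s t = W g (s + t) * W g (s - t) / (W 0 (s + t) * W 0 (s - t))"

definition sg :: "complex \<Rightarrow> complex \<Rightarrow> complex \<Rightarrow> complex \<Rightarrow> complex \<Rightarrow> complex" where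
  "sg a b c d s = W a s * W b s * W c s * W d s / W 0 (2 * s)"

definition Phi :: "nat \<Rightarrow> complex \<Rightarrow> complex \<Rightarrow> complex \<Rightarrow> complex \<Rightarrow> complex \<Rightarrow> (nat \<Rightarrow> complex) \<Rightarrow> complex" where
  "Phi n g a b c d x = (\<Prod>j\<in>{1..n}. \<Prod>k\<in>{j+1..n}. pr g (x j) (x k)) * (\<Prod>j\<in>{1..n}. sg a b c d (x j))"

text \<open>Loss caused by one pair of coordinates. Each half of \<open>pr\<close> is of order w (l
  + m) or w (l - m) to the power - Re g. This is harmless for Re g nonnegative, and otherwise
  submultiplicativity of \<open>w\<close> distributes it over the two coordinates.\<close>

definition neg :: "complex \<Rightarrow> real" where "neg g = 2 * max 0 (- Re g)"

lemma pr_half_bound: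
  assumes "nz z"
  shows "\<exists>C\<ge>0. \<forall>g\<in>cball 0 R. \<forall>l. norm (W g (z + of_int l) / W 0 (z + of_int l)) \<le> C * w l powr (- Re g)"
proof -
  obtain C1 where C1: "C1 \<ge> 0" "\<And>c. \<And>l::int. c\<in>cball 0 R \<Longrightarrow> norm (W c (z + of_int l)) \<le> C1 * w l powr (- (Re c + 1/2))"
    using W_bound[of R z] by blast
  obtain C2 where C2: "C2 \<ge> 0" "\<And>l. norm (1 / W 0 (z + of_int l)) \<le> C2 * w l powr (1/2)"
    using inverse_W0_bound[OF assms] by blast
  have main: "norm (W g (z + of_int l) / W 0 (z + of_int l)) \<le> C1 * C2 * w l powr (- Re g)"
    if "g \<in> cball 0 R" for g l
  proof -
    have "norm (W g (z + of_int l) / W 0 (z + of_int l))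
        = norm (W g (z + of_int l)) * norm (1 / W 0 (z + of_int l))" by (simp add: norm_divide)
    also have "\<dots> \<le> (C1 * w l powr (- (Re g + 1/2))) * (C2 * w l powr (1/2))"
      using C1(1) C2(1) by (intro mult_mono C1(2)[OF that] C2(2)) auto
    also have "\<dots> = C1 * C2 * (w l powr (- (Re g + 1/2)) * w l powr (1/2))" by simp
    also have "\<dots> = C1 * C2 * w l powr (- Re g)" by (subst powr_add[symmetric]) simp
    finally show ?thesis .
  qed
  show ?thesis
    by (intro exI[of _ "C1 * C2"] conjI mult_nonneg_nonneg ballI allI C1(1) C2(1) main)
qed

lemma pr_bound:
  assumes "nz (s + t)" "nz (s - t)"
  shows "\<exists>C\<ge>0. \<forall>g\<in>cball 0 R. \<forall>l m. norm (pr g (s + of_int l) (t + of_int m)) \<le> C * (w l * w m) powr neg g"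
proof -
  obtain C1 where C1: "C1 \<ge> 0" "\<And>g l. g\<in>cball 0 R \<Longrightarrow>
      norm (W g (s + t + of_int l) / W 0 (s + t + of_int l)) \<le> C1 * w l powr (- Re g)"
    using pr_half_bound[OF assms(1)] by blast
  obtain C2 where C2: "C2 \<ge> 0" "\<And>g l. g\<in>cball 0 R \<Longrightarrow>
      norm (W g (s - t + of_int l) / W 0 (s - t + of_int l)) \<le> C2 * w l powr (- Re g)"
    using pr_half_bound[OF assms(2)] by blast
  have key: "w k powr (- Re g) \<le> (w l * w m) powr max 0 (- Re g)" if "k = l + m \<or> k = l - m" for k l m g
  proof -
    have "w k \<le> w l * w m" using that w_add[of l m] w_add[of l "-m"] w_minus[of m] by auto
    moreover have "w k powr (- Re g) \<le> w k powr max 0 (- Re g)" using w_ge_1 by (intro powr_mono) auto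
    ultimately show ?thesis using w_nonneg[of k] powr_mono2[of "max 0 (- Re g)" "w k" "w l * w m"] by fastforce
  qed
  have main: "norm (pr g (s + of_int l) (t + of_int m)) \<le> C1 * C2 * (w l * w m) powr neg g" if g: "g \<in> cball 0 R" for g l m
  proof -
    have "s + of_int l + (t + of_int m) = s + t + of_int (l + m)" "s + of_int l - (t + of_int m) = s - t + of_int (l - m)"
      by simp_all
    then have "pr g (s + of_int l) (t + of_int m) =
       (W g (s + t + of_int (l + m)) / W 0 (s + t + of_int (l + m))) *
       (W g (s - t + of_int (l - m)) / W 0 (s - t + of_int (l - m)))"
      unfolding pr_def by (simp only: times_divide_times_eq)
    then have "norm (pr g (s + of_int l) (t + of_int m)) =
       norm (W g (s + t + of_int (l + m)) / W 0 (s + t + of_int (l + m))) *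
       norm (W g (s - t + of_int (l - m)) / W 0 (s - t + of_int (l - m)))"
      by (simp only: norm_mult)
    also have "\<dots> \<le> (C1 * w (l + m) powr (- Re g)) * (C2 * w (l - m) powr (- Re g))"
      using C1(1) C2(1) by (intro mult_mono C1(2)[OF g] C2(2)[OF g]) auto
    also have "\<dots> \<le> (C1 * (w l * w m) powr max 0 (- Re g)) * (C2 * (w l * w m) powr max 0 (- Re g))"
      using C1(1) C2(1) key by (intro mult_mono mult_nonneg_nonneg) auto
    also have "\<dots> = C1 * C2 * ((w l * w m) powr max 0 (- Re g) * (w l * w m) powr max 0 (- Re g))" by simp
    also have "\<dots> = C1 * C2 * (w l * w m) powr neg g"
      unfolding neg_def by (subst powr_add[symmetric]) simp
    finally show ?thesis .
  qed
  show ?thesis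
    by (intro exI[of _ "C1 * C2"] conjI mult_nonneg_nonneg ballI allI C1(1) C2(1) main)
qed

text \<open>The four numerators contribute the exponent - Re (a + b + c + d) - 2. The reciprocal of
  W 0 at the doubled argument gives back one power of \<open>w\<close> together with
  \<open>\<eta>\<close>, by \<open>w_double\<close>.\<close>

lemma sg_bound:
  assumes "nz (2 * s)"
  shows "\<exists>C\<ge>0. \<forall>a\<in>cball 0 R. \<forall>b\<in>cball 0 R. \<forall>c\<in>cball 0 R. \<forall>d\<in>cball 0 R. \<forall>l.
    norm (sg a b c d (s + of_int l)) \<le> C * (w l powr (- (1 + Re (a + b + c + d))) * \<eta> l)"
proof -
  obtain C1 where C1: "C1 \<ge> 0" "\<And>c. \<And>l::int. c\<in>cball 0 R \<Longrightarrow> norm (W c (s + of_int l)) \<le> C1 * w l powr (- (Re c + 1/2))"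
    using W_bound[of R s] by blast
  obtain C2 where C2: "C2 \<ge> 0" "\<And>l. norm (1 / W 0 (2 * s + of_int l)) \<le> C2 * w l powr (1/2)"
    using inverse_W0_bound[OF assms] by blast
  obtain C3 where C3: "\<And>l. w (2 * l) powr (1/2) \<le> C3 * (w l * \<eta> l)" using w_double by blast
  have C3': "C3 * (w l * \<eta> l) \<ge> 0" for l using C3[of l] powr_ge_zero order_trans by blast
  have main: "norm (sg a b c d (s + of_int l)) \<le> (C1 ^ 4 * C2 * max C3 0) * (w l powr (- (1 + Re (a + b + c + d))) * \<eta> l)"
    if A: "a\<in>cball 0 R" "b\<in>cball 0 R" "c\<in>cball 0 R" "d\<in>cball 0 R" for a b c d l
  proof -
    have "2 * (s + of_int l) = 2 * s + of_int (2 * l)" by simp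
    then have eq: "sg a b c d (s + of_int l) = W a (s + of_int l) * W b (s + of_int l) * W c (s + of_int l) * W d (s + of_int l)
        * (1 / W 0 (2 * s + of_int (2 * l)))"
      unfolding sg_def by (simp only: times_divide_eq_right mult_1_right)
    have l2: "norm (1 / W 0 (2 * s + of_int (2 * l))) \<le> C2 * (max C3 0 * (w l * \<eta> l))"
    proof -
      have "norm (1 / W 0 (2 * s + of_int (2 * l))) \<le> C2 * w (2 * l) powr (1/2)" using C2(2) by blast
      also have "\<dots> \<le> C2 * (C3 * (w l * \<eta> l))" using C2(1) C3 by (intro mult_left_mono) auto
      also have "\<dots> \<le> C2 * (max C3 0 * (w l * \<eta> l))" using C2(1) w_nonneg eta_nonneg
        by (intro mult_left_mono mult_right_mono) auto
      finally show ?thesis .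
    qed
    have "norm (sg a b c d (s + of_int l)) \<le> (C1 * w l powr (- (Re a + 1/2))) * (C1 * w l powr (- (Re b + 1/2)))
       * (C1 * w l powr (- (Re c + 1/2))) * (C1 * w l powr (- (Re d + 1/2))) * (C2 * (max C3 0 * (w l * \<eta> l)))"
      unfolding eq norm_mult using C1(1) C2(1) w_nonneg eta_nonneg
      by (intro mult_mono mult_nonneg_nonneg C1(2)[OF A(1)] C1(2)[OF A(2)] C1(2)[OF A(3)] C1(2)[OF A(4)] l2) auto
    also have "\<dots> = (C1 ^ 4 * C2 * max C3 0) * (w l powr (- (Re a + 1/2)) * w l powr (- (Re b + 1/2))
       * w l powr (- (Re c + 1/2)) * w l powr (- (Re d + 1/2)) * w l powr 1 * \<eta> l)"
      using w_pos[of l] by (simp only: power4_eq_xxxx mult_ac powr_one)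
    also have "\<dots> = (C1 ^ 4 * C2 * max C3 0) * (w l powr (- (1 + Re (a + b + c + d))) * \<eta> l)"
      unfolding powr_add[symmetric] by (simp add: algebra_simps)
    finally show ?thesis .
  qed
  show ?thesis
    by (intro exI[of _ "C1 ^ 4 * C2 * max C3 0"] conjI mult_nonneg_nonneg ballI allI zero_le_power C1(1) C2(1) max.cobounded2 main)
qed

end

section \<open>Absolute convergence and holomorphy of the multiple sum\<close>

lemma summable_on_prod_PiE:
  fixes f :: "'a \<Rightarrow> 'b \<Rightarrow> real"
  assumes "finite A" and nonneg: "\<And>j l. j \<in> A \<Longrightarrow> 0 \<le> f j l" and "\<And>j. j \<in> A \<Longrightarrow> f j summable_on UNIV"
  shows "(\<lambda>l. \<Prod>j\<in>A. f j (l j)) summable_on (A \<rightarrow>\<^sub>E UNIV)"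
proof (rule nonneg_bdd_above_summable_on)
  fix l :: "'a \<Rightarrow> 'b" show "0 \<le> (\<Prod>j\<in>A. f j (l j))" using nonneg by (intro prod_nonneg) auto
next
  have "sum (\<lambda>l. \<Prod>j\<in>A. f j (l j)) X \<le> (\<Prod>j\<in>A. infsum (f j) UNIV)"
    if X: "X \<subseteq> A \<rightarrow>\<^sub>E UNIV" "finite X" for X
  proof -
    \<comment> \<open>A finite set of functions lies in a finite box, and over a box the sum of
      products factors.\<close>
    define B where "B j = (\<lambda>l. l j) ` X" for j
    have fB: "finite (B j)" for j unfolding B_def using X by auto
    have "X \<subseteq> Pi\<^sub>E A B" unfolding B_def using X by (auto simp: PiE_iff)
    then have "sum (\<lambda>l. \<Prod>j\<in>A. f j (l j)) X \<le> sum (\<lambda>l. \<Prod>j\<in>A. f j (l j)) (Pi\<^sub>E A B)"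
      using nonneg fB assms(1) by (intro sum_mono2 finite_PiE prod_nonneg) auto
    also have "\<dots> = (\<Prod>j\<in>A. \<Sum>l\<in>B j. f j l)"
      using assms(1) fB by (subst prod_sum_PiE) auto
    also have "\<dots> \<le> (\<Prod>j\<in>A. infsum (f j) UNIV)"
      using nonneg fB assms by (intro prod_mono conjI sum_nonneg finite_sum_le_infsum) auto
    finally show ?thesis .
  qed
  then show "bdd_above (sum (\<lambda>l. \<Prod>j\<in>A. f j (l j)) ` {F. F \<subseteq> A \<rightarrow>\<^sub>E UNIV \<and> finite F})"
    by (intro bdd_aboveI2) auto
qed

lemma prod_pairs_Suc:
  fixes f :: "nat \<Rightarrow> nat \<Rightarrow> 'a::comm_monoid_mult"
  shows "(\<Prod>j\<in>{1..Suc n}. \<Prod>k\<in>{j+1..Suc n}. f j k) =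
    (\<Prod>j\<in>{1..n}. \<Prod>k\<in>{j+1..n}. f j k) * (\<Prod>j\<in>{1..n}. f j (Suc n))"
proof -
  have "(\<Prod>j\<in>{1..Suc n}. \<Prod>k\<in>{j+1..Suc n}. f j k) = (\<Prod>j\<in>{1..n}. \<Prod>k\<in>{j+1..Suc n}. f j k)"
    by (simp add: prod.cl_ivl_Suc)
  also have "\<dots> = (\<Prod>j\<in>{1..n}. (\<Prod>k\<in>{j+1..n}. f j k) * f j (Suc n))"
    by (intro prod.cong refl) (auto simp: prod.cl_ivl_Suc)
  finally show ?thesis by (simp add: prod.distrib)
qed

text \<open>Each index belongs to n - 1 pairs; this is where the factor n - 1 in
  \<open>decay\<close> comes from.\<close>

lemma prod_pairs_mult:
  fixes u :: "nat \<Rightarrow> 'a::comm_monoid_mult"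
  shows "(\<Prod>j\<in>{1..n}. \<Prod>k\<in>{j+1..n}. u j * u k) = (\<Prod>j\<in>{1..n}. u j ^ (n - 1))"
proof (induction n)
  case (Suc n)
  have "(\<Prod>j\<in>{1..Suc n}. \<Prod>k\<in>{j+1..Suc n}. u j * u k)
      = (\<Prod>j\<in>{1..n}. u j ^ (n - 1)) * (\<Prod>j\<in>{1..n}. u j * u (Suc n))"
    using Suc unfolding prod_pairs_Suc by simp
  also have "\<dots> = (\<Prod>j\<in>{1..n}. u j ^ (n - 1) * u j) * u (Suc n) ^ n"
    by (simp add: prod.distrib mult_ac)
  also have "(\<Prod>j\<in>{1..n}. u j ^ (n - 1) * u j) = (\<Prod>j\<in>{1..n}. u j ^ n)"
    by (intro prod.cong refl) (metis Suc_pred' atLeastAtMost_iff less_eq_Suc_le power_Suc2 One_nat_def le_trans)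
  finally show ?case by simp
qed simp

context gamma_like
begin

definition admissible :: "nat \<Rightarrow> (nat \<Rightarrow> complex) \<Rightarrow> bool" where
  "admissible n z \<longleftrightarrow> (\<forall>j\<in>{1..n}. nz (2 * z j)) \<and> (\<forall>j k. 1 \<le> j \<longrightarrow> j < k \<longrightarrow> k \<le> n \<longrightarrow> nz (z j + z k) \<and> nz (z j - z k))"

definition shifted :: "(nat \<Rightarrow> complex) \<Rightarrow> (nat \<Rightarrow> int) \<Rightarrow> nat \<Rightarrow> complex" where
  "shifted z l = (\<lambda>j. z j + of_int (l j))"

text \<open>Exponent left to each coordinate after the n - 1 pairs containing it have each cost
  \<open>neg g\<close>. For n at least 1, its positivity amounts to the convergence hypothesis of
  the theorem at j = n and j = 1.\<close>

definition decay :: "nat \<Rightarrow> complex \<Rightarrow> complex \<Rightarrow> real" where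
  "decay n g G = 1 + Re G - real (n - 1) * neg g"

definition wt :: "nat \<Rightarrow> real \<Rightarrow> (nat \<Rightarrow> int) \<Rightarrow> real" where
  "wt n \<sigma> l = (\<Prod>j\<in>{1..n}. w (l j) powr (- \<sigma>) * \<eta> (l j))"

lemma wt_nonneg: "wt n \<sigma> l \<ge> 0"
  unfolding wt_def using eta_nonneg by (intro prod_nonneg) auto

lemma wt_antimono: "\<sigma> \<le> \<tau> \<Longrightarrow> wt n \<tau> l \<le> wt n \<sigma> l"
  unfolding wt_def using eta_nonneg w_ge_1
  by (intro prod_mono conjI mult_right_mono mult_nonneg_nonneg powr_mono) auto

lemma wt_summable: "\<sigma> > 0 \<Longrightarrow> wt n \<sigma> summable_on int_vectors n"
  unfolding wt_def[abs_def] int_vectors_def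
  using summable_on_prod_PiE[of "{1..n}" "\<lambda>j l. w l powr (- \<sigma>) * \<eta> l"] eta_nonneg eta_summable by simp

lemma Phi_bound:
  assumes "admissible n z"
  shows "\<exists>C\<ge>0. \<forall>g\<in>cball 0 R. \<forall>a\<in>cball 0 R. \<forall>b\<in>cball 0 R. \<forall>c\<in>cball 0 R. \<forall>d\<in>cball 0 R. \<forall>l.
    norm (Phi n g a b c d (shifted z l)) \<le> C * wt n (decay n g (a + b + c + d)) l"
proof -
  have "\<forall>j k. \<exists>C\<ge>0. 1 \<le> j \<longrightarrow> j < k \<longrightarrow> k \<le> n \<longrightarrow> (\<forall>g\<in>cball 0 R. \<forall>l m.
      norm (pr g (z j + of_int l) (z k + of_int m)) \<le> C * (w l * w m) powr neg g)"
    using pr_bound assms unfolding admissible_def by (metis order_refl)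
  then obtain C1 where C1: "\<And>j k. C1 j k \<ge> 0" "\<And>j k g l m. 1 \<le> j \<Longrightarrow> j < k \<Longrightarrow> k \<le> n \<Longrightarrow> g \<in> cball 0 R \<Longrightarrow>
      norm (pr g (z j + of_int l) (z k + of_int m)) \<le> C1 j k * (w l * w m) powr neg g"
    by metis
  have "\<forall>j. \<exists>C\<ge>0. j \<in> {1..n} \<longrightarrow> (\<forall>a\<in>cball 0 R. \<forall>b\<in>cball 0 R. \<forall>c\<in>cball 0 R. \<forall>d\<in>cball 0 R. \<forall>l.
    norm (sg a b c d (z j + of_int l)) \<le> C * (w l powr (- (1 + Re (a + b + c + d))) * \<eta> l))"
    using sg_bound assms unfolding admissible_def by (metis order_refl)
  then obtain C2 where C2: "\<And>j. C2 j \<ge> 0" "\<And>j a b c d l. j \<in> {1..n} \<Longrightarrow> a\<in>cball 0 R \<Longrightarrow> b\<in>cball 0 R \<Longrightarrow>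
      c\<in>cball 0 R \<Longrightarrow> d\<in>cball 0 R \<Longrightarrow>
    norm (sg a b c d (z j + of_int l)) \<le> C2 j * (w l powr (- (1 + Re (a + b + c + d))) * \<eta> l)"
    by metis
  define C where "C = (\<Prod>j\<in>{1..n}. \<Prod>k\<in>{j+1..n}. C1 j k) * (\<Prod>j\<in>{1..n}. C2 j)"
  have "norm (Phi n g a b c d (shifted z l)) \<le> C * wt n (decay n g (a + b + c + d)) l"
    if A: "g\<in>cball 0 R" "a\<in>cball 0 R" "b\<in>cball 0 R" "c\<in>cball 0 R" "d\<in>cball 0 R" for g a b c d l
  proof -
    let ?G = "a + b + c + d"
    have e: "(w (l j) powr neg g) ^ (n - 1) * w (l j) powr (- (1 + Re (a + b + c + d))) = w (l j) powr (- decay n g (a + b + c + d))" for j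
    proof -
      have "(w (l j) powr neg g) ^ (n - 1) = w (l j) powr (real (n - 1) * neg g)"
        using powr_realpow[of "w (l j) powr neg g" "n - 1"] w_pos[of "l j"] by (simp add: powr_powr mult.commute)
      then show ?thesis unfolding decay_def by (simp add: algebra_simps flip: powr_add)
    qed
    have "norm (Phi n g a b c d (shifted z l)) \<le>
      (\<Prod>j\<in>{1..n}. \<Prod>k\<in>{j+1..n}. C1 j k * (w (l j) * w (l k)) powr neg g) *
      (\<Prod>j\<in>{1..n}. C2 j * (w (l j) powr (- (1 + Re ?G)) * \<eta> (l j)))"
      unfolding Phi_def norm_mult prod_norm[symmetric] shifted_def
      using C1 C2 A eta_nonneg
      by (intro mult_mono prod_mono conjI prod_nonneg norm_ge_zero ballI mult_nonneg_nonneg) auto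
    also have "(\<Prod>j\<in>{1..n}. \<Prod>k\<in>{j+1..n}. C1 j k * (w (l j) * w (l k)) powr neg g)
      = (\<Prod>j\<in>{1..n}. \<Prod>k\<in>{j+1..n}. C1 j k) * (\<Prod>j\<in>{1..n}. (w (l j) powr neg g) ^ (n - 1))"
      unfolding prod_pairs_mult[of "\<lambda>j. w (l j) powr neg g" n, symmetric] using w_nonneg
      by (simp add: prod.distrib powr_mult)
    also have "(\<Prod>j\<in>{1..n}. \<Prod>k\<in>{j+1..n}. C1 j k) * (\<Prod>j\<in>{1..n}. (w (l j) powr neg g) ^ (n - 1)) *
      (\<Prod>j\<in>{1..n}. C2 j * (w (l j) powr (- (1 + Re ?G)) * \<eta> (l j)))
      = C * (\<Prod>j\<in>{1..n}. (w (l j) powr neg g) ^ (n - 1) * w (l j) powr (- (1 + Re ?G)) * \<eta> (l j))"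
      unfolding C_def by (simp add: prod.distrib mult_ac)
    also have "\<dots> = C * wt n (decay n g ?G) l" unfolding wt_def by (simp only: e)
    finally show ?thesis .
  qed
  moreover have "C \<ge> 0" unfolding C_def using C1 C2 by (intro mult_nonneg_nonneg prod_nonneg) auto
  ultimately show ?thesis by blast
qed

definition S :: "nat \<Rightarrow> complex \<Rightarrow> complex \<Rightarrow> complex \<Rightarrow> complex \<Rightarrow> complex \<Rightarrow> (nat \<Rightarrow> complex) \<Rightarrow> complex" where
  "S n g a b c d z = (\<Sum>\<^sub>\<infinity>l\<in>int_vectors n. Phi n g a b c d (shifted z l))"

lemma Phi_abs_summable:
  assumes "admissible n z" and "decay n g (a + b + c + d) > 0"
  shows "(\<lambda>l. norm (Phi n g a b c d (shifted z l))) summable_on int_vectors n"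
proof -
  define R where "R = norm g + norm a + norm b + norm c + norm d"
  obtain C where C: "C \<ge> 0" "\<And>l. norm (Phi n g a b c d (shifted z l)) \<le> C * wt n (decay n g (a + b + c + d)) l"
    using Phi_bound[OF assms(1), of R] unfolding R_def
    by (force simp: add_nonneg_nonneg add_increasing add_increasing2)
  show ?thesis
    by (rule Infinite_Sum.abs_summable_on_comparison_test'[OF summable_on_cmult_right[OF wt_summable[OF assms(2)]]])
      (use C in auto)
qed

text \<open>Locally uniform convergence by the Weierstrass test. All parameters, g included, may
  vary together; this serves both the analytic continuation in a, b, c, d and the limit in
  g.\<close>

lemma S_holomorphic:
  assumes adm: "admissible n z" and U: "open U"
    and hol: "gf holomorphic_on U" "af holomorphic_on U" "bf holomorphic_on U" "cf holomorphic_on U" "df holomorphic_on U"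
    and dec: "\<And>t. t \<in> U \<Longrightarrow> decay n (gf t) (af t + bf t + cf t + df t) > 0"
  shows "(\<lambda>t. S n (gf t) (af t) (bf t) (cf t) (df t) z) holomorphic_on U"
proof -
  have "\<exists>r>0. (\<lambda>t. S n (gf t) (af t) (bf t) (cf t) (df t) z) holomorphic_on ball t0 r" if t0: "t0 \<in> U" for t0
  proof -
    obtain r where r: "r > 0" "cball t0 r \<subseteq> U" using U t0 open_contains_cball by blast
    have cont: "continuous_on (cball t0 r) gf" "continuous_on (cball t0 r) af" "continuous_on (cball t0 r) bf"
       "continuous_on (cball t0 r) cf" "continuous_on (cball t0 r) df"
      using hol r(2) by (auto intro: holomorphic_on_imp_continuous_on holomorphic_on_subset)
    have bdd: "\<exists>B. \<forall>t\<in>cball t0 r. norm (f t) \<le> B" if "continuous_on (cball t0 r) f" for f :: "complex \<Rightarrow> complex"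
    proof -
      have "bounded (f ` cball t0 r)" using that by (intro compact_imp_bounded compact_continuous_image) auto
      then show ?thesis unfolding bounded_iff by blast
    qed
    obtain B1 B2 B3 B4 B5 where B: "\<And>t. t \<in> cball t0 r \<Longrightarrow> norm (gf t) \<le> B1" "\<And>t. t \<in> cball t0 r \<Longrightarrow> norm (af t) \<le> B2"
      "\<And>t. t \<in> cball t0 r \<Longrightarrow> norm (bf t) \<le> B3" "\<And>t. t \<in> cball t0 r \<Longrightarrow> norm (cf t) \<le> B4" "\<And>t. t \<in> cball t0 r \<Longrightarrow> norm (df t) \<le> B5"
      using cont[THEN bdd] by metis
    define R where "R = max B1 (max B2 (max B3 (max B4 B5)))"
    have BR: "gf t \<in> cball 0 R" "af t \<in> cball 0 R" "bf t \<in> cball 0 R" "cf t \<in> cball 0 R" "df t \<in> cball 0 R"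
      if "t \<in> cball t0 r" for t
      using B[OF that] unfolding R_def by (simp_all only: mem_cball_0 le_max_iff_disj simp_thms)
    define D where "D t = decay n (gf t) (af t + bf t + cf t + df t)" for t
    \<comment> \<open>The least decay over the closed ball is attained, hence positive, so one
      summable majorant serves the whole ball.\<close>
    have "continuous_on (cball t0 r) D"
      unfolding D_def decay_def neg_def using cont by (intro continuous_intros)
    then obtain tm where tm: "tm \<in> cball t0 r" "\<And>t. t \<in> cball t0 r \<Longrightarrow> D tm \<le> D t"
      using continuous_attains_inf[of "cball t0 r" D] r(1) by auto
    have Dpos: "D tm > 0" using dec r(2) tm(1) unfolding D_def by blast
    obtain C where C: "C \<ge> 0" "\<And>g a b c d l. g\<in>cball 0 R \<Longrightarrow> a\<in>cball 0 R \<Longrightarrow> b\<in>cball 0 R \<Longrightarrow> c\<in>cball 0 R \<Longrightarrow>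
        d\<in>cball 0 R \<Longrightarrow> norm (Phi n g a b c d (shifted z l)) \<le> C * wt n (decay n g (a + b + c + d)) l"
      using Phi_bound[OF adm, of R] by blast
    define P where "P l t = Phi n (gf t) (af t) (bf t) (cf t) (df t) (shifted z l)" for l t
    have le: "norm (P l t) \<le> C * wt n (D tm) l" if "t \<in> cball t0 r" for l t
    proof -
      have "norm (P l t) \<le> C * wt n (D t) l" unfolding P_def D_def using C(2) BR[OF that] by blast
      also have "\<dots> \<le> C * wt n (D tm) l" using wt_antimono[OF tm(2)[OF that]] C(1) by (intro mult_left_mono)
      finally show ?thesis .
    qed
    have ul: "uniform_limit (cball t0 r) (\<lambda>X t. \<Sum>l\<in>X. P l t) (\<lambda>t. \<Sum>\<^sub>\<infinity>l\<in>int_vectors n. P l t)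
        (finite_subsets_at_top (int_vectors n))"
      using le by (intro Weierstrass_m_test_general[of _ _ _ "\<lambda>l. C * wt n (D tm) l"]
        summable_on_cmult_right wt_summable Dpos) auto
    have holP: "P l holomorphic_on U" for l
    proof -
      have nzW: "W 0 (shifted z l j + shifted z l k) \<noteq> 0" "W 0 (shifted z l j - shifted z l k) \<noteq> 0"
        if "1 \<le> j" "j < k" "k \<le> n" for j k
      proof -
        have "nz (z j + z k)" "nz (z j - z k)" using adm that unfolding admissible_def by auto
        from nz_W0[OF nz_add_int[OF this(1), of "l j + l k"]] nz_W0[OF nz_add_int[OF this(2), of "l j - l k"]]
        show "W 0 (shifted z l j + shifted z l k) \<noteq> 0" "W 0 (shifted z l j - shifted z l k) \<noteq> 0"
          unfolding shifted_def by (simp_all add: algebra_simps)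
      qed
      have nzW2: "W 0 (2 * shifted z l j) \<noteq> 0" if "j \<in> {1..n}" for j
      proof -
        have "nz (2 * z j)" using adm that unfolding admissible_def by auto
        from nz_W0[OF nz_add_int[OF this, of "2 * l j"]]
        show ?thesis unfolding shifted_def by (simp add: algebra_simps)
      qed
      show ?thesis
        unfolding P_def Phi_def pr_def sg_def W_def[of "gf _"] W_def[of "af _"] W_def[of "bf _"] W_def[of "cf _"] W_def[of "df _"]
        using nzW nzW2 by (intro holomorphic_intros hol) auto
    qed
    have "(\<lambda>t. \<Sum>\<^sub>\<infinity>l\<in>int_vectors n. P l t) holomorphic_on ball t0 r"
    proof (rule holomorphic_uniform_limit[OF _ ul])
      show "\<forall>\<^sub>F X in finite_subsets_at_top (int_vectors n).
         continuous_on (cball t0 r) (\<lambda>t. \<Sum>l\<in>X. P l t) \<and> (\<lambda>t. \<Sum>l\<in>X. P l t) holomorphic_on ball t0 r"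
      proof (rule always_eventually, rule allI, rule conjI)
        fix X
        have *: "(\<lambda>t. \<Sum>l\<in>X. P l t) holomorphic_on U" by (intro holomorphic_intros holP)
        show "continuous_on (cball t0 r) (\<lambda>t. \<Sum>l\<in>X. P l t)"
          by (rule holomorphic_on_imp_continuous_on[OF holomorphic_on_subset[OF * r(2)]])
        show "(\<lambda>t. \<Sum>l\<in>X. P l t) holomorphic_on ball t0 r"
          using holomorphic_on_subset[OF *] r(2) ball_subset_cball by blast
      qed
    qed auto
    then show ?thesis using r(1) unfolding S_def P_def by blast
  qed
  then show ?thesis
    using U by (meson holomorphic_on_open holomorphic_onI centre_in_ball field_differentiable_at_within
      holomorphic_on_imp_differentiable_at open_ball)
qed

end

section \<open>Newton interpolation coefficients\<close>

primrec newton :: "(nat \<Rightarrow> complex) \<Rightarrow> (nat \<Rightarrow> complex) \<Rightarrow> nat \<Rightarrow> nat \<Rightarrow> complex" where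
  "newton y X 0 = (\<lambda>m. if m = 0 then 1 else 0)"
| "newton y X (Suc n) = (\<lambda>m. (y m - X (Suc n)) * newton y X n m - (if m = 0 then 0 else newton y X n (m - 1)))"

lemma newton_eq_0: "n < m \<Longrightarrow> newton y X n m = 0"
  by (induction n arbitrary: m) auto

lemma newton_diag: "newton y X n n = (-1) ^ n"
  by (induction n) (auto simp: newton_eq_0)

lemma newton_0: "newton y X n 0 = (\<Prod>k\<in>{1..n}. y 0 - X k)"
  by (induction n) (auto simp: mult.commute)

text \<open>Writing p_m for the product of the first m factors y i - t, one has (t - X) p_m = (y m -
  X) p_m - p_(m+1). The recursion defining \<open>newton\<close> is this relation read off on
  coefficients.\<close>

lemma newton_expansion:
  "(\<Prod>k\<in>{1..n}. t - X k) = (\<Sum>m\<le>n. newton y X n m * (\<Prod>i<m. y i - t))"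
proof (induction n)
  case (Suc n)
  let ?p = "\<lambda>m. \<Prod>i<m. y i - t"
  have "(\<Sum>m\<le>Suc n. newton y X (Suc n) m * ?p m)
      = (\<Sum>m\<le>Suc n. (y m - X (Suc n)) * newton y X n m * ?p m)
        - (\<Sum>m\<le>Suc n. (if m = 0 then 0 else newton y X n (m - 1)) * ?p m)"
    unfolding sum_subtractf[symmetric] by (intro sum.cong refl) (simp add: left_diff_distrib)
  also have "(\<Sum>m\<le>Suc n. (if m = 0 then 0 else newton y X n (m - 1)) * ?p m) = (\<Sum>m\<le>n. newton y X n m * ?p (Suc m))"
    by (subst sum.atMost_Suc_shift) simp
  also have "(\<Sum>m\<le>Suc n. (y m - X (Suc n)) * newton y X n m * ?p m) = (\<Sum>m\<le>n. (y m - X (Suc n)) * newton y X n m * ?p m)"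
    by (simp add: newton_eq_0)
  also have "\<dots> - (\<Sum>m\<le>n. newton y X n m * ?p (Suc m)) = (\<Sum>m\<le>n. (t - X (Suc n)) * (newton y X n m * ?p m))"
    unfolding sum_subtractf[symmetric] by (intro sum.cong refl) (simp add: algebra_simps)
  also have "\<dots> = (\<Prod>k\<in>{1..Suc n}. t - X k)"
    unfolding sum_distrib_left[symmetric] Suc[symmetric] by simp
  finally show ?case ..
qed simp

lemma newton_norm_le:
  assumes "\<And>m. m \<le> n \<Longrightarrow> norm (y m) \<le> A" and "m \<le> n"
  shows "norm (newton y X n m) \<le> (\<Prod>k\<in>{1..n}. 1 + A + norm (X k))"
  using assms
proof (induction n arbitrary: m)
  case (Suc n)
  let ?P = "\<Prod>k\<in>{1..n}. 1 + A + norm (X k)"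
  have A: "A \<ge> 0" using Suc.prems(1)[of 0] norm_ge_zero[of "y 0"] by linarith
  have P: "?P \<ge> 0" using A by (intro prod_nonneg) auto
  have IH: "norm (newton y X n m') \<le> ?P" for m'
  proof (cases "m' \<le> n")
    case True
    then show ?thesis using Suc.IH Suc.prems by simp
  next
    case False
    then show ?thesis using newton_eq_0 P by simp
  qed
  have "norm (newton y X (Suc n) m) \<le> norm ((y m - X (Suc n)) * newton y X n m) + norm (if m = 0 then 0 else newton y X n (m - 1))"
    by (simp only: newton.simps norm_triangle_ineq4)
  also have "\<dots> \<le> (A + norm (X (Suc n))) * ?P + ?P"
  proof (intro add_mono)
    show "norm ((y m - X (Suc n)) * newton y X n m) \<le> (A + norm (X (Suc n))) * ?P"
      unfolding norm_mult using IH Suc.prems norm_triangle_ineq4[of "y m" "X (Suc n)"] A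
      by (intro mult_mono) (auto intro: order_trans add_right_mono)
    show "norm (if m = 0 then 0 else newton y X n (m - 1)) \<le> ?P" using IH P by simp
  qed
  also have "\<dots> = (\<Prod>k\<in>{1..Suc n}. 1 + A + norm (X k))" by (simp add: algebra_simps)
  finally show ?case .
qed simp

text \<open>At t = y 0 only the coefficient d 0 survives. After division by y 0 - t the remaining
  combination vanishes off y 0, hence also at y 0 by continuity, and induction applies.\<close>

lemma newton_basis_independent:
  fixes y d :: "nat \<Rightarrow> complex"
  assumes "\<And>t. (\<Sum>m<n. d m * (\<Prod>i<m. y i - t)) = 0" and "m < n"
  shows "d m = 0"
  using assms
proof (induction n arbitrary: y d m)
  case (Suc n)
  have split: "(\<Sum>m<Suc n. d m * (\<Prod>i<m. y i - t)) = d 0 + (y 0 - t) * (\<Sum>m<n. d (Suc m) * (\<Prod>i<m. y (Suc i) - t))" for t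
    by (subst sum.lessThan_Suc_shift)
       (simp add: prod.lessThan_Suc_shift sum_distrib_left algebra_simps del: prod.lessThan_Suc)
  have d0: "d 0 = 0" using split[of "y 0"] Suc.prems(1)[of "y 0"] by simp
  define f where "f t = (\<Sum>m<n. d (Suc m) * (\<Prod>i<m. y (Suc i) - t))" for t
  have f0: "f t = 0" if "t \<noteq> y 0" for t
    using split[of t] Suc.prems(1)[of t] d0 that unfolding f_def by simp
  have "isCont f (y 0)" unfolding f_def by (intro continuous_intros)
  then have "(f \<longlongrightarrow> f (y 0)) (at (y 0))" by (simp add: isCont_def)
  moreover have "(f \<longlongrightarrow> 0) (at (y 0))"
    by (rule tendsto_eventually) (auto simp: eventually_at_filter f0)
  ultimately have "f (y 0) = 0" using tendsto_unique[of "at (y 0)"] by simp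
  then have "f t = 0" for t using f0 by (cases "t = y 0") auto
  then have "d (Suc m) = 0" if "m < n" for m
    using Suc.IH[of "\<lambda>m. d (Suc m)" "\<lambda>i. y (Suc i)" m] that unfolding f_def by blast
  then show ?case using d0 Suc.prems(2) by (cases m) auto
qed simp

lemma prod_pairs_split:
  fixes f :: "nat \<Rightarrow> nat \<Rightarrow> 'a::comm_monoid_mult"
  assumes sym: "\<And>j k. f j k = f k j" and i: "i \<in> {1..n}"
  shows "(\<Prod>j\<in>{1..n}. \<Prod>k\<in>{j+1..n}. f j k) =
    (\<Prod>k\<in>{1..n}-{i}. f i k) * (\<Prod>j\<in>{1..n}-{i}. \<Prod>k\<in>{j+1..n}-{i}. f j k)"
proof -
  have inner: "(\<Prod>k\<in>{j+1..n}. f j k) = (if j < i then f i j else 1) * (\<Prod>k\<in>{j+1..n}-{i}. f j k)"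
    if "j \<in> {1..n}-{i}" for j
  proof (cases "j < i")
    case True
    then have "i \<in> {j+1..n}" using i by auto
    then show ?thesis using True sym by (subst prod.remove[of _ i]) auto
  next
    case False
    then have "{j+1..n}-{i} = {j+1..n}" using that by auto
    then show ?thesis using False by simp
  qed
  have "(\<Prod>j\<in>{1..n}. \<Prod>k\<in>{j+1..n}. f j k) = (\<Prod>k\<in>{i+1..n}. f i k) * (\<Prod>j\<in>{1..n}-{i}. \<Prod>k\<in>{j+1..n}. f j k)"
    using i by (subst prod.remove[of _ i]) auto
  also have "(\<Prod>j\<in>{1..n}-{i}. \<Prod>k\<in>{j+1..n}. f j k)
      = (\<Prod>j\<in>{1..n}-{i}. if j < i then f i j else 1) * (\<Prod>j\<in>{1..n}-{i}. \<Prod>k\<in>{j+1..n}-{i}. f j k)"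
    by (subst prod.distrib[symmetric]) (intro prod.cong refl inner)
  also have "(\<Prod>j\<in>{1..n}-{i}. if j < i then f i j else 1) = (\<Prod>j\<in>{1..<i}. f i j)"
    using i by (subst prod.inter_filter[symmetric]) (auto intro!: prod.cong)
  also have "(\<Prod>k\<in>{i+1..n}. f i k) * ((\<Prod>j\<in>{1..<i}. f i j) * (\<Prod>j\<in>{1..n}-{i}. \<Prod>k\<in>{j+1..n}-{i}. f j k))
     = ((\<Prod>k\<in>{i+1..n}. f i k) * (\<Prod>j\<in>{1..<i}. f i j)) * (\<Prod>j\<in>{1..n}-{i}. \<Prod>k\<in>{j+1..n}-{i}. f j k)"
    by (simp add: mult.assoc)
  also have "(\<Prod>k\<in>{i+1..n}. f i k) * (\<Prod>j\<in>{1..<i}. f i j) = (\<Prod>k\<in>{i+1..n} \<union> {1..<i}. f i k)"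
    by (subst prod.union_disjoint) auto
  also have "{i+1..n} \<union> {1..<i} = {1..n}-{i}" using i by auto
  finally show ?thesis .
qed

section \<open>The Askey-Wilson type operator with step g\<close>

context gamma_like
begin

text \<open>Nodes in arithmetic progression of step g starting at a. At t = Y s the product
  \<open>basis\<close> splits into brackets of a + i g + s and a + i g - s, the usual basis for
  Wilson and Askey-Wilson polynomials. There \<open>eigval\<close> and \<open>lower\<close> are the
  diagonal and subdiagonal entries of the operator.\<close>

definition node :: "complex \<Rightarrow> complex \<Rightarrow> nat \<Rightarrow> complex" where
  "node g a i = Y (a + of_nat i * g)"

definition basis :: "complex \<Rightarrow> complex \<Rightarrow> nat \<Rightarrow> complex \<Rightarrow> complex" where
  "basis g a m t = (\<Prod>i<m. node g a i - t)"

definition eigval :: "complex \<Rightarrow> complex \<Rightarrow> nat \<Rightarrow> complex" where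
  "eigval g G m = br (of_nat m * g) * br (G + (of_nat m - 1) * g)"

definition lower :: "complex \<Rightarrow> complex \<Rightarrow> complex \<Rightarrow> complex \<Rightarrow> complex \<Rightarrow> nat \<Rightarrow> complex" where
  "lower g a b c d m = - br (of_nat m * g) * (br (a + b + (of_nat m - 1) * g) *
     br (a + c + (of_nat m - 1) * g) * br (a + d + (of_nat m - 1) * g))"

lemma eigval_0: "eigval g G 0 = 0" and lower_0: "lower g a b c d 0 = 0"
  unfolding eigval_def lower_def using br_0 by simp_all

text \<open>With A m = (G + (2m - 1) g) / 2 and B = (G - g) / 2, the eigenvalue is Y (A m) - Y B. A
  difference of two eigenvalues is then Y (A n) - Y (A m), again a product of two brackets.\<close>

lemma eigval_diff:
  assumes "m \<le> n"
  shows "eigval g G n - eigval g G m = br (of_nat (n - m) * g) * br (G + (of_nat n + of_nat m - 1) * g)"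
proof -
  define A where "A = (\<lambda>m::nat. (G + (2 * of_nat m - 1) * g) / 2)"
  define B where "B = (G - g) / 2"
  have h: "A m + B = G + (of_nat m - 1) * g" "A m - B = of_nat m * g" for m
    unfolding A_def B_def by (simp_all add: field_simps)
  have e: "eigval g G m = Y (A m) - Y B" for m
    unfolding eigval_def using br_Y[of "A m" B] unfolding h by (simp add: mult.commute)
  have k: "A n + A m = G + (of_nat n + of_nat m - 1) * g" "A n - A m = of_nat (n - m) * g"
    unfolding A_def using assms by (simp_all add: field_simps of_nat_diff)
  show ?thesis unfolding e using br_Y[of "A n" "A m"] unfolding k by (simp add: mult.commute)
qed

text \<open>Replacing s by g + s moves both strings of brackets by one step, so the two products
  share all but two factors. The difference of the leftover pairs is itself a product of two
  brackets, by three uses of \<open>br_Y\<close>.\<close>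

lemma basis_diff:
  "basis g a (Suc p) (Y (g + s)) - basis g a (Suc p) (Y s) =
    - br (of_nat (Suc p) * g) * br (g + 2 * s) *
    ((\<Prod>i<p. br (a + of_nat (Suc i) * g + s)) * (\<Prod>i<p. br (a + of_nat i * g - s)))"
proof -
  let ?A = "\<Prod>i<p. br (a + of_nat (Suc i) * g + s)" and ?B = "\<Prod>i<p. br (a + of_nat i * g - s)"
  have b: "basis g a m (Y s) = (\<Prod>i<m. br (a + of_nat i * g + s)) * (\<Prod>i<m. br (a + of_nat i * g - s))" for m s
    unfolding basis_def node_def br_Y[symmetric] by (simp add: prod.distrib)
  have 1: "basis g a (Suc p) (Y s) = ?A * ?B * (br (a + s) * br (a + of_nat p * g - s))"
    unfolding b by (subst prod.lessThan_Suc_shift) (simp del: of_nat_Suc)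
  have shift: "a + of_nat (Suc i) * g - (g + s) = a + of_nat i * g - s" "a + of_nat i * g + (g + s) = a + of_nat (Suc i) * g + s" for i
    by (simp_all add: algebra_simps)
  have 2: "basis g a (Suc p) (Y (g + s)) = ?A * ?B * (br (a + of_nat (Suc p) * g + s) * br (a - g - s))"
  proof -
    have "(\<Prod>i<Suc p. br (a + of_nat i * g + (g + s))) = ?A * br (a + of_nat (Suc p) * g + s)"
      unfolding shift by simp
    moreover have "(\<Prod>i<Suc p. br (a + of_nat i * g - (g + s))) = br (a - g - s) * ?B"
      unfolding prod.lessThan_Suc_shift shift by (simp add: diff_diff_eq)
    ultimately show ?thesis unfolding b by (simp only: mult_ac)
  qed
  define u v1 v2 where "u = (2 * a + of_nat p * g) / 2" and "v1 = ((of_nat p + 2) * g + 2 * s) / 2"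
    and "v2 = (of_nat p * g - 2 * s) / 2"
  have h: "u + v1 = a + of_nat (Suc p) * g + s" "u - v1 = a - g - s" "u + v2 = a + of_nat p * g - s" "u - v2 = a + s"
     "v2 + v1 = of_nat (Suc p) * g" "v2 - v1 = - (g + 2 * s)"
    unfolding u_def v1_def v2_def by (simp_all add: field_simps)
  have "br (a + of_nat (Suc p) * g + s) * br (a - g - s) - br (a + s) * br (a + of_nat p * g - s)
     = br (v2 + v1) * br (v2 - v1)"
    using br_Y[of u v1] br_Y[of u v2] br_Y[of v2 v1] unfolding h by (simp add: mult.commute)
  also have "\<dots> = - br (of_nat (Suc p) * g) * br (g + 2 * s)" unfolding h br_minus by simp
  finally have 3: "br (a + of_nat (Suc p) * g + s) * br (a - g - s) - br (a + s) * br (a + of_nat p * g - s)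
     = - br (of_nat (Suc p) * g) * br (g + 2 * s)" .
  have "basis g a (Suc p) (Y (g + s)) - basis g a (Suc p) (Y s) =
     ?A * ?B * (br (a + of_nat (Suc p) * g + s) * br (a - g - s) - br (a + s) * br (a + of_nat p * g - s))"
    unfolding 1 2 by (simp only: right_diff_distrib)
  then show ?thesis unfolding 3 by (simp only: mult_ac)
qed

lemma basis_Y: "basis g a m (Y s) = (\<Prod>i<m. br (a + of_nat i * g + s)) * (\<Prod>i<m. br (a + of_nat i * g - s))"
  unfolding basis_def node_def br_Y[symmetric] by (simp add: prod.distrib)

text \<open>Coefficient of the operator without the denominator br (g + 2s), which cancels against
  the same factor of a difference in \<open>basis\<close> or in \<open>Y\<close>.\<close>

definition vfun :: "complex \<Rightarrow> complex \<Rightarrow> complex \<Rightarrow> complex \<Rightarrow> complex \<Rightarrow> complex \<Rightarrow> complex" where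
  "vfun g a b c d s = br (a + s) * br (b + s) * br (c + s) * br (d + s) / br (2 * s)"

text \<open>The functions \<open>basis\<close> are triangular for the Askey--Wilson (for \<open>q = 1\<close>, Wilson) operator with step \<open>g\<close>.\<close>

lemma basis_operator:
  assumes "br (2 * s) \<noteq> 0" "br (g + 2 * s) \<noteq> 0" "br (g - 2 * s) \<noteq> 0"
  shows "eigval g (a + b + c + d) m * basis g a m (Y s) + lower g a b c d m * basis g a (m - 1) (Y s) =
    vfun g a b c d s / br (g + 2 * s) * (basis g a m (Y (g + s)) - basis g a m (Y s)) +
    vfun g a b c d (- s) / br (g - 2 * s) * (basis g a m (Y (g - s)) - basis g a m (Y s))"
proof (cases m)
  case 0
  then show ?thesis by (simp add: eigval_0 lower_0 basis_def)
next
  case (Suc p)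
  define ap where "ap = a + of_nat p * g"
  have AB: "(\<Prod>i<p. br (a + of_nat (Suc i) * g + s)) * (\<Prod>i<p. br (a + of_nat i * g - s)) * br (a + s) = basis g a p (Y s) * br (ap + s)" for s
  proof -
    have "(\<Prod>i<p. br (a + of_nat (Suc i) * g + s)) * br (a + s) = (\<Prod>i<Suc p. br (a + of_nat i * g + s))"
      by (subst prod.lessThan_Suc_shift) (simp del: of_nat_Suc)
    also have "\<dots> = (\<Prod>i<p. br (a + of_nat i * g + s)) * br (ap + s)" unfolding ap_def by simp
    finally show ?thesis unfolding basis_Y by (simp add: mult_ac)
  qed
  have half: "vfun g a b c d s / br (g + 2 * s) * (basis g a m (Y (g + s)) - basis g a m (Y s))
     = - br (of_nat m * g) * basis g a p (Y s) * (br (b + s) * br (c + s) * br (d + s) * br (ap + s)) / br (2 * s)"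
    if "br (g + 2 * s) \<noteq> 0" for s
  proof -
    have "vfun g a b c d s / br (g + 2 * s) * (basis g a m (Y (g + s)) - basis g a m (Y s))
      = - br (of_nat m * g) * (br (b + s) * br (c + s) * br (d + s)) / br (2 * s) *
        ((\<Prod>i<p. br (a + of_nat (Suc i) * g + s)) * (\<Prod>i<p. br (a + of_nat i * g - s)) * br (a + s))"
      unfolding Suc basis_diff vfun_def using that by (simp add: field_simps del: of_nat_Suc)
    then show ?thesis unfolding AB by (simp add: mult_ac)
  qed
  have m1: "vfun g a b c d (- s) / br (g - 2 * s) * (basis g a m (Y (g - s)) - basis g a m (Y s))
     = br (of_nat m * g) * basis g a p (Y s) * (br (b - s) * br (c - s) * br (d - s) * br (ap - s)) / br (2 * s)"
    using half[of "- s"] assms(3) br_minus[of "2 * s"] Y_minus[of s] by simp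
  have "vfun g a b c d s / br (g + 2 * s) * (basis g a m (Y (g + s)) - basis g a m (Y s)) +
    vfun g a b c d (- s) / br (g - 2 * s) * (basis g a m (Y (g - s)) - basis g a m (Y s))
    = - br (of_nat m * g) * basis g a p (Y s) * (br (b + s) * br (c + s) * br (d + s) * br (ap + s)
       - br (b - s) * br (c - s) * br (d - s) * br (ap - s)) / br (2 * s)"
    unfolding half[OF assms(2)] m1 using assms(1) by (simp add: field_simps)
  \<comment> \<open>The two halves combine into a difference that \<open>br_four\<close> shows to be
    divisible by br (2s); this is where the poles of the operator disappear.\<close>
  also have "\<dots> = - br (of_nat m * g) * basis g a p (Y s) * (br (b + ap) * br (c + ap) * br (d + ap)
      - br (b + c + d + ap) * (br (ap + s) * br (ap - s)))"
    unfolding br_four using assms(1) by simp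
  also have "\<dots> = br (of_nat m * g) * br (b + c + d + ap) * (basis g a p (Y s) * (br (ap + s) * br (ap - s)))
     + - br (of_nat m * g) * (br (b + ap) * br (c + ap) * br (d + ap)) * basis g a p (Y s)"
    by (simp add: algebra_simps)
  also have "basis g a p (Y s) * (br (ap + s) * br (ap - s)) = basis g a m (Y s)"
    unfolding basis_Y Suc ap_def by simp
  also have "br (of_nat m * g) * br (b + c + d + ap) = eigval g (a + b + c + d) m"
    unfolding eigval_def ap_def Suc by (simp add: algebra_simps)
  also have "- br (of_nat m * g) * (br (b + ap) * br (c + ap) * br (d + ap)) = lower g a b c d m"
    unfolding lower_def ap_def Suc by (simp add: algebra_simps)
  finally show ?thesis unfolding Suc by simp
qed

end

section \<open>Summation by parts in one coordinate\<close>

context gamma_like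
begin

text \<open>Half of a Lagrange interpolation term at the node Y (x j). The two values s = x j and s
  = - x j are kept apart because a unit translation will match one with the other.\<close>

definition ibp :: "nat \<Rightarrow> complex \<Rightarrow> complex \<Rightarrow> complex \<Rightarrow> complex \<Rightarrow> complex \<Rightarrow> complex \<Rightarrow> (nat \<Rightarrow> complex) \<Rightarrow> nat \<Rightarrow> complex \<Rightarrow> complex" where
  "ibp n g a b c d t x j s = vfun g a b c d s *
     (\<Prod>k\<in>{1..n}-{j}. (Y (g + s) - Y (x k)) * ((t - Y (x k)) / (Y (x j) - Y (x k))))"

text \<open>Both sides are polynomials in \<open>t\<close> of degree less than \<open>n\<close>; they agree at \<open>t = Y (x j)\<close>.\<close>

lemma newton_ibp:
  assumes n: "n \<ge> 1"
    and dist: "\<And>j k. j \<in> {1..n} \<Longrightarrow> k \<in> {1..n} \<Longrightarrow> j \<noteq> k \<Longrightarrow> Y (x j) \<noteq> Y (x k)"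
    and reg: "\<And>j. j \<in> {1..n} \<Longrightarrow> br (2 * x j) \<noteq> 0 \<and> br (g + 2 * x j) \<noteq> 0 \<and> br (g - 2 * x j) \<noteq> 0"
  shows "(\<Sum>m\<le>n. newton (node g a) (\<lambda>k. Y (x k)) n m *
      ((eigval g (a + b + c + d) m - eigval g (a + b + c + d) n) * basis g a m t + lower g a b c d m * basis g a (m - 1) t))
    = br g * (\<Sum>j\<in>{1..n}. ibp n g a b c d t x j (x j) + ibp n g a b c d t x j (- x j))"
proof -
  define X where "X k = Y (x k)" for k
  define N where "N m = newton (node g a) X n m" for m
  define e where "e m = eigval g (a + b + c + d) m" for m
  define lo where "lo m = lower g a b c d m" for m
  define pb where "pb m = (\<Prod>i<m. [:node g a i, -1:])" for m
  define v where "v = vfun g a b c d"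
  define Nj where "Nj j = v (x j) * (\<Prod>k\<in>{1..n}-{j}. Y (g + x j) - X k) + v (- x j) * (\<Prod>k\<in>{1..n}-{j}. Y (g - x j) - X k)" for j
  have poly_pb: "poly (pb m) t = basis g a m t" for m t
    unfolding pb_def basis_def poly_prod by simp
  have deg_pb: "degree (pb m) \<le> m" for m
  proof -
    have "degree (pb m) \<le> (\<Sum>i<m. degree [:node g a i, -1:])"
      unfolding pb_def using degree_prod_sum_le[of "{..<m}" "\<lambda>i. [:node g a i, -1:]"] by (simp add: o_def)
    then show ?thesis by simp
  qed
  define p1 where "p1 = (\<Sum>m\<le>n. smult (N m * (e m - e n)) (pb m) + smult (N m * lo m) (pb (m - 1)))"
  define lb where "lb j = (\<Prod>k\<in>{1..n}-{j}. [:- X k, 1:])" for j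
  define p2 where "p2 = (\<Sum>j\<in>{1..n}. smult (br g * Nj j / (\<Prod>k\<in>{1..n}-{j}. X j - X k)) (lb j))"
  have deg1: "degree p1 < n"
    unfolding p1_def
  proof (rule degree_sum_less)
    fix m assume m: "m \<in> {..n}"
    \<comment> \<open>Subtracting the eigenvalue e n removes the only term that could have degree
      n.\<close>
    have "degree (smult (N m * (e m - e n)) (pb m)) < n"
    proof (cases "m = n")
      case False
      then have "m < n" using m by simp
      then show ?thesis using deg_pb[of m] degree_smult_le[of "N m * (e m - e n)" "pb m"] by linarith
    qed (use n in simp)
    moreover have "degree (smult (N m * lo m) (pb (m - 1))) < n"
      using deg_pb[of "m - 1"] degree_smult_le[of "N m * lo m" "pb (m - 1)"] m n by fastforce
    ultimately show "degree (smult (N m * (e m - e n)) (pb m) + smult (N m * lo m) (pb (m - 1))) < n"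
      by (rule degree_add_less)
  qed (use n in simp)
  have deg2: "degree p2 < n"
    unfolding p2_def
  proof (rule degree_sum_less)
    fix j assume j: "j \<in> {1..n}"
    have "degree (lb j) \<le> (\<Sum>k\<in>{1..n}-{j}. degree [:- X k, 1:])"
      unfolding lb_def using degree_prod_sum_le[of "{1..n}-{j}" "\<lambda>k. [:- X k, 1:]"] by (simp add: o_def)
    also have "\<dots> = n - 1" using j by simp
    finally show "degree (smult (br g * Nj j / (\<Prod>k\<in>{1..n}-{j}. X j - X k)) (lb j)) < n"
      using degree_smult_le[of _ "lb j"] n by (metis le_trans diff_less less_one le_neq_implies_less less_imp_le_nat not_le)
  qed (use n in simp)
  have inj: "inj_on X {1..n}" unfolding inj_on_def X_def using dist by blast
  have "poly p1 u = poly p2 u" if u_in: "u \<in> X ` {1..n}" for u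
  proof -
    obtain j where j: "j \<in> {1..n}" "u = X j" using u_in by blast
    define s where "s = x j"
    have u: "u = Y s" unfolding j s_def X_def ..
    have exp: "(\<Sum>m\<le>n. N m * basis g a m r) = (\<Prod>k\<in>{1..n}. r - X k)" for r
      unfolding N_def basis_def using newton_expansion[of r X n "node g a"] by simp
    have z: "(\<Prod>k\<in>{1..n}. Y s - X k) = 0" using j u by (intro prod_zero) auto
    have pr: "(\<Prod>k\<in>{1..n}. r - X k) = (r - Y s) * (\<Prod>k\<in>{1..n}-{j}. r - X k)" for r
      using j u by (subst prod.remove[of _ j]) auto
    have "poly p1 u = (\<Sum>m\<le>n. N m * (e m * basis g a m (Y s) + lo m * basis g a (m - 1) (Y s))) - e n * (\<Sum>m\<le>n. N m * basis g a m (Y s))"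
      unfolding p1_def poly_sum poly_add poly_smult poly_pb u sum_distrib_left sum_subtractf[symmetric]
      by (intro sum.cong refl) (simp add: algebra_simps)
    also have "(\<Sum>m\<le>n. N m * (e m * basis g a m (Y s) + lo m * basis g a (m - 1) (Y s)))
       = (\<Sum>m\<le>n. N m * (v s / br (g + 2 * s) * (basis g a m (Y (g + s)) - basis g a m (Y s)) +
            v (- s) / br (g - 2 * s) * (basis g a m (Y (g - s)) - basis g a m (Y s))))"
      unfolding e_def lo_def v_def using reg[OF j(1)] unfolding s_def
      by (subst basis_operator) auto
    also have "\<dots> = v s / br (g + 2 * s) * ((\<Sum>m\<le>n. N m * basis g a m (Y (g + s))) - (\<Sum>m\<le>n. N m * basis g a m (Y s)))
       + v (- s) / br (g - 2 * s) * ((\<Sum>m\<le>n. N m * basis g a m (Y (g - s))) - (\<Sum>m\<le>n. N m * basis g a m (Y s)))"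
      unfolding sum_subtractf[symmetric] sum_distrib_left sum.distrib[symmetric]
      by (intro sum.cong refl) (simp only: algebra_simps)
    finally have "poly p1 u = v s / br (g + 2 * s) * ((Y (g + s) - Y s) * (\<Prod>k\<in>{1..n}-{j}. Y (g + s) - X k))
       + v (- s) / br (g - 2 * s) * ((Y (g - s) - Y s) * (\<Prod>k\<in>{1..n}-{j}. Y (g - s) - X k))"
      unfolding exp z pr[of "Y (g + s)"] pr[of "Y (g - s)"] by simp
    also have "Y (g + s) - Y s = br (g + 2 * s) * br g" using br_Y[of "g + s" s] by (simp add: algebra_simps)
    also have "Y (g - s) - Y s = br (g - 2 * s) * br g" using br_Y[of "g - s" s] by (simp add: algebra_simps)
    also have "v s / br (g + 2 * s) * (br (g + 2 * s) * br g * (\<Prod>k\<in>{1..n}-{j}. Y (g + s) - X k)) +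
        v (- s) / br (g - 2 * s) * (br (g - 2 * s) * br g * (\<Prod>k\<in>{1..n}-{j}. Y (g - s) - X k)) = br g * Nj j"
      using reg[OF j(1)] unfolding Nj_def s_def[symmetric] by (simp add: algebra_simps)
    finally have p1: "poly p1 u = br g * Nj j" .
    have "poly (lb i) u = 0" if "i \<in> {1..n}" "i \<noteq> j" for i
      unfolding lb_def poly_prod using j that by (intro prod_zero) auto
    then have "poly p2 u = br g * Nj j / (\<Prod>k\<in>{1..n}-{j}. X j - X k) * poly (lb j) u"
      unfolding p2_def poly_sum poly_smult using j(1) by (subst sum.remove[of _ j]) auto
    moreover have "poly (lb j) u = (\<Prod>k\<in>{1..n}-{j}. X j - X k)" unfolding lb_def poly_prod j by simp
    moreover have "(\<Prod>k\<in>{1..n}-{j}. X j - X k) \<noteq> 0"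
      using dist[OF j(1)] unfolding X_def by (subst prod_zero_iff) (simp, metis DiffD1 DiffD2 eq_iff_diff_eq_0 singletonI)
    ultimately show ?thesis using p1 by simp
  qed
  then have "p1 = p2" using deg1 deg2 card_image[OF inj] by (intro poly_eqI_degree[of "X ` {1..n}"]) auto
  then have "poly p1 t = poly p2 t" by simp
  moreover have "poly p1 t = (\<Sum>m\<le>n. N m * ((e m - e n) * basis g a m t + lo m * basis g a (m - 1) t))"
    unfolding p1_def poly_sum poly_add poly_smult poly_pb by (intro sum.cong refl) (simp add: algebra_simps)
  moreover have "poly p2 t = br g * (\<Sum>j\<in>{1..n}. ibp n g a b c d t x j (x j) + ibp n g a b c d t x j (- x j))"
    unfolding p2_def poly_sum poly_smult sum_distrib_left
  proof (intro sum.cong refl)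
    fix j assume "j \<in> {1..n}"
    have "poly (lb j) t = (\<Prod>k\<in>{1..n}-{j}. t - X k)" unfolding lb_def poly_prod by simp
    then show "br g * Nj j / (\<Prod>k\<in>{1..n}-{j}. X j - X k) * poly (lb j) t
       = br g * (ibp n g a b c d t x j (x j) + ibp n g a b c d t x j (- x j))"
      unfolding Nj_def ibp_def v_def X_def by (simp add: prod.distrib prod_dividef distrib_left distrib_right add_divide_distrib mult_ac)
  qed
  ultimately show ?thesis unfolding N_def e_def lo_def X_def by simp
qed

lemma pr_sym: "pr g s t = pr g t s"
  unfolding pr_def using W_minus[of g "s - t"] W_minus[of 0 "s - t"] by (simp add: add.commute)

lemma W0_step: "br (u + 1) * W 0 (u + 1) = - br u * W 0 u"
  using W_step[of 0 u] br_minus[of u] by (simp add: add.commute)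

text \<open>\<open>W_step\<close> exchanges the numerator brackets at u + 1 for those at - u. The
  Lagrange denominators absorb \<open>W0_step\<close>, whose two signs cancel.\<close>

lemma pr_step:
  "pr g (u + 1) v * ((Y (g + (u + 1)) - Y v) * (r / (Y (u + 1) - Y v)))
    = pr g u v * ((Y (g - u) - Y v) * (r / (Y u - Y v)))"
proof -
  define p m where "p = u + v" and "m = u - v"
  have e: "u + 1 + v = p + 1" "u + 1 - v = m + 1" unfolding p_def m_def by simp_all
  have Y1: "Y (g + (u + 1)) - Y v = br (1 + g + p) * br (1 + g + m)"
    using br_Y[of "g + (u + 1)" v] unfolding p_def m_def by (simp add: algebra_simps)
  have Y2: "Y (u + 1) - Y v = br (p + 1) * br (m + 1)"
    using br_Y[of "u + 1" v] unfolding p_def m_def by (simp add: algebra_simps)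
  have Y3: "Y (g - u) - Y v = br (g - m) * br (g - p)"
    using br_Y[of "g - u" v] unfolding p_def m_def by (simp add: algebra_simps)
  have Y4: "Y u - Y v = br p * br m"
    using br_Y[of u v] unfolding p_def m_def by simp
  have "pr g (u + 1) v * ((Y (g + (u + 1)) - Y v) * (r / (Y (u + 1) - Y v)))
    = ((br (1 + g + p) * W g (p + 1)) * (br (1 + g + m) * W g (m + 1))) / ((br (p + 1) * W 0 (p + 1)) * (br (m + 1) * W 0 (m + 1))) * r"
    unfolding pr_def e Y1 Y2 by (simp add: mult_ac)
  also have "\<dots> = ((br (g - p) * W g p) * (br (g - m) * W g m)) / ((br p * W 0 p) * (br m * W 0 m)) * r"
    unfolding W_step W0_step by simp
  also have "\<dots> = pr g u v * ((Y (g - u) - Y v) * (r / (Y u - Y v)))"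
    unfolding pr_def p_def[symmetric] m_def[symmetric] Y3 Y4 by (simp add: mult_ac)
  finally show ?thesis .
qed

lemma sg_step:
  "sg a b c d (u + 1) * vfun g a b c d (u + 1) = - (sg a b c d u * vfun g a b c d (- u))"
proof -
  have e: "2 * (u + 1) = 2 * u + 1 + 1" by simp
  have st: "W a (u + 1) * br (a + (u + 1)) = br (a - u) * W a u" for a
    using W_step[of a u] by (simp add: algebra_simps)
  have den: "W 0 (2 * u + 1 + 1) * br (2 * u + 1 + 1) = W 0 (2 * u) * br (2 * u)"
    using W0_step[of "2 * u + 1"] W0_step[of "2 * u"] by (simp add: mult.commute)
  have "sg a b c d (u + 1) * vfun g a b c d (u + 1) = (W a (u + 1) * br (a + (u + 1))) * (W b (u + 1) * br (b + (u + 1))) *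
     (W c (u + 1) * br (c + (u + 1))) * (W d (u + 1) * br (d + (u + 1))) / (W 0 (2 * u + 1 + 1) * br (2 * u + 1 + 1))"
    unfolding sg_def vfun_def e by (simp add: mult_ac)
  also have "\<dots> = - (sg a b c d u * vfun g a b c d (- u))"
    unfolding st den sg_def vfun_def using br_minus[of "2 * u"] by (simp add: mult_ac)
  finally show ?thesis .
qed

text \<open>Only the factors containing the coordinate j change. The pair factors match by
  \<open>pr_step\<close>, and the single factor changes sign by \<open>sg_step\<close>: the
  translated first half is minus the second half.\<close>

lemma ibp_step:
  assumes j: "j \<in> {1..n}"
  shows "Phi n g a b c d (x(j := x j + 1)) * ibp n g a b c d t (x(j := x j + 1)) j (x j + 1)
    = - (Phi n g a b c d x * ibp n g a b c d t x j (- x j))"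
proof -
  define Rest where "Rest x = (\<Prod>i\<in>{1..n}-{j}. \<Prod>k\<in>{i+1..n}-{j}. pr g (x i) (x k)) * (\<Prod>i\<in>{1..n}-{j}. sg a b c d (x i))" for x
  have Phi: "Phi n g a b c d x = (\<Prod>k\<in>{1..n}-{j}. pr g (x j) (x k)) * sg a b c d (x j) * Rest x" for x
  proof -
    have "(\<Prod>i\<in>{1..n}. sg a b c d (x i)) = sg a b c d (x j) * (\<Prod>i\<in>{1..n}-{j}. sg a b c d (x i))"
      using j by (subst prod.remove[of _ j]) auto
    then show ?thesis unfolding Phi_def Rest_def
      using prod_pairs_split[of "\<lambda>i k. pr g (x i) (x k)" j n, OF pr_sym j] by (simp add: mult_ac)
  qed
  define x' where "x' = x(j := x j + 1)"
  have R: "Rest x' = Rest x" unfolding Rest_def x'_def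
    by (intro arg_cong2[where f = "(*)"] prod.cong refl) auto
  have x'k: "x' k = x k" if "k \<in> {1..n} - {j}" for k using that unfolding x'_def by auto
  have cg: "(\<Prod>k\<in>{1..n}-{j}. h (x' k)) = (\<Prod>k\<in>{1..n}-{j}. h (x k))" for h :: "complex \<Rightarrow> complex"
    by (intro prod.cong refl) (simp only: x'k)
  have x'j: "x' j = x j + 1" unfolding x'_def by simp
  have "Phi n g a b c d x' * ibp n g a b c d t x' j (x j + 1)
     = (sg a b c d (x j + 1) * vfun g a b c d (x j + 1)) * Rest x *
       (\<Prod>k\<in>{1..n}-{j}. pr g (x j + 1) (x k) * ((Y (g + (x j + 1)) - Y (x k)) * ((t - Y (x k)) / (Y (x j + 1) - Y (x k)))))"
    unfolding Phi ibp_def R x'j prod.distrib[of "\<lambda>k. pr g (x j + 1) (x k)"]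
      cg[of "pr g (x j + 1)"] cg[of "\<lambda>y. (Y (g + (x j + 1)) - Y y) * ((t - Y y) / (Y (x j + 1) - Y y))"]
    by (simp only: mult_ac)
  also have "\<dots> = - (sg a b c d (x j) * vfun g a b c d (- x j)) * Rest x *
       (\<Prod>k\<in>{1..n}-{j}. pr g (x j) (x k) * ((Y (g - x j) - Y (x k)) * ((t - Y (x k)) / (Y (x j) - Y (x k)))))"
    unfolding sg_step by (intro arg_cong2[where f = "(*)"] prod.cong refl pr_step)
  also have "\<dots> = - (Phi n g a b c d x * ibp n g a b c d t x j (- x j))"
    unfolding Phi ibp_def prod.distrib[of "\<lambda>k. pr g (x j) (x k)"] by (simp only: mult_ac mult_minus_left mult_minus_right add_uminus_conv_diff)
  finally show ?thesis unfolding x'_def .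
qed

end

section \<open>Growth orders of the multipliers of the summand\<close>

context gamma_like
begin

definition wprod :: "nat \<Rightarrow> (nat \<Rightarrow> int) \<Rightarrow> real" where
  "wprod n l = (\<Prod>k\<in>{1..n}. w (l k))"

text \<open>Growth of order \<open>M\<close> in the weights. Multiplying the summand by such a
  function keeps it summable as long as \<open>decay\<close> exceeds \<open>M\<close>.\<close>

definition pbd :: "nat \<Rightarrow> real \<Rightarrow> ((nat \<Rightarrow> int) \<Rightarrow> complex) \<Rightarrow> bool" where
  "pbd n M f \<longleftrightarrow> (\<exists>C\<ge>0. \<forall>l. norm (f l) \<le> C * wprod n l powr M)"

lemma wprod_ge_1: "wprod n l \<ge> 1"
  unfolding wprod_def using w_ge_1 by (intro prod_ge_1) auto

lemma w_le_wprod: assumes "j \<in> {1..n}" shows "w (l j) \<le> wprod n l"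
proof -
  have "wprod n l = w (l j) * (\<Prod>k\<in>{1..n}-{j}. w (l k))"
    unfolding wprod_def using assms by (subst prod.remove[of _ j]) auto
  moreover have "(\<Prod>k\<in>{1..n}-{j}. w (l k)) \<ge> 1" using w_ge_1 by (intro prod_ge_1) auto
  ultimately show ?thesis using w_pos[of "l j"] by (metis mult_left_mono less_imp_le mult.right_neutral)
qed

lemma w_mult_le_wprod: assumes "j \<in> {1..n}" "k \<in> {1..n}" "j \<noteq> k" shows "w (l j) * w (l k) \<le> wprod n l"
proof -
  have "wprod n l = w (l j) * (w (l k) * (\<Prod>k\<in>{1..n}-{j}-{k}. w (l k)))"
    unfolding wprod_def using assms by (subst prod.remove[of _ j], simp, simp, subst prod.remove[of _ k]) auto
  moreover have "(\<Prod>k\<in>{1..n}-{j}-{k}. w (l k)) \<ge> 1" using w_ge_1 by (intro prod_ge_1) auto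
  moreover have "w (l j) * w (l k) > 0" using w_pos by simp
  ultimately show ?thesis by (metis mult.assoc mult_left_mono less_imp_le mult.right_neutral)
qed

lemma pbd_const: "pbd n 0 (\<lambda>_. c)"
proof -
  have "wprod n l powr 0 = 1" for l using wprod_ge_1[of n l] by simp
  then show ?thesis unfolding pbd_def by (intro exI[of _ "norm c"]) simp
qed

lemma pbd_mono: assumes "pbd n M f" "M \<le> M'" shows "pbd n M' f"
proof -
  obtain C where "C \<ge> 0" "\<And>l. norm (f l) \<le> C * wprod n l powr M" using assms unfolding pbd_def by blast
  moreover have "C * wprod n l powr M \<le> C * wprod n l powr M'" for l
    using calculation(1) assms(2) wprod_ge_1 by (intro mult_left_mono powr_mono) auto
  ultimately show ?thesis unfolding pbd_def by (meson order_trans)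
qed

lemma pbd_mult: assumes "pbd n M f" "pbd n M' h" shows "pbd n (M + M') (\<lambda>l. f l * h l)"
proof -
  obtain C where C: "C \<ge> 0" "\<And>l. norm (f l) \<le> C * wprod n l powr M" using assms unfolding pbd_def by blast
  obtain D where D: "D \<ge> 0" "\<And>l. norm (h l) \<le> D * wprod n l powr M'" using assms unfolding pbd_def by blast
  have "norm (f l * h l) \<le> (C * D) * wprod n l powr (M + M')" for l
  proof -
    have "norm (f l * h l) \<le> (C * wprod n l powr M) * (D * wprod n l powr M')"
      unfolding norm_mult using C(1) by (intro mult_mono C(2) D(2)) auto
    then show ?thesis unfolding powr_add by (simp only: mult_ac)
  qed
  then show ?thesis unfolding pbd_def using C(1) D(1) by (intro exI[of _ "C * D"]) (simp only: mult_nonneg_nonneg simp_thms)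
qed

lemma pbd_add: assumes "pbd n M f" "pbd n M h" shows "pbd n M (\<lambda>l. f l + h l)"
proof -
  obtain C where C: "C \<ge> 0" "\<And>l. norm (f l) \<le> C * wprod n l powr M" using assms unfolding pbd_def by blast
  obtain D where D: "D \<ge> 0" "\<And>l. norm (h l) \<le> D * wprod n l powr M" using assms unfolding pbd_def by blast
  have "norm (f l + h l) \<le> (C + D) * wprod n l powr M" for l
    using norm_triangle_mono[OF C(2)[of l] D(2)[of l]] by (simp only: distrib_right)
  then show ?thesis unfolding pbd_def using C(1) D(1) by (intro exI[of _ "C + D"]) (simp only: add_nonneg_nonneg simp_thms)
qed

lemma pbd_prod:
  assumes "finite A" "\<And>k. k \<in> A \<Longrightarrow> pbd n M (f k)"
  shows "pbd n (real (card A) * M) (\<lambda>l. \<Prod>k\<in>A. f k l)"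
  using assms
proof (induction rule: finite_induct)
  case empty
  then show ?case using pbd_const[of n 1] by simp
next
  case (insert k A)
  then have "pbd n (M + real (card A) * M) (\<lambda>l. f k l * (\<Prod>k\<in>A. f k l))" by (intro pbd_mult) auto
  then show ?case using insert.hyps by (simp add: distrib_right)
qed

lemma pbd_br:
  assumes "\<And>l. w (i l) \<le> wprod n l"
  shows "pbd n (1/2) (\<lambda>l. br (u + of_int (i l)))"
proof -
  obtain C where C: "\<And>l. norm (br (u + of_int l)) \<le> C * w l powr (1/2)" using br_bound by blast
  have "norm (br (u + of_int (i l))) \<le> max C 0 * wprod n l powr (1/2)" for l
  proof -
    have "norm (br (u + of_int (i l))) \<le> max C 0 * w (i l) powr (1/2)"
      using C[of "i l"] mult_right_mono[OF max.cobounded1[of C 0] powr_ge_zero[of "w (i l)" "1/2"]] by linarith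
    also have "\<dots> \<le> max C 0 * wprod n l powr (1/2)" using assms w_nonneg by (intro mult_left_mono powr_mono2) auto
    finally show ?thesis .
  qed
  then show ?thesis unfolding pbd_def by (intro exI[of _ "max C 0"]) (simp only: max.cobounded2 simp_thms)
qed

lemma pbd_inverse_br:
  assumes "nz u"
  shows "pbd n 0 (\<lambda>l. 1 / br (u + of_int (i l)))"
proof -
  obtain C where C: "C \<ge> 0" "\<And>l. norm (1 / br (u + of_int l)) \<le> C" using inverse_br_bound[OF assms] by blast
  have "norm (1 / br (u + of_int (i l))) \<le> C * wprod n l powr 0" for l
    using C(2)[of "i l"] wprod_ge_1[of n l] by simp
  then show ?thesis unfolding pbd_def using C(1) by (intro exI[of _ C]) (simp only: simp_thms)
qed

lemma wt_wprod: "wt n \<sigma> l * wprod n l powr M = wt n (\<sigma> - M) l"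
proof -
  have "wprod n l powr M = (\<Prod>k\<in>{1..n}. w (l k) powr M)"
    unfolding wprod_def using w_nonneg by (subst prod_powr_distrib) auto
  then show ?thesis unfolding wt_def by (simp add: prod.distrib[symmetric] powr_add[symmetric] mult_ac)
qed

lemma Phi_pbd_summable:
  assumes adm: "admissible n z" and dec: "decay n g (a + b + c + d) > M" and f: "pbd n M f"
  shows "(\<lambda>l. norm (Phi n g a b c d (shifted z l) * f l)) summable_on int_vectors n"
proof -
  define R where "R = norm g + norm a + norm b + norm c + norm d"
  define D where "D = decay n g (a + b + c + d)"
  have "g \<in> cball 0 R" "a \<in> cball 0 R" "b \<in> cball 0 R" "c \<in> cball 0 R" "d \<in> cball 0 R"
    unfolding R_def by (simp_all add: add_increasing add_increasing2)
  then obtain C where C: "C \<ge> 0" "\<And>l. norm (Phi n g a b c d (shifted z l)) \<le> C * wt n D l"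
    using Phi_bound[OF adm, of R] unfolding D_def by blast
  obtain E where E: "E \<ge> 0" "\<And>l. norm (f l) \<le> E * wprod n l powr M" using f unfolding pbd_def by blast
  have "norm (Phi n g a b c d (shifted z l) * f l) \<le> (C * E) * wt n (D - M) l" for l
  proof -
    have "norm (Phi n g a b c d (shifted z l) * f l) \<le> (C * wt n D l) * (E * wprod n l powr M)"
      unfolding norm_mult using C(1) wt_nonneg by (intro mult_mono C(2) E(2)) auto
    also have "\<dots> = (C * E) * wt n (D - M) l" unfolding wt_wprod[symmetric] by (simp only: mult_ac)
    finally show ?thesis .
  qed
  moreover have "(\<lambda>l. (C * E) * wt n (D - M) l) summable_on int_vectors n"
    using dec unfolding D_def by (intro summable_on_cmult_right wt_summable) simp
  ultimately show ?thesis by (intro Infinite_Sum.abs_summable_on_comparison_test'[where g = "\<lambda>l. (C * E) * wt n (D - M) l"]) simp_all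
qed

lemma pbd_t_minus_Y:
  assumes k: "k \<in> {1..n}"
  shows "pbd n 1 (\<lambda>l. t - Y (shifted z l k))"
proof -
  have "pbd n (1/2 + 1/2) (\<lambda>l. br (z k + of_int (l k)) * br (- z k + of_int (- l k)))"
    using w_le_wprod[OF k] w_minus by (intro pbd_mult pbd_br) auto
  moreover have "pbd n 1 (\<lambda>_. t - Y 0)" by (rule pbd_mono[OF pbd_const]) simp
  ultimately have main: "pbd n 1 (\<lambda>l. br (z k + of_int (l k)) * br (- z k + of_int (- l k)) + (t - Y 0))"
    by (intro pbd_add) auto
  have eq: "br (z k + of_int (l k)) * br (- z k + of_int (- l k)) + (t - Y 0) = t - Y (shifted z l k)" for l
    using br_Y[of 0 "z k + of_int (l k)"] unfolding shifted_def by (simp add: algebra_simps)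
  show ?thesis using main unfolding eq .
qed

text \<open>\<open>vfun\<close> has order 2, and so has each of the n - 1 further factors: two
  brackets of order 1/2, one factor t - Y of order 1, and denominators bounded away from zero. The
  sign e selects the half.\<close>

lemma ibp_pbd:
  assumes adm: "admissible n z" and j: "j \<in> {1..n}" and e: "e = 1 \<or> e = (-1::int)"
  shows "pbd n (2 * real n) (\<lambda>l. ibp n g a b c d t (shifted z l) j (of_int e * shifted z l j))"
proof -
  have s: "of_int e * shifted z l j = of_int e * z j + of_int (e * l j)" for l
    unfolding shifted_def by (simp add: algebra_simps)
  have we: "w (e * m) = w m" for m using e w_minus by auto
  have nz2: "nz (2 * (of_int e * z j))"
    using adm j e nz_minus[of "2 * z j"] unfolding admissible_def by auto
  have nzp: "nz (z j + z k)" "nz (z j - z k)" if "k \<in> {1..n} - {j}" for k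
  proof -
    have "nz (z j + z k) \<and> nz (z j - z k)"
    proof (cases "j < k")
      case True
      then show ?thesis using adm j that unfolding admissible_def by auto
    next
      case False
      then have "nz (z k + z j)" "nz (z k - z j)" using adm j that unfolding admissible_def by auto
      then show ?thesis using nz_minus[of "z k - z j"] by (simp add: add.commute)
    qed
    then show "nz (z j + z k)" "nz (z j - z k)" by auto
  qed
  have p: "pbd n (1/2) (\<lambda>l. br (u + (of_int e * z j + of_int (e * l j))))" for u
    using pbd_br[of "\<lambda>l. e * l j" n "u + of_int e * z j"] w_le_wprod[OF j] we by (simp add: add.assoc)
  have i2: "pbd n 0 (\<lambda>l. 1 / br (2 * (of_int e * z j + of_int (e * l j))))"
    using pbd_inverse_br[OF nz2, of n "\<lambda>l. 2 * (e * l j)"] by (simp add: distrib_left)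
  have "pbd n (1/2 + 1/2 + 1/2 + 1/2 + 0) (\<lambda>l. br (a + (of_int e * z j + of_int (e * l j))) *
      br (b + (of_int e * z j + of_int (e * l j))) * br (c + (of_int e * z j + of_int (e * l j))) *
      br (d + (of_int e * z j + of_int (e * l j))) * (1 / br (2 * (of_int e * z j + of_int (e * l j)))))"
    by (intro pbd_mult p i2)
  then have v: "pbd n 2 (\<lambda>l. vfun g a b c d (of_int e * shifted z l j))" unfolding vfun_def s by simp
  have f: "pbd n 2 (\<lambda>l. (Y (g + of_int e * shifted z l j) - Y (shifted z l k)) *
       ((t - Y (shifted z l k)) / (Y (shifted z l j) - Y (shifted z l k))))" if k: "k \<in> {1..n} - {j}" for k
  proof -
    have kj: "k \<in> {1..n}" "j \<noteq> k" using k by auto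
    have w1: "w (e * l j + l k) \<le> wprod n l" "w (e * l j - l k) \<le> wprod n l" for l
      using w_mult_le_wprod[OF j kj, of l] w_add[of "e * l j" "l k"] w_add[of "e * l j" "- l k"] we w_minus
      by (auto intro: order_trans)
    have main: "pbd n (1/2 + 1/2 + (1 + (0 + 0))) (\<lambda>l. br (g + of_int e * z j + z k + of_int (e * l j + l k)) *
       br (g + of_int e * z j - z k + of_int (e * l j - l k)) * ((t - Y (shifted z l k)) *
       (1 / br (z j + z k + of_int (l j + l k)) * (1 / br (z j - z k + of_int (l j - l k))))))"
      by (intro pbd_mult pbd_br pbd_inverse_br w1 nzp k pbd_t_minus_Y kj)
    have e1: "br (g + of_int e * z j + z k + of_int (e * l j + l k)) *
       br (g + of_int e * z j - z k + of_int (e * l j - l k)) = Y (g + of_int e * shifted z l j) - Y (shifted z l k)" for l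
      using br_Y[of "g + of_int e * shifted z l j" "shifted z l k"] unfolding shifted_def by (simp add: algebra_simps)
    have e2: "br (z j + z k + of_int (l j + l k)) * br (z j - z k + of_int (l j - l k)) = Y (shifted z l j) - Y (shifted z l k)" for l
      using br_Y[of "shifted z l j" "shifted z l k"] unfolding shifted_def by (simp add: algebra_simps)
    have eq: "br (g + of_int e * z j + z k + of_int (e * l j + l k)) *
       br (g + of_int e * z j - z k + of_int (e * l j - l k)) * ((t - Y (shifted z l k)) *
       (1 / br (z j + z k + of_int (l j + l k)) * (1 / br (z j - z k + of_int (l j - l k)))))
       = (Y (g + of_int e * shifted z l j) - Y (shifted z l k)) *
       ((t - Y (shifted z l k)) / (Y (shifted z l j) - Y (shifted z l k)))" for l
      unfolding e1[symmetric] e2[symmetric] by (simp only: times_divide_eq_right times_divide_times_eq divide_divide_eq_left mult_1_right mult_1_left)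
    show ?thesis using main unfolding eq by simp
  qed
  have "pbd n (2 + real (card ({1..n} - {j})) * 2) (\<lambda>l. ibp n g a b c d t (shifted z l) j (of_int e * shifted z l j))"
    unfolding ibp_def by (intro pbd_mult v pbd_prod f) auto
  moreover have "2 + real (card ({1..n} - {j})) * 2 = 2 * real n" using j by (simp add: of_nat_diff)
  ultimately show ?thesis by simp
qed

text \<open>The coefficient is bounded by a product of n factors that are linear in the values of
  \<open>Y\<close>, each of order 1.\<close>

lemma newton_pbd:
  assumes "m \<le> n"
  shows "pbd n (real n) (\<lambda>l. newton y (\<lambda>k. Y (shifted z l k)) n m)"
proof -
  define A where "A = (\<Sum>m\<le>n. norm (y m))"
  have A: "norm (y m) \<le> A" if "m \<le> n" for m unfolding A_def using that by (intro member_le_sum) auto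
  have "pbd n 1 (\<lambda>l. of_real (1 + A + norm (Y (shifted z l k))))" if k: "k \<in> {1..n}" for k
  proof -
    obtain C where C: "C \<ge> 0" "\<And>l. norm (0 - Y (shifted z l k)) \<le> C * wprod n l powr 1"
      using pbd_t_minus_Y[OF k, of 0 z] unfolding pbd_def by blast
    have A0: "A \<ge> 0" unfolding A_def by (intro sum_nonneg) auto
    have "norm (complex_of_real (1 + A + norm (Y (shifted z l k)))) \<le> (1 + A + C) * wprod n l powr 1" for l
    proof -
      have "1 + A \<le> (1 + A) * wprod n l" using A0 wprod_ge_1[of n l] mult_left_mono[of 1 "wprod n l" "1 + A"] by simp
      moreover have "norm (Y (shifted z l k)) \<le> C * wprod n l" using C(2)[of l] wprod_ge_1[of n l] by simp
      ultimately show ?thesis using A0 wprod_ge_1[of n l] unfolding norm_of_real by (simp add: algebra_simps abs_of_nonneg)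
    qed
    then show ?thesis unfolding pbd_def using A0 C(1) by (intro exI[of _ "1 + A + C"]) (auto simp del: norm_of_real)
  qed
  then have "pbd n (real (card {1..n}) * 1) (\<lambda>l. \<Prod>k\<in>{1..n}. of_real (1 + A + norm (Y (shifted z l k))))"
    by (intro pbd_prod) auto
  then obtain C where C: "C \<ge> 0" "\<And>l. norm (\<Prod>k\<in>{1..n}. complex_of_real (1 + A + norm (Y (shifted z l k)))) \<le> C * wprod n l powr real n"
    unfolding pbd_def by auto
  have "norm (newton y (\<lambda>k. Y (shifted z l k)) n m) \<le> C * wprod n l powr real n" for l
  proof -
    have "norm (newton y (\<lambda>k. Y (shifted z l k)) n m) \<le> (\<Prod>k\<in>{1..n}. 1 + A + norm (Y (shifted z l k)))"
      by (rule newton_norm_le[OF A assms]) simp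
    also have "\<dots> \<le> norm (\<Prod>k\<in>{1..n}. complex_of_real (1 + A + norm (Y (shifted z l k))))"
      unfolding of_real_prod[symmetric] norm_of_real by simp
    finally show ?thesis using C(2)[of l] by linarith
  qed
  then show ?thesis unfolding pbd_def using C(1) by blast
qed

end

section \<open>The first-order recurrence of the sum\<close>

lemma has_sum_sum_finite:
  fixes f :: "'i \<Rightarrow> 'a \<Rightarrow> complex"
  assumes "finite A" "\<And>i. i \<in> A \<Longrightarrow> (f i has_sum s i) B"
  shows "((\<lambda>x. \<Sum>i\<in>A. f i x) has_sum (\<Sum>i\<in>A. s i)) B"
  using assms by (induction rule: finite_induct) (auto intro: has_sum_add)

lemma infsum_sum_finite:
  fixes f :: "'i \<Rightarrow> 'a \<Rightarrow> complex"
  assumes "finite A" "\<And>i. i \<in> A \<Longrightarrow> f i summable_on B"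
  shows "(\<Sum>\<^sub>\<infinity>x\<in>B. \<Sum>i\<in>A. f i x) = (\<Sum>i\<in>A. infsum (f i) B)"
  using assms by (intro infsumI has_sum_sum_finite has_sum_infsum) auto

context gamma_like
begin

text \<open>The brackets of m g are divided out of the recurrence, the values F (1 + m g) keep
  \<open>R\<close> finite and nonzero, and g + 2 z j, g - 2 z j must avoid the lattice so that the
  operator is defined at every shifted point. Exceptional g are isolated
  (\<open>eventually_generic\<close>).\<close>

definition generic :: "nat \<Rightarrow> complex \<Rightarrow> (nat \<Rightarrow> complex) \<Rightarrow> bool" where
  "generic n g z \<longleftrightarrow> (\<forall>m\<in>{1..n}. br (of_nat m * g) \<noteq> 0 \<and> F (1 + of_nat m * g) \<noteq> 0) \<and>
     (\<forall>j\<in>{1..n}. nz (g + 2 * z j) \<and> nz (g - 2 * z j))"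

lemma shifted_nz:
  assumes "admissible n z" and j: "j \<in> {1..n}"
  shows "nz (2 * shifted z l j)" "\<And>k. k \<in> {1..n} - {j} \<Longrightarrow> nz (shifted z l j + shifted z l k) \<and> nz (shifted z l j - shifted z l k)"
proof -
  have "nz (2 * z j + of_int (2 * l j))" using assms nz_add_int unfolding admissible_def by blast
  then show "nz (2 * shifted z l j)" unfolding shifted_def by (simp add: algebra_simps)
  fix k assume k: "k \<in> {1..n} - {j}"
  have "nz (z j + z k) \<and> nz (z j - z k)"
  proof (cases "j < k")
    case True
    then show ?thesis using assms k unfolding admissible_def by auto
  next
    case False
    then have "nz (z k + z j)" "nz (z k - z j)" using assms k unfolding admissible_def by auto
    then show ?thesis using nz_minus[of "z k - z j"] by (simp add: add.commute)
  qed
  then have "nz (z j + z k + of_int (l j + l k))" "nz (z j - z k + of_int (l j - l k))" using nz_add_int by blast+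
  then show "nz (shifted z l j + shifted z l k) \<and> nz (shifted z l j - shifted z l k)"
    unfolding shifted_def by (simp add: algebra_simps)
qed

lemma bij_betw_shift_coordinate:
  assumes "j \<in> {1..n}"
  shows "bij_betw (\<lambda>l. l(j := l j + 1)) (int_vectors n) (int_vectors n)"
  by (rule bij_betwI[where g = "\<lambda>l. l(j := l j - 1)"])
    (use assms in \<open>auto simp: int_vectors_def PiE_def extensional_def\<close>)

text \<open>Translating the coordinate j by 1 permutes the lattice and carries the first half into
  minus the second. The decay above 2n makes the halves summable separately.\<close>

lemma infsum_ibp_zero:
  assumes adm: "admissible n z" and dec: "decay n g (a + b + c + d) > 2 * real n" and j: "j \<in> {1..n}"
  shows "(\<Sum>\<^sub>\<infinity>l\<in>int_vectors n. Phi n g a b c d (shifted z l) *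
     (ibp n g a b c d t (shifted z l) j (shifted z l j) + ibp n g a b c d t (shifted z l) j (- shifted z l j))) = 0"
proof -
  define f where "f l = Phi n g a b c d (shifted z l) * ibp n g a b c d t (shifted z l) j (shifted z l j)" for l
  define h where "h l = Phi n g a b c d (shifted z l) * ibp n g a b c d t (shifted z l) j (- shifted z l j)" for l
  have sf: "f summable_on int_vectors n"
    unfolding f_def using abs_summable_summable[OF Phi_pbd_summable[OF adm dec ibp_pbd[OF adm j, where e = 1 and t = t]]]
    by simp
  have sh: "h summable_on int_vectors n"
    unfolding h_def using abs_summable_summable[OF Phi_pbd_summable[OF adm dec ibp_pbd[OF adm j, where e = "-1" and t = t]]]
    by simp
  have fh: "f (l(j := l j + 1)) = - h l" for l
  proof -
    have "shifted z (l(j := l j + 1)) = (shifted z l)(j := shifted z l j + 1)"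
      unfolding shifted_def by (auto simp: algebra_simps)
    then show ?thesis
      using ibp_step[where x = "shifted z l" and t = t, OF j] unfolding f_def h_def by simp
  qed
  have "infsum f (int_vectors n) = (\<Sum>\<^sub>\<infinity>l\<in>int_vectors n. f (l(j := l j + 1)))"
    using infsum_reindex_bij_betw[OF bij_betw_shift_coordinate[OF j], of f] by simp
  also have "\<dots> = - infsum h (int_vectors n)" unfolding fh by (rule infsum_uminus)
  finally have "infsum f (int_vectors n) + infsum h (int_vectors n) = 0" by simp
  then show ?thesis unfolding infsum_add[OF sf sh, symmetric] unfolding f_def h_def by (simp add: distrib_left)
qed

text \<open>Averaging \<open>newton_ibp\<close> against the summand kills its right side.
  Independence of the Newton basis leaves two-term relations (e n - e m) C m = lo (m + 1) C (m + 1)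
  between the moments \<open>C m\<close> of the Newton coefficients. Chaining them links C 0 with C
  n. The first is the sum with a lowered by 1, since W (a - 1) u = (Y a - Y u) W a u; the second is
  the original sum up to the sign (-1)^n.\<close>

lemma S_recurrence:
  assumes adm: "admissible n z" and gen: "generic n g z" and dec: "decay n g (a + b + c + d) > 2 * real n"
  shows "S n g (a - 1) b c d z * (\<Prod>m<n. br (a + b + c + d + (of_nat n - 1 + of_nat m) * g)) =
    (\<Prod>m<n. br (a + b + of_nat m * g) * br (a + c + of_nat m * g) * br (a + d + of_nat m * g)) * S n g a b c d z"
proof (cases "n = 0")
  case True
  then show ?thesis unfolding S_def Phi_def by simp
next
  case False
  then have n: "n \<ge> 1" by simp
  define G where "G = a + b + c + d"
  define P where "P l = Phi n g a b c d (shifted z l)" for l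
  define N where "N l m = newton (node g a) (\<lambda>k. Y (shifted z l k)) n m" for l m
  define C where "C m = (\<Sum>\<^sub>\<infinity>l\<in>int_vectors n. P l * N l m)" for m
  define e where "e m = eigval g G m" for m
  define lo where "lo m = lower g a b c d m" for m
  have sumN: "(\<lambda>l. P l * N l m) summable_on int_vectors n" if "m \<le> n" for m
  proof -
    have "pbd n (2 * real n) (\<lambda>l. N l m)" unfolding N_def by (rule pbd_mono[OF newton_pbd[OF that]]) simp
    from Phi_pbd_summable[OF adm dec this] show ?thesis unfolding P_def by (rule abs_summable_summable)
  qed
  have sumI: "(\<lambda>l. P l * (ibp n g a b c d t (shifted z l) j (shifted z l j) + ibp n g a b c d t (shifted z l) j (- shifted z l j)))
      summable_on int_vectors n" if j: "j \<in> {1..n}" for j t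
  proof -
    have "pbd n (2 * real n) (\<lambda>l. ibp n g a b c d t (shifted z l) j (shifted z l j) + ibp n g a b c d t (shifted z l) j (- shifted z l j))"
      using ibp_pbd[OF adm j, of 1 g a b c d t] ibp_pbd[OF adm j, of "-1" g a b c d t] by (intro pbd_add) simp_all
    from Phi_pbd_summable[OF adm dec this] show ?thesis unfolding P_def by (rule abs_summable_summable)
  qed
  have pointwise: "(\<Sum>m\<le>n. N l m * ((e m - e n) * basis g a m t + lo m * basis g a (m - 1) t))
    = br g * (\<Sum>j\<in>{1..n}. ibp n g a b c d t (shifted z l) j (shifted z l j) + ibp n g a b c d t (shifted z l) j (- shifted z l j))" for l t
    unfolding N_def e_def lo_def G_def
  proof (rule newton_ibp[OF n])
    fix j k assume "j \<in> {1..n}" "k \<in> {1..n}" "j \<noteq> k"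
    then have "br (shifted z l j + shifted z l k) \<noteq> 0" "br (shifted z l j - shifted z l k) \<noteq> 0"
      using shifted_nz(2)[OF adm] nz_br(2) by blast+
    then show "Y (shifted z l j) \<noteq> Y (shifted z l k)" using br_Y[of "shifted z l j" "shifted z l k"] by auto
  next
    fix j assume j: "j \<in> {1..n}"
    have "nz (g + 2 * z j)" "nz (g - 2 * z j)" using gen j unfolding generic_def by auto
    then have "br (g + 2 * z j + of_int (2 * l j)) \<noteq> 0" "br (g - 2 * z j + of_int (- 2 * l j)) \<noteq> 0"
      using nz_br(1) by blast+
    then show "br (2 * shifted z l j) \<noteq> 0 \<and> br (g + 2 * shifted z l j) \<noteq> 0 \<and> br (g - 2 * shifted z l j) \<noteq> 0"
      using nz_br(2)[OF shifted_nz(1)[OF adm j]] unfolding shifted_def by (simp add: algebra_simps)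
  qed
  have "(\<Sum>m\<le>n. C m * ((e m - e n) * basis g a m t + lo m * basis g a (m - 1) t)) = 0" for t
  proof -
    define q where "q m = (e m - e n) * basis g a m t + lo m * basis g a (m - 1) t" for m
    have "(\<Sum>m\<le>n. C m * q m) = (\<Sum>m\<le>n. \<Sum>\<^sub>\<infinity>l\<in>int_vectors n. P l * N l m * q m)"
      unfolding C_def by (simp add: infsum_cmult_left')
    also have "\<dots> = (\<Sum>\<^sub>\<infinity>l\<in>int_vectors n. \<Sum>m\<le>n. P l * N l m * q m)"
      by (intro infsum_sum_finite[symmetric] summable_on_cmult_left sumN) simp_all
    also have "\<dots> = (\<Sum>\<^sub>\<infinity>l\<in>int_vectors n. P l * (\<Sum>m\<le>n. N l m * q m))"
      by (simp add: sum_distrib_left mult_ac)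
    also have "\<dots> = (\<Sum>\<^sub>\<infinity>l\<in>int_vectors n. \<Sum>j\<in>{1..n}. br g * (P l * (ibp n g a b c d t (shifted z l) j (shifted z l j) + ibp n g a b c d t (shifted z l) j (- shifted z l j))))"
      unfolding q_def pointwise by (simp add: sum_distrib_left mult_ac)
    also have "\<dots> = (\<Sum>j\<in>{1..n}. \<Sum>\<^sub>\<infinity>l\<in>int_vectors n. br g * (P l * (ibp n g a b c d t (shifted z l) j (shifted z l j) + ibp n g a b c d t (shifted z l) j (- shifted z l j))))"
      by (intro infsum_sum_finite summable_on_cmult_right sumI) simp_all
    also have "\<dots> = 0"
      unfolding infsum_cmult_right' P_def using infsum_ibp_zero[OF adm dec] by (intro sum.neutral) simp
    finally show ?thesis unfolding q_def .
  qed
  \<comment> \<open>The term m = n drops because its factor is e n - e n. The lowered terms are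
    reindexed by one, \<open>lo 0\<close> being 0.\<close>
  then have rel0: "(\<Sum>m<n. ((e m - e n) * C m + lo (Suc m) * C (Suc m)) * basis g a m t) = 0" for t
  proof -
    have "(\<Sum>m\<le>n. C m * ((e m - e n) * basis g a m t + lo m * basis g a (m - 1) t))
       = (\<Sum>m\<le>n. C m * (e m - e n) * basis g a m t) + (\<Sum>m\<le>n. C m * lo m * basis g a (m - 1) t)"
      unfolding sum.distrib[symmetric] by (intro sum.cong refl) (simp only: distrib_left mult.assoc)
    also have "(\<Sum>m\<le>n. C m * (e m - e n) * basis g a m t) = (\<Sum>m<n. C m * (e m - e n) * basis g a m t)"
      by (subst lessThan_Suc_atMost[symmetric]) simp
    also have "(\<Sum>m\<le>n. C m * lo m * basis g a (m - 1) t) = (\<Sum>m<n. C (Suc m) * lo (Suc m) * basis g a m t)"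
      by (subst sum.atMost_shift) (simp add: lo_def lower_0)
    finally show ?thesis using \<open>\<And>t. (\<Sum>m\<le>n. C m * ((e m - e n) * basis g a m t + lo m * basis g a (m - 1) t)) = 0\<close>
      by (simp add: sum.distrib[symmetric] algebra_simps)
  qed
  have rel: "(e n - e m) * C m = lo (Suc m) * C (Suc m)" if "m < n" for m
    using newton_basis_independent[OF rel0[unfolded basis_def] that] by (simp add: algebra_simps)
  have "(\<Prod>i<m. e n - e i) * C 0 = (\<Prod>i<m. lo (Suc i)) * C m" if "m \<le> n" for m
    using that
  proof (induction m)
    case (Suc m)
    then have "(\<Prod>i<Suc m. e n - e i) * C 0 = (\<Prod>i<m. lo (Suc i)) * ((e n - e m) * C m)" by simp
    then show ?case using rel[of m] Suc.prems by simp
  qed simp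
  from this[of n] have main: "(\<Prod>i<n. e n - e i) * C 0 = (\<Prod>i<n. lo (Suc i)) * C n" by simp
  have Cn: "C n = (-1) ^ n * S n g a b c d z"
    unfolding C_def N_def newton_diag P_def S_def infsum_cmult_left' by (rule mult.commute)
  have C0: "C 0 = S n g (a - 1) b c d z"
    unfolding C_def N_def newton_0 S_def
  proof (intro infsum_cong)
    fix l
    have sg: "sg (a - 1) b c d s = (Y a - Y s) * sg a b c d s" for s unfolding sg_def W_pred by simp
    show "P l * (\<Prod>k\<in>{1..n}. node g a 0 - Y (shifted z l k)) = Phi n g (a - 1) b c d (shifted z l)"
      unfolding P_def Phi_def sg node_def by (simp add: prod.distrib mult_ac)
  qed
  have E: "(\<Prod>i<n. e n - e i) = (\<Prod>m<n. br (of_nat (Suc m) * g)) * (\<Prod>m<n. br (G + (of_nat n - 1 + of_nat m) * g))"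
  proof -
    have "(\<Prod>i<n. e n - e i) = (\<Prod>i<n. br (of_nat (n - i) * g) * br (G + (of_nat n - 1 + of_nat i) * g))"
      unfolding e_def by (intro prod.cong refl) (simp add: eigval_diff algebra_simps)
    also have "\<dots> = (\<Prod>i<n. br (of_nat (n - i) * g)) * (\<Prod>m<n. br (G + (of_nat n - 1 + of_nat m) * g))"
      by (rule prod.distrib)
    also have "(\<Prod>i<n. br (of_nat (n - i) * g)) = (\<Prod>i<n. br (of_nat (Suc i) * g))"
      by (subst prod.nat_diff_reindex[symmetric]) (auto intro!: prod.cong simp: Suc_diff_Suc)
    finally show ?thesis .
  qed
  have L: "(\<Prod>i<n. lo (Suc i)) = (-1) ^ n * (\<Prod>m<n. br (of_nat (Suc m) * g)) *
     (\<Prod>m<n. br (a + b + of_nat m * g) * br (a + c + of_nat m * g) * br (a + d + of_nat m * g))"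
    unfolding lo_def lower_def by (simp add: prod.distrib prod_uminus)
  have nz: "(\<Prod>m<n. br (of_nat (Suc m) * g)) \<noteq> 0" using gen unfolding generic_def by (simp del: of_nat_Suc)
  have sgn: "(-1 :: complex) ^ n * (-1) ^ n = 1" by (simp add: power_mult_distrib[symmetric])
  have "(\<Prod>m<n. br (of_nat (Suc m) * g)) * (S n g (a - 1) b c d z * (\<Prod>m<n. br (G + (of_nat n - 1 + of_nat m) * g)))
     = (\<Prod>m<n. br (of_nat (Suc m) * g)) * ((-1) ^ n * (-1) ^ n * (\<Prod>m<n. br (a + b + of_nat m * g) * br (a + c + of_nat m * g) * br (a + d + of_nat m * g)) * S n g a b c d z)"
    using main unfolding E L Cn C0 by (simp only: mult_ac)
  then show ?thesis using nz unfolding sgn G_def by simp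
qed

end

section \<open>Periodic functions of polynomial growth\<close>

lemma periodic_polynomial_growth_constant:
  fixes h :: "complex \<Rightarrow> complex"
  assumes hol: "h holomorphic_on UNIV" and per: "\<And>s. h (s + 1) = h s"
    and bound: "\<And>s. norm (h s) \<le> C * (1 + \<bar>Im s\<bar>) ^ m"
  shows "h s = h 0"
proof -
  have "norm (h s) \<le> (\<bar>C\<bar> * 2 ^ m) * norm s ^ m" if "1 \<le> norm s" for s
  proof -
    have "norm (h s) \<le> \<bar>C\<bar> * (1 + \<bar>Im s\<bar>) ^ m"
      by (rule order_trans[OF bound mult_right_mono[OF abs_ge_self]]) simp
    also have "\<dots> \<le> \<bar>C\<bar> * (2 * norm s) ^ m"
      using abs_Im_le_cmod[of s] that by (intro mult_left_mono power_mono) auto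
    finally show ?thesis by (simp add: power_mult_distrib mult_ac)
  qed
  then have poly: "h s = (\<Sum>k\<le>m. (deriv ^^ k) h 0 / fact k * s ^ k)" for s
    using Liouville_polynomial[OF hol] by blast
  define c where "c k = (deriv ^^ k) h 0 / fact k - (if k = 0 then h 0 else 0)" for k
  have c: "h s - h 0 = (\<Sum>k\<le>m. c k * s ^ k)" for s
  proof -
    have "(\<Sum>k\<le>m. c k * s ^ k) = (\<Sum>k\<le>m. (deriv ^^ k) h 0 / fact k * s ^ k) - (\<Sum>k\<le>m. (if k = 0 then h 0 else 0) * s ^ k)"
      unfolding sum_subtractf[symmetric] c_def by (simp only: left_diff_distrib)
    also have "(\<Sum>k\<le>m. (if k = 0 then h 0 else 0) * s ^ k) = (\<Sum>k\<le>m. if k = 0 then h 0 else 0)"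
      by (intro sum.cong) auto
    also have "\<dots> = h 0" by simp
    finally show ?thesis using poly[of s] by simp
  qed
  have hn: "h (of_nat k) = h 0" for k :: nat
  proof (induction k)
    case (Suc k)
    then show ?case using per[of "of_nat k"] by (simp add: add.commute)
  qed simp
  \<comment> \<open>By Liouville h is a polynomial, and h - h 0 vanishes at all natural
    numbers.\<close>
  have "range (of_nat :: nat \<Rightarrow> complex) \<subseteq> {s. (\<Sum>k\<le>m. c k * s ^ k) = 0}" using hn c[symmetric] by auto
  moreover have "infinite (range (of_nat :: nat \<Rightarrow> complex))" by (rule range_inj_infinite) (simp add: inj_on_def)
  ultimately have "infinite {s. (\<Sum>k\<le>m. c k * s ^ k) = 0}" using infinite_super by blast
  then have "\<forall>k\<le>m. c k = 0" using polyfun_finite_roots[of c m] by blast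
  then show ?thesis using c[of s] by simp
qed

text \<open>The periodic extension of f, obtained by rounding the real part, is entire and of
  polynomial growth. The strip is wider than one period, so that the extension is holomorphic across
  the seams; the part with small imaginary part is compact.\<close>

lemma strip_constant:
  fixes f :: "complex \<Rightarrow> complex"
  assumes hol: "f holomorphic_on {s. \<bar>Re s\<bar> < 2}"
    and per: "\<And>s. \<bar>Re s\<bar> < 2 \<Longrightarrow> \<bar>Re s + 1\<bar> < 2 \<Longrightarrow> f (s + 1) = f s"
    and bound: "\<And>s. \<bar>Re s\<bar> \<le> 1 \<Longrightarrow> \<bar>Im s\<bar> \<ge> y0 \<Longrightarrow> norm (f s) \<le> C * (1 + \<bar>Im s\<bar>) ^ m"
    and s: "\<bar>Re s\<bar> \<le> 1/2"
  shows "f s = f 0"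
proof -
  obtain B where B: "\<And>s. \<bar>Re s\<bar> \<le> 1 \<Longrightarrow> \<bar>Im s\<bar> \<le> y0 \<Longrightarrow> norm (f s) \<le> B"
  proof -
    define K where "K = cbox (Complex (-1) (-y0)) (Complex 1 y0)"
    have K: "K = {s. \<bar>Re s\<bar> \<le> 1 \<and> \<bar>Im s\<bar> \<le> y0}" unfolding K_def in_cbox_complex_iff set_eq_iff by auto
    have "continuous_on K f"
      by (rule holomorphic_on_imp_continuous_on[OF holomorphic_on_subset[OF hol]]) (auto simp: K)
    then have "bounded (f ` K)" unfolding K_def by (intro compact_imp_bounded compact_continuous_image) auto
    then show ?thesis using that unfolding bounded_iff K by blast
  qed
  have bound': "norm (f s) \<le> (\<bar>C\<bar> + \<bar>B\<bar>) * (1 + \<bar>Im s\<bar>) ^ m" if "\<bar>Re s\<bar> \<le> 1" for s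
  proof (cases "\<bar>Im s\<bar> \<le> y0")
    case True
    have "norm (f s) \<le> (\<bar>C\<bar> + \<bar>B\<bar>) * 1" using B[OF that True] by simp
    also have "\<dots> \<le> (\<bar>C\<bar> + \<bar>B\<bar>) * (1 + \<bar>Im s\<bar>) ^ m" by (intro mult_left_mono one_le_power) auto
    finally show ?thesis .
  next
    case False
    then have "norm (f s) \<le> C * (1 + \<bar>Im s\<bar>) ^ m" using bound[OF that] by simp
    also have "\<dots> \<le> (\<bar>C\<bar> + \<bar>B\<bar>) * (1 + \<bar>Im s\<bar>) ^ m" by (intro mult_right_mono) auto
    finally show ?thesis .
  qed
  define r where "r s = round (Re s)" for s :: complex
  define h where "h s = f (s - of_int (r s))" for s
  have r: "\<bar>Re s - r s\<bar> \<le> 1/2" for s unfolding r_def using of_int_round_abs_le[of "Re s"] by (simp add: abs_minus_commute)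
  have r1: "r (s + 1) = r s + 1" for s
  proof -
    have "\<lfloor>Re s + 1 + 1/2\<rfloor> = \<lfloor>Re s + 1/2\<rfloor> + 1" by linarith
    then show ?thesis unfolding r_def round_def by simp
  qed
  \<comment> \<open>Any integer within distance 1 of Re s may replace the rounded value. Near a
    given point one fixed integer therefore works, which gives holomorphy.\<close>
  have h_eq: "h s = f (s - of_int k)" if "\<bar>Re s - k\<bar> < 1" for s k
  proof -
    have "\<bar>r s - k\<bar> < 2" using r[of s] that by linarith
    then consider "k = r s" | "k = r s + 1" | "k = r s - 1" by linarith
    then show ?thesis
    proof cases
      case 1
      then show ?thesis unfolding h_def by simp
    next
      case 2
      then show ?thesis unfolding h_def using per[of "s - of_int k"] that by simp
    next
      case 3
      then have "s - of_int k = s - of_int (r s) + 1" by simp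
      moreover have "f (s - of_int (r s) + 1) = f (s - of_int (r s))"
        using that 3 r[of s] by (intro per) auto
      ultimately show ?thesis unfolding h_def by (simp only:)
    qed
  qed
  have "h s = h 0"
  proof (rule periodic_polynomial_growth_constant)
    show "h (s + 1) = h s" for s unfolding h_def r1 by simp
    show "norm (h s) \<le> (\<bar>C\<bar> + \<bar>B\<bar>) * (1 + \<bar>Im s\<bar>) ^ m" for s
      unfolding h_def using bound'[of "s - of_int (r s)"] r[of s] by simp
    have "h field_differentiable (at s0)" for s0
    proof -
      have "open {s. \<bar>Re s - r s0\<bar> < 1}" by (intro open_Collect_less continuous_intros)
      moreover have "(\<lambda>s. f (s - of_int (r s0))) holomorphic_on {s. \<bar>Re s - r s0\<bar> < 1}"
        by (rule holomorphic_on_compose_gen[OF _ hol, unfolded o_def]) (auto intro!: holomorphic_intros)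
      then have "h holomorphic_on {s. \<bar>Re s - r s0\<bar> < 1}"
        by (rule holomorphic_transform) (use h_eq in auto)
      moreover have "s0 \<in> {s. \<bar>Re s - r s0\<bar> < 1}" using r[of s0] by auto
      ultimately show ?thesis using holomorphic_on_imp_differentiable_at by blast
    qed
    then show "h holomorphic_on UNIV" unfolding holomorphic_on_def by (simp add: field_differentiable_at_within)
  qed
  moreover have "h s = f s" using h_eq[of s 0] s by simp
  moreover have "h 0 = f 0" using h_eq[of 0 0] by simp
  ultimately show ?thesis by simp
qed

section \<open>The product side and the reduction of the dimension\<close>

context gamma_like
begin

text \<open>The Selberg-type closed form of the sum. As \<open>F\<close> is a reciprocal gamma
  function, this is an ordinary gamma product turned upside down; \<open>quot_eq_R\<close>
  recognises the dual quotient in it.\<close>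

definition R :: "nat \<Rightarrow> complex \<Rightarrow> complex \<Rightarrow> complex \<Rightarrow> complex \<Rightarrow> complex \<Rightarrow> complex" where
  "R n g a b c d = (\<Prod>i<n. F 1 * F (1 + of_nat (Suc i) * g) / F (1 + g)) *
    (\<Prod>i<n. F (1 + of_nat i * g + a + b) * F (1 + of_nat i * g + a + c) * F (1 + of_nat i * g + a + d) *
            F (1 + of_nat i * g + b + c) * F (1 + of_nat i * g + b + d) * F (1 + of_nat i * g + c + d) /
            F (1 + (of_nat n - 1 + of_nat i) * g + a + b + c + d))"

lemma R_sym: "R n g a b c d = R n g b a c d" "R n g a b c d = R n g a c b d" "R n g a b c d = R n g a b d c"
  unfolding R_def by (simp_all add: add_ac mult_ac)

lemma Phi_sym: "Phi n g a b c d x = Phi n g b a c d x" "Phi n g a b c d x = Phi n g a c b d x" "Phi n g a b c d x = Phi n g a b d c x"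
  unfolding Phi_def sg_def by (simp_all add: mult_ac)

lemma S_sym: "S n g a b c d z = S n g b a c d z" "S n g a b c d z = S n g a c b d z" "S n g a b c d z = S n g a b d c z"
  unfolding S_def using Phi_sym[of n g a b c d] by simp_all

text \<open>The multiple of g is at most 2 (n - 1), which is the multiple that \<open>decay\<close>
  takes into account when Re g is negative.\<close>

lemma Re_denominator_pos:
  assumes "decay n g G > 0" "i < n"
  shows "Re (1 + (of_nat n - 1 + of_nat i) * g + G) > 0"
proof -
  define M where "M = real (n - 1 + i)"
  have M: "M \<le> 2 * real (n - 1)" "M \<ge> 0" unfolding M_def using assms(2) by auto
  have "(of_nat n - 1 + of_nat i :: complex) = of_real M" unfolding M_def using assms(2) by (simp add: of_nat_diff)
  then have "Re (1 + (of_nat n - 1 + of_nat i) * g + G) = 1 + M * Re g + Re G" by simp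
  moreover have "M * Re g \<ge> - (M * max 0 (- Re g))" using M(2) mult_left_mono[of "- max 0 (- Re g)" "Re g" M] by simp
  moreover have "M * max 0 (- Re g) \<le> 2 * real (n - 1) * max 0 (- Re g)" using M(1) by (intro mult_right_mono) auto
  ultimately show ?thesis using assms(1) unfolding decay_def neg_def by (simp add: algebra_simps)
qed

lemma R_recurrence:
  assumes "decay n g (a + b + c + d) > 1"
  shows "R n g (a - 1) b c d * (\<Prod>m<n. br (a + b + c + d + (of_nat n - 1 + of_nat m) * g)) =
    (\<Prod>m<n. br (a + b + of_nat m * g) * br (a + c + of_nat m * g) * br (a + d + of_nat m * g)) * R n g a b c d"
proof -
  define G where "G = a + b + c + d"
  define f where "f a m = F (1 + of_nat m * g + a + b) * F (1 + of_nat m * g + a + c) * F (1 + of_nat m * g + a + d) *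
            F (1 + of_nat m * g + b + c) * F (1 + of_nat m * g + b + d) * F (1 + of_nat m * g + c + d) /
            F (1 + (of_nat n - 1 + of_nat m) * g + a + b + c + d)" for a m
  have step: "f (a - 1) m * br (G + (of_nat n - 1 + of_nat m) * g) =
     br (a + b + of_nat m * g) * br (a + c + of_nat m * g) * br (a + d + of_nat m * g) * f a m" if m: "m < n" for m
  proof -
    define v where "v = G + (of_nat n - 1 + of_nat m) * g"
    have "Re (1 + (of_nat n - 1 + of_nat m) * g + (G - 1)) > 0"
      using assms m unfolding G_def by (intro Re_denominator_pos) (auto simp: decay_def)
    then have "br v \<noteq> 0" unfolding v_def by (intro br_nonzero) auto
    then have v: "br v / F v = 1 / F (v + 1)" using F_rec[of v] by simp
    have num: "F (1 + of_nat m * g + (a - 1) + r) = br (a + r + of_nat m * g) * F (1 + of_nat m * g + a + r)" for r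
      using F_rec[of "a + r + of_nat m * g"] by (simp add: algebra_simps)
    have d1: "1 + (of_nat n - 1 + of_nat m) * g + (a - 1) + b + c + d = v"
      and d2: "1 + (of_nat n - 1 + of_nat m) * g + a + b + c + d = v + 1"
      unfolding v_def G_def by (simp_all add: algebra_simps)
    have "f (a - 1) m * br v = br (a + b + of_nat m * g) * br (a + c + of_nat m * g) * br (a + d + of_nat m * g) *
       (F (1 + of_nat m * g + a + b) * F (1 + of_nat m * g + a + c) * F (1 + of_nat m * g + a + d) *
            F (1 + of_nat m * g + b + c) * F (1 + of_nat m * g + b + d) * F (1 + of_nat m * g + c + d)) * (br v / F v)"
      unfolding f_def d1 num by (simp only: times_divide_eq_right times_divide_eq_left mult_ac)
    also have "\<dots> = br (a + b + of_nat m * g) * br (a + c + of_nat m * g) * br (a + d + of_nat m * g) * f a m"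
      unfolding v f_def d2 by (simp only: times_divide_eq_right mult_1_right mult.assoc)
    finally show ?thesis unfolding v_def .
  qed
  have Rf: "R n g a b c d = (\<Prod>i<n. F 1 * F (1 + of_nat (Suc i) * g) / F (1 + g)) * (\<Prod>i<n. f a i)" for a
    unfolding R_def f_def ..
  define B where "B = (\<Prod>i<n. F 1 * F (1 + of_nat (Suc i) * g) / F (1 + g))"
  define Q where "Q = (\<Prod>m<n. br (G + (of_nat n - 1 + of_nat m) * g))"
  define T where "T = (\<Prod>m<n. br (a + b + of_nat m * g) * br (a + c + of_nat m * g) * br (a + d + of_nat m * g))"
  have "(\<Prod>i<n. f (a - 1) i) * (\<Prod>m<n. br (G + (of_nat n - 1 + of_nat m) * g))
     = (\<Prod>m<n. br (a + b + of_nat m * g) * br (a + c + of_nat m * g) * br (a + d + of_nat m * g)) * (\<Prod>i<n. f a i)"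
    unfolding prod.distrib[symmetric] using step by (intro prod.cong refl) (simp add: prod.distrib)
  then have "(\<Prod>i<n. f (a - 1) i) * Q = T * (\<Prod>i<n. f a i)" unfolding Q_def T_def .
  then have "B * ((\<Prod>i<n. f (a - 1) i) * Q) = B * (T * (\<Prod>i<n. f a i))" by simp
  then show ?thesis unfolding Rf G_def[symmetric] B_def[symmetric] Q_def[symmetric] T_def[symmetric] by (simp only: mult_ac)
qed

lemma recurrence_factor_nonzero:
  assumes "decay n g (a + b + c + d) > 1"
  shows "(\<Prod>m<n. br (a + b + c + d + (of_nat n - 1 + of_nat m) * g)) \<noteq> 0"
proof (subst prod_zero_iff)
  show "\<not> (\<exists>m\<in>{..<n}. br (a + b + c + d + (of_nat n - 1 + of_nat m) * g) = 0)"
  proof (clarify)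
    fix m assume "m < n" "br (a + b + c + d + (of_nat n - 1 + of_nat m) * g) = 0"
    moreover have "Re (1 + (of_nat n - 1 + of_nat m) * g + (a + b + c + d - 1)) > 0"
      using assms \<open>m < n\<close> by (intro Re_denominator_pos) (auto simp: decay_def)
    ultimately show False using br_zero[of "a + b + c + d + (of_nat n - 1 + of_nat m) * g"] by simp
  qed
qed simp

text \<open>Both sides obey the same recurrence, whose factor on the lowered side is nonzero. The
  cross-multiplied form is kept because \<open>R\<close> may vanish here.\<close>

lemma S_R_shift:
  assumes "admissible n z" "generic n g z" "decay n g (a + b + c + d) > 2 * real n + 1"
  shows "S n g (a - 1) b c d z * R n g a b c d = S n g a b c d z * R n g (a - 1) b c d"
proof -
  define Q where "Q = (\<Prod>m<n. br (a + b + c + d + (of_nat n - 1 + of_nat m) * g))"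
  have "Q \<noteq> 0" unfolding Q_def using assms(3) by (intro recurrence_factor_nonzero) simp
  have 1: "S n g (a - 1) b c d z * Q = (\<Prod>m<n. br (a + b + of_nat m * g) * br (a + c + of_nat m * g) * br (a + d + of_nat m * g)) * S n g a b c d z"
    unfolding Q_def using assms by (intro S_recurrence) auto
  have 2: "R n g (a - 1) b c d * Q = (\<Prod>m<n. br (a + b + of_nat m * g) * br (a + c + of_nat m * g) * br (a + d + of_nat m * g)) * R n g a b c d"
    unfolding Q_def using assms by (intro R_recurrence) auto
  have "Q * (S n g (a - 1) b c d z * R n g a b c d) = (S n g (a - 1) b c d z * Q) * R n g a b c d" by (simp only: mult_ac)
  also have "\<dots> = S n g a b c d z * ((\<Prod>m<n. br (a + b + of_nat m * g) * br (a + c + of_nat m * g) * br (a + d + of_nat m * g)) * R n g a b c d)"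
    unfolding 1 by (simp only: mult_ac)
  also have "\<dots> = Q * (S n g a b c d z * R n g (a - 1) b c d)" unfolding 2[symmetric] by (simp only: mult_ac)
  finally show ?thesis using \<open>Q \<noteq> 0\<close> by simp
qed

text \<open>At s = z' + l the factors W (-z') s and W z' s contain F (1 + l) and F (1 - l), one of
  which is zero unless l = 0. So the last coordinate is frozen at z', and its pair factors turn the
  parameters -z', z' of the other coordinates into g + z', g - z'.\<close>

lemma S_reduction:
  assumes adm: "admissible (Suc n) z" and z': "z' = z (Suc n)"
  shows "S (Suc n) g (- z') z' c d z = F 1 ^ 2 * W c z' * W d z' * S n g (g + z') (g - z') c d z"
proof -
  have nz2: "nz (2 * z')" using adm unfolding admissible_def z' by auto
  have brz: "br 0 = 0" by (rule br_0)
  \<comment> \<open>As br 0 = 0, the recurrence makes \<open>F\<close> vanish at 0 and then at every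
    negative integer.\<close>
  have Fneg: "F (1 + of_int m) = 0" if "m < 0" for m :: int
  proof -
    have "F (of_int (- int k)) = 0" for k :: nat
    proof (induction k)
      case 0
      then show ?case using F_rec[of 0] brz by simp
    next
      case (Suc k)
      then show ?case using F_rec[of "of_int (- int (Suc k))"] by simp
    qed
    from this[of "nat (- m - 1)"] that show ?thesis by (simp add: algebra_simps)
  qed
  have zero: "Phi (Suc n) g (- z') z' c d (shifted z l) = 0" if "l (Suc n) \<noteq> 0" for l
  proof -
    define s where "s = shifted z l (Suc n)"
    have s: "s = z' + of_int (l (Suc n))" unfolding s_def shifted_def z' ..
    have "W (- z') s * W z' s = 0"
    proof (cases "l (Suc n) < 0")
      case True
      then show ?thesis unfolding W_def s using Fneg[of "l (Suc n)"] by (simp add: algebra_simps)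
    next
      case False
      then have "F (1 + of_int (- l (Suc n))) = 0" using that by (intro Fneg) simp
      then show ?thesis unfolding W_def s by (simp add: algebra_simps)
    qed
    then have "sg (- z') z' c d s = 0" unfolding sg_def by simp
    then have "(\<Prod>j\<in>{1..Suc n}. sg (- z') z' c d (shifted z l j)) = 0" unfolding s_def by simp
    then show ?thesis unfolding Phi_def by simp
  qed
  have red: "Phi (Suc n) g (- z') z' c d (shifted z (l(Suc n := 0))) = F 1 ^ 2 * W c z' * W d z' * Phi n g (g + z') (g - z') c d (shifted z l)"
    for l
  proof -
    define x where "x = shifted z (l(Suc n := 0))"
    have xS: "x (Suc n) = z'" unfolding x_def shifted_def z' by simp
    have x: "x j = shifted z l j" if "j \<in> {1..n}" for j using that unfolding x_def shifted_def by auto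
    have "sg (- z') z' c d z' = F 1 ^ 2 * W c z' * W d z'"
      unfolding sg_def using nz_F_simps[OF nz2] by (simp add: W_def power2_eq_square algebra_simps)
    moreover have "pr g (x j) z' * sg (- z') z' c d (x j) = sg (g + z') (g - z') c d (x j)" if j: "j \<in> {1..n}" for j
    proof -
      have "nz (z j + z')" "nz (z j - z')" using adm j unfolding admissible_def z' by auto
      then have "nz (x j + z')" "nz (x j - z')" using nz_add_int[of "z j + z'" "l j"] nz_add_int[of "z j - z'" "l j"]
        unfolding x[OF j] shifted_def by (simp_all add: algebra_simps)
      then have nonz: "F (1 + (x j + z')) \<noteq> 0" "F (1 - (x j + z')) \<noteq> 0" "F (1 + (x j - z')) \<noteq> 0" "F (1 - (x j - z')) \<noteq> 0"
        using nz_F_simps by auto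
      \<comment> \<open>The two arguments are regrouped: a pair factor at parameter g becomes a
        product of single factors at g + z' and g - z', and its denominator cancels the old single
        factors.\<close>
      have 1: "W g (x j + z') * W g (x j - z') = W (g + z') (x j) * W (g - z') (x j)"
        unfolding W_def by (simp add: algebra_simps)
      have 2: "W 0 (x j + z') * W 0 (x j - z') = W (- z') (x j) * W z' (x j)"
        unfolding W_def by (simp add: algebra_simps)
      have 3: "W (- z') (x j) * W z' (x j) \<noteq> 0" unfolding 2[symmetric] using nonz unfolding W_def by simp
      have "pr g (x j) z' * sg (- z') z' c d (x j) = W (g + z') (x j) * W (g - z') (x j) / (W (- z') (x j) * W z' (x j)) *
         ((W (- z') (x j) * W z' (x j)) * (W c (x j) * W d (x j) / W 0 (2 * x j)))"
        unfolding pr_def sg_def 1 2 by (simp only: mult.assoc times_divide_eq_right)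
      also have "\<dots> = sg (g + z') (g - z') c d (x j)" unfolding sg_def using 3 by simp
      finally show ?thesis .
    qed
    ultimately have sgz: "sg (- z') z' c d z' = F 1 ^ 2 * W c z' * W d z'"
      and sgx: "(\<Prod>j\<in>{1..n}. pr g (x j) z' * sg (- z') z' c d (x j)) = (\<Prod>j\<in>{1..n}. sg (g + z') (g - z') c d (x j))"
      by (simp, intro prod.cong) simp_all
    have "Phi (Suc n) g (- z') z' c d x =
       (\<Prod>j\<in>{1..n}. \<Prod>k\<in>{j+1..n}. pr g (x j) (x k)) * (\<Prod>j\<in>{1..n}. pr g (x j) z') *
       ((\<Prod>j\<in>{1..n}. sg (- z') z' c d (x j)) * sg (- z') z' c d z')"
      unfolding Phi_def prod_pairs_Suc xS by (simp add: prod.cl_ivl_Suc xS)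
    also have "\<dots> = (\<Prod>j\<in>{1..n}. \<Prod>k\<in>{j+1..n}. pr g (x j) (x k)) *
       (\<Prod>j\<in>{1..n}. pr g (x j) z' * sg (- z') z' c d (x j)) * (F 1 ^ 2 * W c z' * W d z')"
      unfolding sgz prod.distrib by (simp only: mult_ac)
    finally have "Phi (Suc n) g (- z') z' c d x =
       (\<Prod>j\<in>{1..n}. \<Prod>k\<in>{j+1..n}. pr g (x j) (x k)) * (\<Prod>j\<in>{1..n}. sg (g + z') (g - z') c d (x j)) * (F 1 ^ 2 * W c z' * W d z')"
      unfolding sgx .
    also have "(\<Prod>j\<in>{1..n}. \<Prod>k\<in>{j+1..n}. pr g (x j) (x k)) = (\<Prod>j\<in>{1..n}. \<Prod>k\<in>{j+1..n}. pr g (shifted z l j) (shifted z l k))"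
      by (intro prod.cong refl) (simp add: x)
    also have "(\<Prod>j\<in>{1..n}. sg (g + z') (g - z') c d (x j)) = (\<Prod>j\<in>{1..n}. sg (g + z') (g - z') c d (shifted z l j))"
      by (intro prod.cong refl) (simp add: x)
    finally show ?thesis unfolding x_def Phi_def by (simp only: mult_ac)
  qed
  have bij: "bij_betw (\<lambda>l. l(Suc n := 0)) (int_vectors n) {l \<in> int_vectors (Suc n). l (Suc n) = 0}"
    by (rule bij_betwI[where g = "\<lambda>l. l(Suc n := undefined)"])
      (auto simp: int_vectors_def PiE_def extensional_def fun_eq_iff)
  have "S (Suc n) g (- z') z' c d z = (\<Sum>\<^sub>\<infinity>l\<in>{l \<in> int_vectors (Suc n). l (Suc n) = 0}. Phi (Suc n) g (- z') z' c d (shifted z l))"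
    unfolding S_def by (rule infsum_cong_neutral) (auto simp: zero)
  also have "\<dots> = (\<Sum>\<^sub>\<infinity>l\<in>int_vectors n. Phi (Suc n) g (- z') z' c d (shifted z (l(Suc n := 0))))"
    by (rule infsum_reindex_bij_betw[OF bij, symmetric])
  also have "\<dots> = F 1 ^ 2 * W c z' * W d z' * S n g (g + z') (g - z') c d z"
    unfolding red S_def by (rule infsum_cmult_right')
  finally show ?thesis .
qed

end

context gamma_like
begin

text \<open>The strings \<open>A\<close>, \<open>P\<close>, \<open>E\<close> of the larger product
  are those of the smaller one, some of them moved by a step, together with a few end factors. These
  give the prefactor.\<close>

lemma R_reduction:
  assumes "F (1 + g) \<noteq> 0" "F (1 + of_nat n * g + c + d) \<noteq> 0"
  shows "R (Suc n) g (- z') z' c d = F 1 ^ 2 * W c z' * W d z' * R n g (g + z') (g - z') c d"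
proof -
  define A where "A i = F (1 + of_nat i * g)" for i :: nat
  define P where "P i = F (1 + of_nat i * g - z' + c) * F (1 + of_nat i * g - z' + d) * F (1 + of_nat i * g + z' + c) * F (1 + of_nat i * g + z' + d)" for i :: nat
  define E where "E i = F (1 + of_nat i * g + c + d)" for i :: nat
  define B where "B = (\<Prod>i<n. F 1 * A (Suc i) / A 1)"
  have R1: "R (Suc n) g (- z') z' c d = B * (F 1 * A (Suc n) / A 1) * ((\<Prod>i<Suc n. A i) * (\<Prod>i<Suc n. P i) * (\<Prod>i<Suc n. E i) / (\<Prod>i<Suc n. E (n + i)))"
  proof -
    have t: "F (1 + of_nat i * g + - z' + z') * F (1 + of_nat i * g + - z' + c) * F (1 + of_nat i * g + - z' + d) *
            F (1 + of_nat i * g + z' + c) * F (1 + of_nat i * g + z' + d) * F (1 + of_nat i * g + c + d) /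
            F (1 + (of_nat (Suc n) - 1 + of_nat i) * g + - z' + z' + c + d) = A i * P i * E i / E (n + i)" for i
      unfolding A_def P_def E_def by (simp add: mult_ac)
    have "R (Suc n) g (- z') z' c d = (\<Prod>i<Suc n. F 1 * A (Suc i) / A 1) * (\<Prod>i<Suc n. A i * P i * E i / E (n + i))"
      unfolding R_def t unfolding A_def by simp
    also have "(\<Prod>i<Suc n. F 1 * A (Suc i) / A 1) = B * (F 1 * A (Suc n) / A 1)" unfolding B_def by simp
    finally show ?thesis unfolding prod_dividef prod.distrib .
  qed
  have R2: "R n g (g + z') (g - z') c d = B * ((\<Prod>i<n. A (Suc (Suc i))) * (\<Prod>i<n. P (Suc i)) * (\<Prod>i<n. E i) / (\<Prod>i<n. E (n + Suc i)))"
  proof -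
    have "F (1 + of_nat i * g + (g + z') + (g - z')) * F (1 + of_nat i * g + (g + z') + c) * F (1 + of_nat i * g + (g + z') + d) *
            F (1 + of_nat i * g + (g - z') + c) * F (1 + of_nat i * g + (g - z') + d) * F (1 + of_nat i * g + c + d) /
            F (1 + (of_nat n - 1 + of_nat i) * g + (g + z') + (g - z') + c + d) = A (Suc (Suc i)) * P (Suc i) * E i / E (n + Suc i)" for i
    proof -
      have e: "1 + of_nat i * g + (g + z') + (g - z') = 1 + of_nat (Suc (Suc i)) * g"
         "1 + of_nat i * g + (g + z') + c = 1 + of_nat (Suc i) * g + z' + c"
         "1 + of_nat i * g + (g + z') + d = 1 + of_nat (Suc i) * g + z' + d"
         "1 + of_nat i * g + (g - z') + c = 1 + of_nat (Suc i) * g - z' + c"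
         "1 + of_nat i * g + (g - z') + d = 1 + of_nat (Suc i) * g - z' + d"
         "1 + (of_nat n - 1 + of_nat i) * g + (g + z') + (g - z') + c + d = 1 + of_nat (n + Suc i) * g + c + d"
        by (simp_all add: algebra_simps)
      show ?thesis unfolding e A_def P_def E_def by (simp only: mult_ac)
    qed
    then have "R n g (g + z') (g - z') c d = (\<Prod>i<n. F 1 * A (Suc i) / A 1) * (\<Prod>i<n. A (Suc (Suc i)) * P (Suc i) * E i / E (n + Suc i))"
      unfolding R_def unfolding A_def by simp
    then show ?thesis unfolding B_def[symmetric] by (simp only: prod.distrib prod_dividef)
  qed
  have A1: "A 1 \<noteq> 0" and En: "E n \<noteq> 0" using assms unfolding A_def E_def by simp_all
  have AA: "A (Suc n) * (\<Prod>i<Suc n. A i) = A 0 * A 1 * (\<Prod>i<n. A (Suc (Suc i)))"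
  proof -
    have "A (Suc n) * (\<Prod>i<Suc n. A i) = (\<Prod>i<Suc (Suc n). A i)" by (simp add: mult_ac)
    also have "\<dots> = A 0 * A 1 * (\<Prod>i<n. A (Suc (Suc i)))" by (simp only: prod.lessThan_Suc_shift One_nat_def mult.assoc)
    finally show ?thesis .
  qed
  have PP: "(\<Prod>i<Suc n. P i) = P 0 * (\<Prod>i<n. P (Suc i))" by (simp only: prod.lessThan_Suc_shift)
  have EE: "(\<Prod>i<Suc n. E i) = (\<Prod>i<n. E i) * E n" by simp
  have EN: "(\<Prod>i<Suc n. E (n + i)) = E n * (\<Prod>i<n. E (n + Suc i))" by (simp only: prod.lessThan_Suc_shift add_0_right)
  have A0: "A 0 = F 1" and P0: "P 0 = W c z' * W d z'" unfolding A_def P_def W_def by (simp_all add: algebra_simps)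
  have "R (Suc n) g (- z') z' c d = B * F 1 / A 1 * (A (Suc n) * (\<Prod>i<Suc n. A i)) * (\<Prod>i<Suc n. P i) * ((\<Prod>i<Suc n. E i) / (\<Prod>i<Suc n. E (n + i)))"
    unfolding R1 by (simp add: mult_ac)
  also have "\<dots> = B * F 1 * F 1 * (\<Prod>i<n. A (Suc (Suc i))) * (W c z' * W d z') * (\<Prod>i<n. P (Suc i)) * ((\<Prod>i<n. E i) / (\<Prod>i<n. E (n + Suc i)))"
    unfolding AA PP EE EN A0 P0 using A1 En by simp
  also have "\<dots> = F 1 ^ 2 * W c z' * W d z' * R n g (g + z') (g - z') c d"
    unfolding R2 power2_eq_square by (simp add: mult_ac)
  finally show ?thesis .
qed

section \<open>The quotient of sum and product for parameters of large real part\<close>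

definition big :: "nat \<Rightarrow> complex \<Rightarrow> real" where
  "big n g = 4 * real (n + 1) * (1 + norm g)"

lemma big_pos: "big n g > 0" and big_ge: "big n g \<ge> 4 * real n + 4" and big_ge_g: "real (n + 1) * norm g \<le> big n g / 4"
proof -
  define x where "x = real (n + 1) * norm g"
  have e: "big n g = 4 * real n + 4 + 4 * x" unfolding big_def x_def by (simp add: algebra_simps)
  have x: "x \<ge> 0" unfolding x_def by simp
  show "big n g > 0" using e x by linarith
  show "big n g \<ge> 4 * real n + 4" using e x by linarith
  show "real (n + 1) * norm g \<le> big n g / 4" using e x unfolding x_def[symmetric] by linarith
qed

lemma decay_big:
  assumes "Re G \<ge> big n g"
  shows "decay n g G > 2 * real n + 1"
proof -
  have "max 0 (- Re g) \<le> norm g" using abs_Re_le_cmod[of g] by (auto simp: max_def)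
  then have "real (n - 1) * neg g \<le> real n * (2 * norm g)" unfolding neg_def by (intro mult_mono) auto
  moreover have "big n g = 4 * real n + 4 + 2 * (real n * (2 * norm g)) + 4 * norm g"
    unfolding big_def by (simp add: algebra_simps)
  moreover have "real n * (2 * norm g) \<ge> 0" by simp
  moreover have "p \<le> u \<Longrightarrow> B = 4 * N + 4 + 2 * u + 4 * x \<Longrightarrow> 0 \<le> u \<Longrightarrow> 0 \<le> N \<Longrightarrow> 0 \<le> x \<Longrightarrow> B \<le> H \<Longrightarrow> 2 * N + 1 < 1 + H - p"
    for p u B N x H :: real by linarith
  ultimately show ?thesis using assms unfolding decay_def by (metis norm_ge_zero of_nat_0_le_iff)
qed

lemma Re_add_nat_mult: assumes "i \<le> n" shows "\<bar>Re (of_nat i * g)\<bar> \<le> big n g / 4"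
proof -
  have "\<bar>Re (of_nat i * g)\<bar> \<le> real i * norm g" using abs_Re_le_cmod[of "of_nat i * g"] by (simp add: norm_mult)
  also have "\<dots> \<le> real (n + 1) * norm g" using assms by (intro mult_right_mono) auto
  also have "\<dots> \<le> big n g / 4" by (rule big_ge_g)
  finally show ?thesis .
qed

lemma R_denominator_nonzero:
  assumes "decay n g (a + b + c + d) > 0" "i < n"
  shows "F (1 + (of_nat n - 1 + of_nat i) * g + a + b + c + d) \<noteq> 0"
  using Re_denominator_pos[OF assms] by (intro F_nonzero) (simp add: add_ac)

lemma R_nonzero:
  assumes gen: "\<And>m. m \<in> {1..n} \<Longrightarrow> F (1 + of_nat m * g) \<noteq> 0"
    and dec: "decay n g (a + b + c + d) > 0"
    and "\<And>i. i < n \<Longrightarrow> F (1 + of_nat i * g + a + b) \<noteq> 0"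
    and "\<And>i. i < n \<Longrightarrow> F (1 + of_nat i * g + a + c) \<noteq> 0"
    and "\<And>i. i < n \<Longrightarrow> F (1 + of_nat i * g + a + d) \<noteq> 0"
    and "\<And>i. i < n \<Longrightarrow> F (1 + of_nat i * g + b + c) \<noteq> 0"
    and "\<And>i. i < n \<Longrightarrow> F (1 + of_nat i * g + b + d) \<noteq> 0"
    and "\<And>i. i < n \<Longrightarrow> F (1 + of_nat i * g + c + d) \<noteq> 0"
  shows "R n g a b c d \<noteq> 0"
proof -
  have "F 1 \<noteq> 0" by (rule F_nonzero) simp
  moreover have "F (1 + g) \<noteq> 0" if "i < n" for i using gen[of 1] that by simp
  moreover have "F (1 + of_nat (Suc i) * g) \<noteq> 0" if "i < n" for i using gen[of "Suc i"] that by simp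
  ultimately show ?thesis
    unfolding R_def using assms(3-8) R_denominator_nonzero[OF dec] by (simp del: of_nat_Suc)
qed

text \<open>The bound \<open>big n g\<close> exceeds four times the real part of every multiple i g
  with i at most n. So, for generic g, \<open>R\<close> is finite and nonzero here, and
  \<open>decay\<close> exceeds 2n + 1, which leaves room for lowering a parameter in the
  recurrence.\<close>

definition region :: "nat \<Rightarrow> complex \<Rightarrow> complex \<Rightarrow> complex \<Rightarrow> complex \<Rightarrow> complex \<Rightarrow> bool" where
  "region n g a b c d \<longleftrightarrow> Re a \<ge> big n g \<and> Re b \<ge> big n g \<and> Re c \<ge> big n g \<and> Re d \<ge> big n g"

lemma decay_region: "region n g a b c d \<Longrightarrow> decay n g (a + b + c + d) > 2 * real n + 1"
  using big_pos[of n g] unfolding region_def by (intro decay_big) simp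

lemma F_region_nonzero:
  assumes "Re a \<ge> big n g" "Re b \<ge> big n g" "i < n"
  shows "F (1 + of_nat i * g + a + b) \<noteq> 0"
  using assms Re_add_nat_mult[of i n g] big_pos[of n g] by (intro F_nonzero) simp

lemma R_region_nonzero:
  assumes "generic n g z" "region n g a b c d"
  shows "R n g a b c d \<noteq> 0"
  using assms decay_region[OF assms(2)] unfolding region_def generic_def
  by (intro R_nonzero F_region_nonzero) auto

definition psi :: "nat \<Rightarrow> complex \<Rightarrow> (nat \<Rightarrow> complex) \<Rightarrow> complex \<Rightarrow> complex \<Rightarrow> complex \<Rightarrow> complex \<Rightarrow> complex" where
  "psi n g z a b c d = S n g a b c d z / R n g a b c d"

lemma psi_sym: "psi n g z a b c d = psi n g z b a c d" "psi n g z a b c d = psi n g z a c b d" "psi n g z a b c d = psi n g z a b d c"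
  unfolding psi_def using R_sym[of n g a b c d] S_sym[of n g a b c d z] by simp_all

lemma psi_shift:
  assumes adm: "admissible n z" and gen: "generic n g z" and reg: "region n g a b c d"
  shows "psi n g z (a + 1) b c d = psi n g z a b c d"
proof -
  have reg': "region n g (a + 1) b c d" using reg unfolding region_def by simp
  have "S n g (a + 1 - 1) b c d z * R n g (a + 1) b c d = S n g (a + 1) b c d z * R n g (a + 1 - 1) b c d"
    by (rule S_R_shift[OF adm gen decay_region[OF reg']])
  then show ?thesis unfolding psi_def using R_region_nonzero[OF gen reg] R_region_nonzero[OF gen reg']
    by (simp add: field_simps)
qed

lemma psi_shift_nat:
  assumes adm: "admissible n z" and gen: "generic n g z" and reg: "region n g a b c d"
  shows "psi n g z (a + of_nat k) b c d = psi n g z a b c d"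
proof (induction k)
  case (Suc k)
  have "region n g (a + of_nat k) b c d" using reg unfolding region_def by simp
  from psi_shift[OF adm gen this] Suc show ?case by (simp add: add_ac)
qed simp

lemma R_holomorphic:
  assumes hol: "gf holomorphic_on U" "af holomorphic_on U" "bf holomorphic_on U" "cf holomorphic_on U" "df holomorphic_on U"
    and "\<And>t. t \<in> U \<Longrightarrow> decay n (gf t) (af t + bf t + cf t + df t) > 0" "\<And>t. t \<in> U \<Longrightarrow> F (1 + gf t) \<noteq> 0"
  shows "(\<lambda>t. R n (gf t) (af t) (bf t) (cf t) (df t)) holomorphic_on U"
  unfolding R_def using R_denominator_nonzero assms(6,7) by (intro holomorphic_intros hol) auto

lemma psi_shift_all:
  assumes adm: "admissible n z" and gen: "generic n g z" and reg: "region n g a b c d"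
  shows "psi n g z (a + of_nat k) (b + of_nat k) (c + of_nat k) (d + of_nat k) = psi n g z a b c d"
proof -
  let ?k = "of_nat k :: complex"
  have "psi n g z (a + ?k) (b + ?k) (c + ?k) (d + ?k) = psi n g z a (b + ?k) (c + ?k) (d + ?k)"
    using reg by (intro psi_shift_nat[OF adm gen]) (simp add: region_def)
  also have "\<dots> = psi n g z (b + ?k) a (c + ?k) (d + ?k)" by (rule psi_sym(1))
  also have "\<dots> = psi n g z b a (c + ?k) (d + ?k)"
    using reg by (intro psi_shift_nat[OF adm gen]) (simp add: region_def)
  also have "\<dots> = psi n g z b (c + ?k) a (d + ?k)" by (rule psi_sym(2))
  also have "\<dots> = psi n g z (c + ?k) b a (d + ?k)" by (rule psi_sym(1))
  also have "\<dots> = psi n g z c b a (d + ?k)"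
    using reg by (intro psi_shift_nat[OF adm gen]) (simp add: region_def)
  also have "\<dots> = psi n g z c b (d + ?k) a" by (rule psi_sym(3))
  also have "\<dots> = psi n g z c (d + ?k) b a" by (rule psi_sym(2))
  also have "\<dots> = psi n g z (d + ?k) c b a" by (rule psi_sym(1))
  also have "\<dots> = psi n g z d c b a"
    using reg by (intro psi_shift_nat[OF adm gen]) (simp add: region_def)
  also have "\<dots> = psi n g z c d b a" by (rule psi_sym(1))
  also have "\<dots> = psi n g z c b d a" by (rule psi_sym(2))
  also have "\<dots> = psi n g z b c d a" by (rule psi_sym(1))
  also have "\<dots> = psi n g z b c a d" by (rule psi_sym(3))
  also have "\<dots> = psi n g z b a c d" by (rule psi_sym(2))
  also have "\<dots> = psi n g z a b c d" by (rule psi_sym(1))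
  finally show ?thesis .
qed

end

text \<open>Polynomial growth in vertical strips, which makes the \<open>1\<close>-periodic function \<open>psi\<close> constant.\<close>

locale gamma_like_growth = gamma_like +
  assumes growth: "admissible n z \<Longrightarrow> generic n g z \<Longrightarrow> n \<ge> 1 \<Longrightarrow>
    region n g (a - 2) (b - 2) c d \<Longrightarrow> \<exists>C m y0. \<forall>s. \<bar>Re s\<bar> \<le> 1 \<longrightarrow> \<bar>Im s\<bar> \<ge> y0 \<longrightarrow>
      norm (S n g (a + s) (b - s) c d z) \<le> C * (1 + \<bar>Im s\<bar>) ^ m * norm (R n g (a + s) (b - s) c d)"
begin

text \<open>Raising a and lowering b by 1 shows that the function of s has period 1;
  \<open>growth\<close> bounds it polynomially, so \<open>strip_constant\<close> applies. The margin
  2 in the region makes room for the strip.\<close>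

lemma psi_strip:
  assumes adm: "admissible n z" and gen: "generic n g z" and n: "n \<ge> 1"
    and reg: "region n g (a - 2) (b - 2) c d" and s: "\<bar>Re s\<bar> \<le> 1/2"
  shows "psi n g z (a + s) (b - s) c d = psi n g z a b c d"
proof -
  define f where "f s = psi n g z (a + s) (b - s) c d" for s
  have regs: "region n g (a + s) (b - s) c d" if "\<bar>Re s\<bar> < 2" for s
    using reg that unfolding region_def by auto
  obtain C m y0 where gr: "\<And>s. \<bar>Re s\<bar> \<le> 1 \<Longrightarrow> \<bar>Im s\<bar> \<ge> y0 \<Longrightarrow>
      norm (S n g (a + s) (b - s) c d z) \<le> C * (1 + \<bar>Im s\<bar>) ^ m * norm (R n g (a + s) (b - s) c d)"
    using growth[OF adm gen n reg] by blast
  have "f s = f 0"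
  proof (rule strip_constant[OF _ _ _ s])
    have "open {s. \<bar>Re s\<bar> < 2}" by (intro open_Collect_less continuous_intros)
    moreover have "decay n g ((a + s) + (b - s) + c + d) > 0" if "\<bar>Re s\<bar> < 2" for s
      using decay_region[OF regs[OF that]] by simp
    moreover have "F (1 + g) \<noteq> 0" using gen n unfolding generic_def by force
    ultimately show "f holomorphic_on {s. \<bar>Re s\<bar> < 2}"
      unfolding f_def psi_def using R_region_nonzero[OF gen regs]
      by (intro holomorphic_on_divide S_holomorphic[OF adm] R_holomorphic holomorphic_intros) auto
    show "f (s + 1) = f s" if "\<bar>Re s\<bar> < 2" "\<bar>Re s + 1\<bar> < 2" for s
    proof -
      have r: "region n g (b - s - 1) (a + s) c d" "region n g (a + s) (b - s - 1) c d"
        using regs[of "s + 1"] regs[of s] that unfolding region_def by auto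
      have "f (s + 1) = psi n g z (a + s + 1) (b - s - 1) c d" unfolding f_def by (simp add: algebra_simps)
      also have "\<dots> = psi n g z (b - s - 1) (a + s) c d" using psi_shift[OF adm gen r(2)] psi_sym(1) by metis
      also have "\<dots> = psi n g z (b - s) (a + s) c d" using psi_shift[OF adm gen r(1)] by simp
      finally show ?thesis unfolding f_def using psi_sym(1) by metis
    qed
    show "norm (f s) \<le> C * (1 + \<bar>Im s\<bar>) ^ m" if "\<bar>Re s\<bar> \<le> 1" "\<bar>Im s\<bar> \<ge> y0" for s
      using gr[OF that] R_region_nonzero[OF gen regs, of s] that(1) unfolding f_def psi_def
      by (simp add: norm_divide field_simps)
  qed
  then show ?thesis unfolding f_def by simp
qed

text \<open>A long displacement is cut into N equal ones whose real part is at most 1/2.\<close>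

lemma psi_move:
  assumes adm: "admissible n z" and gen: "generic n g z" and n: "n \<ge> 1"
    and reg: "region n g (a - 2) (b - 2) c d" and reg': "region n g (a + s - 2) (b - s - 2) c d"
  shows "psi n g z (a + s) (b - s) c d = psi n g z a b c d"
proof -
  obtain N :: nat where N: "real N \<ge> 2 * \<bar>Re s\<bar> + 1" using real_arch_simple by blast
  have N0: "real N > 0" using N by linarith
  define h where "h = s / of_nat N"
  have h: "\<bar>Re h\<bar> \<le> 1/2" unfolding h_def using N N0 by (simp add: Re_divide_of_nat field_simps)
  have Ns: "of_nat N * h = s" unfolding h_def using N0 by simp
  have "psi n g z (a + of_nat k * h) (b - of_nat k * h) c d = psi n g z a b c d" if "k \<le> N" for k
    using that
  proof (induction k)
    case (Suc k)
    define r where "r = real k / real N"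
    have r: "0 \<le> r" "r \<le> 1" unfolding r_def using Suc.prems N0 by simp_all
    have kh: "Re (of_nat k * h) = r * Re s" unfolding h_def r_def by (simp add: Re_divide_of_nat)
    \<comment> \<open>Convexity: both ends of the segment satisfy the lower bound on the real part,
      hence so does every point between them.\<close>
    have cv: "m \<le> X + r * e" if "m \<le> X" "m \<le> X + e" for m X e :: real
    proof -
      have "(1 - r) * m + r * m \<le> (1 - r) * X + r * (X + e)"
        using that r by (intro add_mono mult_left_mono) auto
      then show ?thesis by (simp add: algebra_simps)
    qed
    have "Re a + r * Re s \<ge> big n g + 2" "Re b + r * (- Re s) \<ge> big n g + 2"
      using reg reg' unfolding region_def by (intro cv; simp)+
    then have "region n g (a + of_nat k * h - 2) (b - of_nat k * h - 2) c d"
      using reg kh unfolding region_def by simp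
    from psi_strip[OF adm gen n this h] Suc show ?case by (simp add: algebra_simps)
  qed simp
  from this[of N] show ?thesis unfolding Ns by simp
qed

end

section \<open>Induction on the number of variables\<close>

context gamma_like_growth
begin

lemma psi_perm: "psi n g z a b c d = psi n g z c d a b" "psi n g z a b c d = psi n g z c b a d"
proof -
  have "psi n g z a b c d = psi n g z a c b d" by (rule psi_sym(2))
  also have "\<dots> = psi n g z c a b d" by (rule psi_sym(1))
  finally have 1: "psi n g z a b c d = psi n g z c a b d" .
  also have "\<dots> = psi n g z c a d b" by (rule psi_sym(3))
  also have "\<dots> = psi n g z c d a b" by (rule psi_sym(2))
  finally show "psi n g z a b c d = psi n g z c d a b" .
  show "psi n g z a b c d = psi n g z c b a d" using 1 psi_sym(2)[of n g z c a b d] by simp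
qed

text \<open>Carries the identity upwards from parameters that may lie outside \<open>region\<close>:
  only their sum has to be large. Nonvanishing of \<open>R\<close> propagates by its own
  recurrence.\<close>

lemma S_eq_R_shift:
  assumes adm: "admissible n z" and gen: "generic n g z" and G: "Re (a + b + c + d) \<ge> big n g"
    and eq: "S n g a b c d z = R n g a b c d" "R n g a b c d \<noteq> 0"
  shows "S n g (a + of_nat k) b c d z = R n g (a + of_nat k) b c d \<and> R n g (a + of_nat k) b c d \<noteq> 0"
proof (induction k)
  case (Suc k)
  define e where "e = a + of_nat k"
  have dec: "decay n g (e + 1 + b + c + d) > 2 * real n + 1"
    using G unfolding e_def by (intro decay_big) simp
  have "S n g (e + 1 - 1) b c d z * R n g (e + 1) b c d = S n g (e + 1) b c d z * R n g (e + 1 - 1) b c d"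
    by (rule S_R_shift[OF adm gen dec])
  moreover have "R n g (e + 1) b c d \<noteq> 0"
  proof
    assume "R n g (e + 1) b c d = 0"
    then have "R n g (e + 1 - 1) b c d * (\<Prod>m<n. br (e + 1 + b + c + d + (of_nat n - 1 + of_nat m) * g)) = 0"
      using R_recurrence[of n g "e + 1" b c d] dec by simp
    moreover have "(\<Prod>m<n. br (e + 1 + b + c + d + (of_nat n - 1 + of_nat m) * g)) \<noteq> 0"
      using dec by (intro recurrence_factor_nonzero) simp
    ultimately show False using Suc unfolding e_def by simp
  qed
  moreover have "a + of_nat (Suc k) = e + 1" unfolding e_def by (simp add: add_ac)
  ultimately show ?case using Suc unfolding e_def by (simp add: add_ac)
qed (use eq in simp)

text \<open>Let x be the last component of z. Raising all parameters by N and displacing within two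
  pairs, \<open>psi\<close> at (a, b, c, d) equals \<open>psi\<close> at (M - x, M + x, t3, t4).
  That point is reached by M integer steps in each of the first two parameters from (-x, x, t3, t4),
  where the sum collapses to n variables and the induction hypothesis applies.\<close>

lemma psi_eq_1:
  assumes IH: "\<And>a b c d. decay n g (a + b + c + d) > 0 \<Longrightarrow> S n g a b c d z = R n g a b c d"
    and adm: "admissible (Suc n) z" and gen: "generic (Suc n) g z" and reg: "region (Suc n) g a b c d"
  shows "psi (Suc n) g z a b c d = 1"
proof -
  define K where "K = big (Suc n) g"
  define x where "x = z (Suc n)"
  \<comment> \<open>M brings M - x and M + x deep into the region; N is then large enough for the
    partners \<open>t3\<close> and \<open>t4\<close> to stay there.\<close>
  obtain M :: nat where M: "real M \<ge> K + 2 + norm x" using real_arch_simple by blast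
  obtain N :: nat where N: "real N \<ge> real M + 2 + 2 * norm x" using real_arch_simple by blast
  have K0: "K > 0" unfolding K_def by (rule big_pos)
  have Rx: "Re x \<le> norm x" "- Re x \<le> norm x" using abs_Re_le_cmod[of x] by linarith+
  have nx: "norm x \<ge> 0" by simp
  have rg: "Re a \<ge> K" "Re b \<ge> K" "Re c \<ge> K" "Re d \<ge> K" using reg unfolding region_def K_def by auto
  \<comment> \<open>Displacement preserves the sum of the two parameters involved, which forces t3 =
    (a + N) + (c + N) - (M - x), and similarly \<open>t4\<close>.\<close>
  define t3 where "t3 = a + c + 2 * of_nat N - of_nat M + x"
  define t4 where "t4 = b + d + 2 * of_nat N - of_nat M - x"
  have t3: "Re t3 \<ge> K + 2 + norm x" and t4: "Re t4 \<ge> K + 2 + norm x"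
    using rg N K0 Rx nx M unfolding t3_def t4_def by simp_all
  have t3': "Re t3 \<ge> K + 2" and t4': "Re t4 \<ge> K + 2" and M': "real M - Re x \<ge> K + 2" "real M + Re x \<ge> K + 2"
    and N': "real N \<ge> 2" "real N \<ge> 0"
    using t3 t4 M N Rx nx by linarith+
  have "psi (Suc n) g z a b c d = psi (Suc n) g z (a + of_nat N) (b + of_nat N) (c + of_nat N) (d + of_nat N)"
    using psi_shift_all[OF adm gen reg] by simp
  also have "\<dots> = psi (Suc n) g z (a + of_nat N) (c + of_nat N) (b + of_nat N) (d + of_nat N)" by (rule psi_sym(2))
  also have "\<dots> = psi (Suc n) g z (of_nat M - x) t3 (b + of_nat N) (d + of_nat N)"
  proof -
    define s where "s = of_nat M - x - (a + of_nat N)"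
    have s: "a + of_nat N + s = of_nat M - x" "c + of_nat N - s = t3" unfolding s_def t3_def by (simp_all add: algebra_simps)
    have "psi (Suc n) g z (a + of_nat N + s) (c + of_nat N - s) (b + of_nat N) (d + of_nat N)
        = psi (Suc n) g z (a + of_nat N) (c + of_nat N) (b + of_nat N) (d + of_nat N)"
    proof (rule psi_move[OF adm gen])
      show "region (Suc n) g (a + of_nat N - 2) (c + of_nat N - 2) (b + of_nat N) (d + of_nat N)"
        using rg N' unfolding region_def K_def[symmetric] by simp
      show "region (Suc n) g (a + of_nat N + s - 2) (c + of_nat N - s - 2) (b + of_nat N) (d + of_nat N)"
        unfolding s using rg N' M' t3' unfolding region_def K_def[symmetric] by simp
    qed simp
    then show ?thesis unfolding s by simp
  qed
  also have "\<dots> = psi (Suc n) g z (b + of_nat N) (d + of_nat N) (of_nat M - x) t3" by (rule psi_perm(1))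
  also have "\<dots> = psi (Suc n) g z (of_nat M + x) t4 (of_nat M - x) t3"
  proof -
    define s where "s = of_nat M + x - (b + of_nat N)"
    have s: "b + of_nat N + s = of_nat M + x" "d + of_nat N - s = t4" unfolding s_def t4_def by (simp_all add: algebra_simps)
    have "psi (Suc n) g z (b + of_nat N + s) (d + of_nat N - s) (of_nat M - x) t3
        = psi (Suc n) g z (b + of_nat N) (d + of_nat N) (of_nat M - x) t3"
    proof (rule psi_move[OF adm gen])
      show "region (Suc n) g (b + of_nat N - 2) (d + of_nat N - 2) (of_nat M - x) t3"
        using rg N' M' t3' unfolding region_def K_def[symmetric] by simp
      show "region (Suc n) g (b + of_nat N + s - 2) (d + of_nat N - s - 2) (of_nat M - x) t3"
        unfolding s using rg N' M' t3' t4' unfolding region_def K_def[symmetric] by simp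
    qed simp
    then show ?thesis unfolding s by simp
  qed
  also have "\<dots> = psi (Suc n) g z (of_nat M - x) (of_nat M + x) t3 t4"
    using psi_perm(1)[of "Suc n" g z "of_nat M + x" t4 "of_nat M - x" t3] psi_sym(2)[of "Suc n" g z "of_nat M - x" t3 "of_nat M + x" t4]
    by simp
  also have "\<dots> = 1"
  proof -
    have Fg: "F (1 + of_nat m * g) \<noteq> 0" if "m \<le> Suc n" for m
    proof (cases "m = 0")
      case True
      then show ?thesis using F_nonzero[of 1] by simp
    next
      case False
      then have "m \<in> {1..Suc n}" using that by auto
      then show ?thesis using gen unfolding generic_def by blast
    qed
    have Re_i: "\<bar>Re (of_nat i * g)\<bar> \<le> K / 4" if "i \<le> Suc n" for i using Re_add_nat_mult[OF that] unfolding K_def .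
    have pos: "F (1 + of_nat i * g + u) \<noteq> 0" if "i \<le> Suc n" "Re u \<ge> K" for i u
      using Re_i[OF that(1)] that(2) K0 by (intro F_nonzero) simp
    have pos3: "F (1 + of_nat i * g + - x + t3) \<noteq> 0" "F (1 + of_nat i * g + - x + t4) \<noteq> 0"
        "F (1 + of_nat i * g + x + t3) \<noteq> 0" "F (1 + of_nat i * g + x + t4) \<noteq> 0" "F (1 + of_nat i * g + t3 + t4) \<noteq> 0"
      if "i \<le> Suc n" for i
      unfolding add.assoc[of "1 + of_nat i * g"] using t3 t4 Rx nx K0 by (intro pos that; simp)+
    have G: "Re (- x + x + t3 + t4) \<ge> big (Suc n) g" using t3' t4' K0 unfolding K_def[symmetric] by simp
    have decS: "decay (Suc n) g (- x + x + t3 + t4) > 2 * real (Suc n) + 1" by (rule decay_big[OF G])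
    \<comment> \<open>The reduced parameters are g + x, g - x, t3, t4. Their sum contains 2g, and
      the surplus of \<open>big (Suc n) g\<close> over \<open>big n g\<close> compensates a negative
      Re g.\<close>
    have base: "S (Suc n) g (- x) x t3 t4 z = R (Suc n) g (- x) x t3 t4"
    proof -
      have "big (Suc n) g = big n g + 4 * (1 + norm g)" unfolding big_def by (simp add: algebra_simps)
      moreover have "Re g \<ge> - norm g" using abs_Re_le_cmod[of g] by linarith
      ultimately have "2 * Re g + Re t3 + Re t4 \<ge> big n g"
        using t3' t4' K0 norm_ge_zero[of g] unfolding K_def distrib_left by linarith
      then have "Re ((g + x) + (g - x) + t3 + t4) \<ge> big n g" by simp
      from decay_big[OF this] have "decay n g ((g + x) + (g - x) + t3 + t4) > 0" by simp
      then have "S n g (g + x) (g - x) t3 t4 z = R n g (g + x) (g - x) t3 t4" by (rule IH)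
      moreover have "F (1 + g) \<noteq> 0" using Fg[of 1] by simp
      ultimately show ?thesis
        using S_reduction[OF adm, of x g t3 t4] R_reduction[of g n t3 t4 x] pos3(5)[of n] unfolding x_def by simp
    qed
    have "R (Suc n) g (- x) x t3 t4 \<noteq> 0"
      using Fg pos3 decS by (intro R_nonzero) (auto simp del: of_nat_Suc)
    then have e1: "S (Suc n) g (- x + of_nat M) x t3 t4 z = R (Suc n) g (- x + of_nat M) x t3 t4" "R (Suc n) g (- x + of_nat M) x t3 t4 \<noteq> 0"
      using S_eq_R_shift[OF adm gen G base, of M] by auto
    have G2: "Re (x + (- x + of_nat M) + t3 + t4) \<ge> big (Suc n) g" using G by simp
    have "S (Suc n) g (x + of_nat M) (- x + of_nat M) t3 t4 z = R (Suc n) g (x + of_nat M) (- x + of_nat M) t3 t4 \<and>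
      R (Suc n) g (x + of_nat M) (- x + of_nat M) t3 t4 \<noteq> 0"
      using e1 S_sym(1)[of "Suc n" g x "- x + of_nat M" t3 t4 z] R_sym(1)[of "Suc n" g x "- x + of_nat M" t3 t4]
      by (intro S_eq_R_shift[OF adm gen G2]) simp_all
    then have "psi (Suc n) g z (x + of_nat M) (- x + of_nat M) t3 t4 = 1" unfolding psi_def by simp
    then show ?thesis using psi_sym(1)[of "Suc n" g z "x + of_nat M" "- x + of_nat M" t3 t4]
      by (simp add: algebra_simps)
  qed
  finally show ?thesis .
qed

lemma admissible_Suc: "admissible (Suc n) z \<Longrightarrow> admissible n z"
  unfolding admissible_def by auto

lemma generic_Suc: "generic (Suc n) g z \<Longrightarrow> generic n g z"
  unfolding generic_def by auto

text \<open>\<open>psi_eq_1\<close> settles parameters of large real part. Both sides are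
  holomorphic in a common shift t of all four parameters on the half-plane where
  \<open>decay\<close> stays positive, and they agree for large Re t.\<close>

theorem S_eq_R:
  assumes "admissible n z" "generic n g z" "decay n g (a + b + c + d) > 0"
  shows "S n g a b c d z = R n g a b c d"
  using assms
proof (induction n arbitrary: a b c d)
  case 0
  then show ?case unfolding S_def R_def Phi_def int_vectors_def by simp
next
  case (Suc n)
  note adm = Suc.prems(1) and gen = Suc.prems(2)
  have psi1: "psi (Suc n) g z a b c d = 1" if "region (Suc n) g a b c d" for a b c d
    using Suc.IH[OF admissible_Suc[OF adm] generic_Suc[OF gen]] adm gen that by (intro psi_eq_1)
  define G where "G = a + b + c + d"
  \<comment> \<open>All four parameters move by t, so \<open>decay\<close> changes by 4 Re
    t.\<close>
  define \<delta> where "\<delta> = decay (Suc n) g G / 4"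
  define U where "U = {t. Re t > - \<delta>}"
  define K where "K = big (Suc n) g + norm a + norm b + norm c + norm d"
  define V where "V = {t. Re t > max K (- \<delta>)}"
  have \<delta>: "\<delta> > 0" unfolding \<delta>_def G_def using Suc.prems(3) by simp
  have dec: "decay (Suc n) g ((a + t) + (b + t) + (c + t) + (d + t)) > 0" if "t \<in> U" for t
    using that unfolding U_def \<delta>_def G_def decay_def by (simp add: field_simps)
  have Fg: "F (1 + g) \<noteq> 0" using gen unfolding generic_def by force
  have "S (Suc n) g (a + 0) (b + 0) (c + 0) (d + 0) z = R (Suc n) g (a + 0) (b + 0) (c + 0) (d + 0)"
  proof (rule analytic_continuation_open[where s = V and s' = U and z = 0
        and f = "\<lambda>t. S (Suc n) g (a + t) (b + t) (c + t) (d + t) z" and g = "\<lambda>t. R (Suc n) g (a + t) (b + t) (c + t) (d + t)"])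
    show "open V" unfolding V_def by (rule open_halfspace_Re_gt)
    show "open U" unfolding U_def by (rule open_halfspace_Re_gt)
    show "V \<noteq> {}" unfolding V_def by (metis (mono_tags) Re_complex_of_real gt_ex mem_Collect_eq empty_iff)
    show "connected U" unfolding U_def by (intro convex_connected convex_halfspace_Re_gt)
    show "V \<subseteq> U" unfolding U_def V_def by auto
    show "(\<lambda>t. S (Suc n) g (a + t) (b + t) (c + t) (d + t) z) holomorphic_on U"
      using dec \<open>open U\<close> by (intro S_holomorphic[OF adm] holomorphic_intros)
    show "(\<lambda>t. R (Suc n) g (a + t) (b + t) (c + t) (d + t)) holomorphic_on U"
      using dec Fg by (intro R_holomorphic holomorphic_intros)
    show "S (Suc n) g (a + t) (b + t) (c + t) (d + t) z = R (Suc n) g (a + t) (b + t) (c + t) (d + t)" if "t \<in> V" for t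
    proof -
      have "Re u \<ge> - norm u" for u using abs_Re_le_cmod[of u] by linarith
      note R = this[of a] this[of b] this[of c] this[of d]
      note P = norm_ge_zero[of a] norm_ge_zero[of b] norm_ge_zero[of c] norm_ge_zero[of d]
      have "Re t > K" using that unfolding V_def by simp
      then have "region (Suc n) g (a + t) (b + t) (c + t) (d + t)"
        using R P unfolding K_def region_def plus_complex.sel by linarith
      from psi1[OF this] show ?thesis unfolding psi_def by (simp add: divide_eq_1_iff)
    qed
    show "0 \<in> U" unfolding U_def using \<delta> by simp
  qed
  then show ?case by simp
qed

end

section \<open>Generic values of g and evaluation of the dual quotient\<close>

lemma eventually_nonzero_entire:
  fixes h :: "complex \<Rightarrow> complex"
  assumes hol: "h holomorphic_on UNIV" and "h c \<noteq> 0"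
  shows "\<forall>\<^sub>F t in at t0. h t \<noteq> 0"
proof (cases "h t0 = 0")
  case True
  obtain r where r: "0 < r" "ball t0 r \<subseteq> UNIV" "\<And>t. t \<in> ball t0 r - {t0} \<Longrightarrow> h t \<noteq> 0"
    by (rule isolated_zeros[OF hol open_UNIV connected_UNIV UNIV_I True UNIV_I assms(2)]) (rule that)
  have "h t \<noteq> 0" if "t \<noteq> t0" "dist t t0 < r" for t using that r(3)[of t] by (simp add: dist_commute)
  then show ?thesis unfolding eventually_at using r(1) by blast
next
  case False
  have "continuous_on UNIV h" using hol by (rule holomorphic_on_imp_continuous_on)
  then have "isCont h t0" by (simp add: continuous_on_eq_continuous_at)
  then have "(h \<longlongrightarrow> h t0) (at t0)" by (simp add: isCont_def)
  then show ?thesis using False by (rule tendsto_imp_eventually_ne)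
qed

text \<open>The quotient of \<open>Cminus\<close> by \<open>Cplus\<close>, with \<open>F\<close> the
  reciprocal gamma function or the q-Pochhammer symbol. Written in reciprocals, the two cases of q
  take the same form; factors common to both functions are squared in the denominator.\<close>

definition quot :: "(complex \<Rightarrow> complex) \<Rightarrow> nat \<Rightarrow> complex \<Rightarrow> complex \<Rightarrow> complex \<Rightarrow> complex \<Rightarrow> complex \<Rightarrow> (nat \<Rightarrow> complex) \<Rightarrow> complex" where
  "quot F n g h1 h2 h3 h4 x =
    (\<Prod>j\<in>{1..n}. \<Prod>k\<in>{j+1..n}. (F (1 - g + x j + x k) * F (1 - g + x j - x k) * F (1 + g + x j + x k) * F (1 + g + x j - x k)) /
        (F (1 + x j + x k) * F (1 + x j - x k))\<^sup>2) *
    (\<Prod>j\<in>{1..n}. (F (1 - h1 + x j) * F (1 - h2 + x j) * F (1 - h3 + x j) * F (1 - h4 + x j) *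
         F (1 + h1 + x j) * F (1 + h2 + x j) * F (1 + h3 + x j) * F (1 + h4 + x j)) / (F (1 + 2 * x j))\<^sup>2)"

lemma prod_pairs_reverse:
  fixes f :: "nat \<Rightarrow> nat \<Rightarrow> 'a::comm_monoid_mult"
  shows "(\<Prod>j\<in>{1..n}. \<Prod>k\<in>{j+1..n}. f (n - j) (n - k)) = (\<Prod>i<n. \<Prod>m<i. f i m)"
proof (rule prod.reindex_bij_witness[where i = "\<lambda>i. n - i" and j = "\<lambda>j. n - j"])
  fix j assume j: "j \<in> {1..n}"
  show "(\<Prod>m<n - j. f (n - j) m) = (\<Prod>k\<in>{j+1..n}. f (n - j) (n - k))"
    by (rule prod.reindex_bij_witness[where i = "\<lambda>k. n - k" and j = "\<lambda>m. n - m"]) (use j in auto)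
qed auto

text \<open>Each factor is a quotient of consecutive ratios h (i + 1) / h i, so the product
  telescopes.\<close>

lemma prod_second_difference:
  fixes h :: "nat \<Rightarrow> 'a::field"
  assumes "\<And>i. 1 \<le> i \<Longrightarrow> i \<le> n \<Longrightarrow> h i \<noteq> 0" and "n \<ge> 1"
  shows "(\<Prod>i<n. h (i + 2) * h i / (h (i + 1))\<^sup>2) = h (n + 1) * h 0 / (h n * h 1)"
  using assms(2,1)
proof (induction n rule: dec_induct)
  case base
  then show ?case by (simp add: power2_eq_square numeral_2_eq_2)
next
  case (step n)
  have IH: "(\<Prod>i<n. h (i + 2) * h i / (h (i + 1))\<^sup>2) = h (n + 1) * h 0 / (h n * h 1)" using step by simp
  have "h n \<noteq> 0" "h (n + 1) \<noteq> 0" "h 1 \<noteq> 0" using step.prems[of n] step.prems[of "n + 1"] step.prems[of 1] step.hyps by auto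
  then show ?case unfolding prod.lessThan_Suc IH by (simp add: power2_eq_square field_simps)
qed

context gamma_like_growth
begin

lemma theta_nz_iff: "theta u \<noteq> 0 \<longleftrightarrow> nz u"
proof
  assume "theta u \<noteq> 0"
  then have "theta (u + of_int l) \<noteq> 0" for l using norm_theta_int[of u l] by (metis norm_eq_zero)
  then show "nz u" unfolding nz_def using theta_eq_W by auto
qed (rule nz_theta)

text \<open>Every condition is implied by the nonvanishing of an entire function of g that is not
  identically zero. \<open>theta\<close> tests a whole coset of the integers at once, and
  \<open>br\<close> divides \<open>F\<close>.\<close>

lemma eventually_generic:
  assumes adm: "admissible n z"
  shows "\<forall>\<^sub>F g in at g0. generic n g z"
proof -
  have F1: "F 1 \<noteq> 0" "F 2 \<noteq> 0" using F_nonzero[of 1] F_nonzero[of 2] by simp_all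
  have 1: "\<forall>\<^sub>F g in at g0. F (of_nat m * g) \<noteq> 0 \<and> F (1 + of_nat m * g) \<noteq> 0" if m: "m \<in> {1..n}" for m
  proof (intro eventually_conj)
    show "\<forall>\<^sub>F g in at g0. F (of_nat m * g) \<noteq> 0"
      by (rule eventually_nonzero_entire[where c = "1 / of_nat m"]) (use m F1 in \<open>auto intro!: holomorphic_intros\<close>)
    show "\<forall>\<^sub>F g in at g0. F (1 + of_nat m * g) \<noteq> 0"
      by (rule eventually_nonzero_entire[where c = 0]) (use F1 in \<open>auto intro!: holomorphic_intros\<close>)
  qed
  have 2: "\<forall>\<^sub>F g in at g0. theta (g + 2 * z j) \<noteq> 0 \<and> theta (g - 2 * z j) \<noteq> 0" if j: "j \<in> {1..n}" for j
  proof (intro eventually_conj)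
    have nzj: "theta (2 * z j) \<noteq> 0" using adm j nz_theta unfolding admissible_def by blast
    show "\<forall>\<^sub>F g in at g0. theta (g + 2 * z j) \<noteq> 0"
      by (rule eventually_nonzero_entire[where c = 0]) (use nzj in \<open>auto simp: theta_def intro!: holomorphic_intros\<close>)
    show "\<forall>\<^sub>F g in at g0. theta (g - 2 * z j) \<noteq> 0"
      by (rule eventually_nonzero_entire[where c = "4 * z j"]) (use nzj in \<open>auto simp: theta_def intro!: holomorphic_intros\<close>)
  qed
  have "\<forall>\<^sub>F g in at g0. (\<forall>m\<in>{1..n}. F (of_nat m * g) \<noteq> 0 \<and> F (1 + of_nat m * g) \<noteq> 0) \<and>
      (\<forall>j\<in>{1..n}. theta (g + 2 * z j) \<noteq> 0 \<and> theta (g - 2 * z j) \<noteq> 0)"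
    using 1 2 by (intro eventually_conj eventually_ball_finite) blast+
  then show ?thesis
  proof eventually_elim
    case (elim g)
    then have "br (of_nat m * g) \<noteq> 0" if "m \<in> {1..n}" for m using F_rec[of "of_nat m * g"] that by auto
    then show ?case unfolding generic_def using elim theta_nz_iff by blast
  qed
qed

lemma decay_open:
  assumes "decay n g0 G > 0"
  shows "\<exists>r>0. \<forall>g\<in>ball g0 r. decay n g G > 0"
proof -
  have "open {g. decay n g G > 0}" unfolding decay_def neg_def by (intro open_Collect_less continuous_intros)
  moreover have "g0 \<in> {g. decay n g G > 0}" using assms by simp
  ultimately obtain r where "r > 0" "ball g0 r \<subseteq> {g. decay n g G > 0}" unfolding open_contains_ball by blast
  then show ?thesis by blast
qed

lemma S_tendsto:
  assumes adm: "admissible n z" and dec: "decay n g0 (a + b + c + d) > 0"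
  shows "((\<lambda>g. S n g a b c d z) \<longlongrightarrow> S n g0 a b c d z) (at g0)"
proof -
  obtain r where r: "r > 0" "\<And>g. g \<in> ball g0 r \<Longrightarrow> decay n g (a + b + c + d) > 0" using decay_open[OF dec] by blast
  have "(\<lambda>g. S n g a b c d z) holomorphic_on ball g0 r"
    using r by (intro S_holomorphic[OF adm] holomorphic_intros) auto
  then have "continuous_on (ball g0 r) (\<lambda>g. S n g a b c d z)" by (rule holomorphic_on_imp_continuous_on)
  then have "isCont (\<lambda>g. S n g a b c d z) g0" using r(1) by (simp add: continuous_on_eq_continuous_at)
  then show ?thesis by (simp add: isCont_def)
qed

lemma eventually_decay:
  assumes "decay n g0 G > 0"
  shows "\<forall>\<^sub>F g in at g0. decay n g G > 0"
  using decay_open[OF assms] unfolding eventually_at by (auto simp: dist_commute)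

text \<open>With i = n - j the components of \<open>rhohat\<close> are i g + h1. Differences of
  components give the string \<open>A\<close>, sums give \<open>E\<close>, and the dual parameters
  combine to the six sums of two original ones. The pair factors are second differences along both
  strings and telescope in the inner product; the rest is an induction on the number of
  coordinates.\<close>

lemma quot_eq_R:
  assumes gen: "\<And>m. m \<in> {1..n} \<Longrightarrow> F (1 + of_nat m * g) \<noteq> 0" and dec: "decay n g (a + b + c + d) > 0"
    and h: "h1 = (a + b + c + d) / 2" "h2 = (a + b - c - d) / 2" "h3 = (a - b + c - d) / 2" "h4 = (a - b - c + d) / 2"
    and x: "\<And>j. j \<in> {1..n} \<Longrightarrow> x j = of_nat (n - j) * g + h1"
  shows "quot F n g h1 h2 h3 h4 x = R n g a b c d"
proof -
  define A where "A i = F (1 + of_nat i * g)" for i :: nat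
  define E where "E i = F (1 + of_nat i * g + a + b + c + d)" for i :: nat
  define six where "six i = F (1 + of_nat i * g + a + b) * F (1 + of_nat i * g + a + c) * F (1 + of_nat i * g + a + d) *
            F (1 + of_nat i * g + b + c) * F (1 + of_nat i * g + b + d) * F (1 + of_nat i * g + c + d)" for i :: nat
  have A0: "A m \<noteq> 0" if "m \<le> n" for m
    using gen[of m] that F_nonzero[of 1] unfolding A_def by (cases m) (auto simp del: of_nat_Suc)
  \<comment> \<open>The largest index that occurs is 2n - 2, from the doubled first component and
    from the pair of the first two; the decay hypothesis gives these arguments positive real
    part.\<close>
  have E0: "E M \<noteq> 0" if "M + 2 \<le> 2 * n" for M
  proof -
    have "M \<le> 2 * (n - 1)" using that by simp
    then have M: "real M \<le> 2 * real (n - 1)" by (metis of_nat_le_iff of_nat_mult of_nat_numeral)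
    have "real M * Re g \<ge> - (real M * max 0 (- Re g))" using mult_left_mono[of "- max 0 (- Re g)" "Re g" "real M"] by simp
    moreover have "real M * max 0 (- Re g) \<le> 2 * real (n - 1) * max 0 (- Re g)" using M by (intro mult_right_mono) auto
    ultimately show ?thesis using dec unfolding E_def decay_def neg_def by (intro F_nonzero) (simp add: algebra_simps)
  qed
  define f where "f i m = (F (1 - g + (of_nat i * g + h1) + (of_nat m * g + h1)) * F (1 - g + (of_nat i * g + h1) - (of_nat m * g + h1)) *
       F (1 + g + (of_nat i * g + h1) + (of_nat m * g + h1)) * F (1 + g + (of_nat i * g + h1) - (of_nat m * g + h1))) /
       (F (1 + (of_nat i * g + h1) + (of_nat m * g + h1)) * F (1 + (of_nat i * g + h1) - (of_nat m * g + h1)))\<^sup>2" for i m :: nat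
  define u where "u i = A i * E i * six i / (E (2 * i))\<^sup>2" for i
  have q: "quot F n g h1 h2 h3 h4 x = (\<Prod>i<n. \<Prod>m<i. f i m) * (\<Prod>i<n. u i)"
  proof -
    have "(\<Prod>j\<in>{1..n}. \<Prod>k\<in>{j+1..n}. (F (1 - g + x j + x k) * F (1 - g + x j - x k) * F (1 + g + x j + x k) * F (1 + g + x j - x k)) /
        (F (1 + x j + x k) * F (1 + x j - x k))\<^sup>2) = (\<Prod>j\<in>{1..n}. \<Prod>k\<in>{j+1..n}. f (n - j) (n - k))"
      unfolding f_def by (intro prod.cong refl) (simp add: x)
    also have "\<dots> = (\<Prod>i<n. \<Prod>m<i. f i m)" by (rule prod_pairs_reverse)
    finally have 1: "(\<Prod>j\<in>{1..n}. \<Prod>k\<in>{j+1..n}. (F (1 - g + x j + x k) * F (1 - g + x j - x k) * F (1 + g + x j + x k) * F (1 + g + x j - x k)) /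
        (F (1 + x j + x k) * F (1 + x j - x k))\<^sup>2) = (\<Prod>i<n. \<Prod>m<i. f i m)" .
    have "(\<Prod>j\<in>{1..n}. (F (1 - h1 + x j) * F (1 - h2 + x j) * F (1 - h3 + x j) * F (1 - h4 + x j) *
         F (1 + h1 + x j) * F (1 + h2 + x j) * F (1 + h3 + x j) * F (1 + h4 + x j)) / (F (1 + 2 * x j))\<^sup>2) = (\<Prod>j\<in>{1..n}. u (n - j))"
    proof (intro prod.cong refl)
      fix j assume j: "j \<in> {1..n}"
      define i where "i = n - j"
      have e: "1 - h1 + x j = 1 + of_nat i * g" "1 - h2 + x j = 1 + of_nat i * g + c + d" "1 - h3 + x j = 1 + of_nat i * g + b + d"
         "1 - h4 + x j = 1 + of_nat i * g + b + c" "1 + h1 + x j = 1 + of_nat i * g + a + b + c + d" "1 + h2 + x j = 1 + of_nat i * g + a + b"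
         "1 + h3 + x j = 1 + of_nat i * g + a + c" "1 + h4 + x j = 1 + of_nat i * g + a + d"
         "1 + 2 * x j = 1 + of_nat (2 * i) * g + a + b + c + d"
        unfolding x[OF j] h i_def[symmetric] by (simp_all add: field_simps)
      show "(F (1 - h1 + x j) * F (1 - h2 + x j) * F (1 - h3 + x j) * F (1 - h4 + x j) *
         F (1 + h1 + x j) * F (1 + h2 + x j) * F (1 + h3 + x j) * F (1 + h4 + x j)) / (F (1 + 2 * x j))\<^sup>2 = u (n - j)"
        unfolding e u_def A_def E_def six_def i_def[symmetric] by (simp only: mult_ac)
    qed
    also have "\<dots> = (\<Prod>i<n. u i)"
      by (rule prod.reindex_bij_witness[where i = "\<lambda>i. n - i" and j = "\<lambda>j. n - j"]) auto
    finally show ?thesis unfolding quot_def 1 by simp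
  qed
  define T where "T k = (\<Prod>i<k. \<Prod>m<i. f i m) * (\<Prod>i<k. u i)" for k
  define D where "D k = (\<Prod>i<k. E (k - 1 + i))" for k
  define R' where "R' k = (\<Prod>i<k. A 0 * A (Suc i) / A 1) * (\<Prod>i<k. six i) / D k" for k
  have fm: "f i m = (E (i + m - 1) * E (i + m + 1) / (E (i + m))\<^sup>2) * (A (i - m - 1) * A (i - m + 1) / (A (i - m))\<^sup>2)" if "m < i" for i m
  proof -
    have e: "1 - g + (of_nat i * g + h1) + (of_nat m * g + h1) = 1 + of_nat (i + m - 1) * g + a + b + c + d"
      "1 - g + (of_nat i * g + h1) - (of_nat m * g + h1) = 1 + of_nat (i - m - 1) * g"
      "1 + g + (of_nat i * g + h1) + (of_nat m * g + h1) = 1 + of_nat (i + m + 1) * g + a + b + c + d"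
      "1 + g + (of_nat i * g + h1) - (of_nat m * g + h1) = 1 + of_nat (i - m + 1) * g"
      "1 + (of_nat i * g + h1) + (of_nat m * g + h1) = 1 + of_nat (i + m) * g + a + b + c + d"
      "1 + (of_nat i * g + h1) - (of_nat m * g + h1) = 1 + of_nat (i - m) * g"
      unfolding h using that by (simp_all add: field_simps of_nat_diff)
    show ?thesis unfolding f_def e A_def E_def by (simp add: power_mult_distrib mult_ac)
  qed
  \<comment> \<open>The string \<open>E\<close> is read upwards from index k - 1 and the string
    \<open>A\<close> downwards from k, each as a telescoping second difference.\<close>
  have tele: "(\<Prod>m<k. f k m) = (E (2 * k) * E (k - 1) / (E (2 * k - 1) * E k)) * (A (k + 1) * A 0 / (A k * A 1))" if k: "k \<ge> 1" "k < n" for k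
  proof -
    have "(\<Prod>m<k. f k m) = (\<Prod>m<k. E (k + m - 1) * E (k + m + 1) / (E (k + m))\<^sup>2) * (\<Prod>m<k. A (k - m - 1) * A (k - m + 1) / (A (k - m))\<^sup>2)"
      unfolding prod.distrib[symmetric] by (intro prod.cong refl) (simp add: fm)
    also have "(\<Prod>m<k. E (k + m - 1) * E (k + m + 1) / (E (k + m))\<^sup>2) = (\<Prod>m<k. E (k - 1 + (m + 2)) * E (k - 1 + m) / (E (k - 1 + (m + 1)))\<^sup>2)"
      using k by (intro prod.cong refl) (simp add: mult.commute)
    also have "\<dots> = E (k - 1 + (k + 1)) * E (k - 1 + 0) / (E (k - 1 + k) * E (k - 1 + 1))"
      using k by (intro prod_second_difference[where h = "\<lambda>i. E (k - 1 + i)"] E0) auto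
    also have "E (k - 1 + (k + 1)) * E (k - 1 + 0) / (E (k - 1 + k) * E (k - 1 + 1)) = E (2 * k) * E (k - 1) / (E (2 * k - 1) * E k)"
    proof -
      have "k - 1 + (k + 1) = 2 * k" "k - 1 + k = 2 * k - 1" "k - 1 + 1 = k" "k - 1 + 0 = k - 1" using k by auto
      then show ?thesis by (simp only:)
    qed
    also have "(\<Prod>m<k. A (k - m - 1) * A (k - m + 1) / (A (k - m))\<^sup>2) = (\<Prod>i<k. A (i + 2) * A i / (A (i + 1))\<^sup>2)"
      by (rule prod.reindex_bij_witness[where i = "\<lambda>i. k - Suc i" and j = "\<lambda>m. k - Suc m"]) (auto simp: mult.commute Suc_diff_Suc)
    also have "\<dots> = A (k + 1) * A 0 / (A k * A 1)" using k by (intro prod_second_difference A0) auto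
    finally show ?thesis .
  qed
  have Dstep: "D (Suc k) * E (k - 1) = D k * E (2 * k - 1) * E (2 * k)" if "k \<ge> 1" for k
  proof -
    have "D (Suc k) = (\<Prod>i<k. E (k + i)) * E (2 * k)" unfolding D_def by (simp add: mult_2)
    moreover have "E (k - 1) * (\<Prod>i<k. E (k + i)) = D k * E (2 * k - 1)"
    proof -
      have "E (k - 1) * (\<Prod>i<k. E (k + i)) = (\<Prod>i<Suc k. E (k - 1 + i))"
        unfolding prod.lessThan_Suc_shift using that by simp
      also have "\<dots> = D k * E (2 * k - 1)" unfolding D_def using that by (simp add: mult_2)
      finally show ?thesis .
    qed
    ultimately show ?thesis by (simp add: mult_ac)
  qed
  have D0: "D k \<noteq> 0" if "k \<le> n" for k unfolding D_def using that by (auto intro!: E0)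
  have TR: "T k = R' k" if "k \<le> n" for k
    using that
  proof (induction k)
    case 0
    then show ?case unfolding T_def R'_def D_def by simp
  next
    case (Suc k)
    then have IH: "T k = R' k" by simp
    have k: "k < n" using Suc.prems by simp
    have T: "T (Suc k) = T k * ((\<Prod>m<k. f k m) * u k)" unfolding T_def by simp
    show ?case
    proof (cases "k = 0")
      case True
      have "A 1 \<noteq> 0" "E 0 \<noteq> 0" using A0[of 1] E0[of 0] k by auto
      then show ?thesis unfolding True T_def R'_def D_def u_def by (simp add: power2_eq_square)
    next
      case False
      then have k1: "k \<ge> 1" by simp
      have nonz: "A k \<noteq> 0" "A 1 \<noteq> 0" "E k \<noteq> 0" "E (2 * k) \<noteq> 0" "E (2 * k - 1) \<noteq> 0" "E (k - 1) \<noteq> 0"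
        using k k1 by (auto intro!: A0 E0)
      have Dk: "D (Suc k) = D k * E (2 * k - 1) * E (2 * k) / E (k - 1)" using Dstep[OF k1] nonz by (simp add: field_simps)
      have "T (Suc k) = R' k * (A 0 * A (Suc k) / A 1 * six k * (E (k - 1) / (E (2 * k - 1) * E (2 * k))))"
        unfolding T IH tele[OF k1 k] u_def using nonz by (simp add: field_simps power2_eq_square)
      also have "\<dots> = R' (Suc k)"
        unfolding R'_def Dk using nonz D0[of k] D0[of "Suc k"] k by (simp add: field_simps)
      finally show ?thesis .
    qed
  qed
  have "R n g a b c d = R' n"
  proof -
    have "(\<Prod>i<n. F (1 + (of_nat n - 1 + of_nat i) * g + a + b + c + d)) = D n"
      unfolding D_def E_def by (intro prod.cong refl) (simp add: of_nat_diff diff_add_eq)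
    then show ?thesis unfolding R_def R'_def prod_dividef six_def A_def by (simp add: prod_dividef)
  qed
  then show ?thesis using TR[of n] unfolding q T_def by simp
qed

end

section \<open>Estimates for the reciprocal gamma function\<close>

lemma summable_on_int:
  fixes f :: "int \<Rightarrow> real"
  assumes "(\<lambda>n::nat. f (int n)) summable_on UNIV" "(\<lambda>n::nat. f (- int n)) summable_on UNIV"
  shows "f summable_on UNIV"
proof -
  have 1: "f summable_on range int"
    by (subst summable_on_reindex) (use assms(1) in \<open>auto simp: o_def inj_on_def\<close>)
  have 2: "f summable_on range (\<lambda>n. - int n)"
    by (subst summable_on_reindex) (use assms(2) in \<open>auto simp: o_def inj_on_def\<close>)
  have "range int \<union> range (\<lambda>n. - int n) = UNIV"
  proof -
    have "x \<in> range int \<or> x \<in> range (\<lambda>n. - int n)" for x by (cases x rule: int_cases2) auto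
    then show ?thesis by blast
  qed
  then show ?thesis using summable_on_union[OF 1 2] by simp
qed

lemma sum_inverse_square_le: "(\<Sum>k\<le>n. 1 / (real k + 1)\<^sup>2) \<le> 2"
proof -
  have "(\<Sum>k\<le>n. 1 / (real k + 1)\<^sup>2) \<le> 2 - 1 / (real n + 1)"
  proof (induction n)
    case (Suc n)
    have "1 / (real n + 2)\<^sup>2 \<le> 1 / (real n + 1) - 1 / (real n + 2)"
    proof -
      have "1 / (real n + 2)\<^sup>2 \<le> 1 / ((real n + 1) * (real n + 2))"
        unfolding power2_eq_square by (intro divide_left_mono mult_right_mono mult_pos_pos) auto
      also have "\<dots> = 1 / (real n + 1) - 1 / (real n + 2)" by (simp add: field_simps)
      finally show ?thesis .
    qed
    then show ?case using Suc by (simp add: add_ac)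
  qed simp
  also have "\<dots> \<le> 2" by simp
  finally show ?thesis .
qed

text \<open>A discrete form of the boundedness, uniform in y, of the integral of y / (x^2 + y^2).
  Each term is dominated by a telescoping difference.\<close>

lemma sum_imag_le: "(\<Sum>k\<le>n. \<bar>y\<bar> / ((real k + 1)\<^sup>2 + y\<^sup>2)) \<le> 2"
proof (cases "y = 0")
  case False
  define t where "t = \<bar>y\<bar>"
  have t: "t > 0" "y\<^sup>2 = t\<^sup>2" using False unfolding t_def by simp_all
  have step: "t / ((real k + 1)\<^sup>2 + t\<^sup>2) \<le> 2 * t * (1 / (real k + t) - 1 / (real k + 1 + t))" for k
  proof -
    have "2 * t * (1 / (real k + t) - 1 / (real k + 1 + t)) = 2 * t / ((real k + t) * (real k + 1 + t))"
      using t by (simp add: field_simps)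
    moreover have "(real k + t) * (real k + 1 + t) \<le> 2 * ((real k + 1)\<^sup>2 + t\<^sup>2)"
    proof -
      have "(real k + t) * (real k + 1 + t) \<le> (real k + 1 + t) * (real k + 1 + t)" using t by (intro mult_right_mono) auto
      also have "\<dots> \<le> 2 * ((real k + 1)\<^sup>2 + t\<^sup>2)"
        using zero_le_power2[of "real k + 1 - t"] by (simp add: power2_eq_square algebra_simps)
      finally show ?thesis .
    qed
    moreover have "(real k + t) * (real k + 1 + t) > 0" using t by (intro mult_pos_pos) auto
    moreover have "(real k + 1)\<^sup>2 + t\<^sup>2 > 0" by (intro add_pos_nonneg) auto
    ultimately have "2 * t / (2 * ((real k + 1)\<^sup>2 + t\<^sup>2)) \<le> 2 * t * (1 / (real k + t) - 1 / (real k + 1 + t))"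
      using t by (simp only:) (intro divide_left_mono mult_pos_pos; simp)
    moreover have "2 * t / (2 * q) = t / q" for q :: real by simp
    ultimately show ?thesis by (simp only:)
  qed
  have "(\<Sum>k\<le>n. t / ((real k + 1)\<^sup>2 + t\<^sup>2)) \<le> (\<Sum>k\<le>n. 2 * t * (1 / (real k + t) - 1 / (real k + 1 + t)))"
    by (intro sum_mono step)
  also have "\<dots> = 2 * t * (1 / t - 1 / (real n + 1 + t))"
    unfolding sum_distrib_left[symmetric] by (induction n) (simp_all add: field_simps t less_imp_neq)
  also have "\<dots> \<le> 2" using t by (simp add: right_diff_distrib)
  finally show ?thesis unfolding t(2) unfolding t_def .
qed simp

lemma sum_inverse_le_ln:
  assumes "a \<ge> (1::real)"
  shows "(\<Sum>k\<le>n. 1 / (a + real k)) \<le> 1 + (ln (a + real n) - ln a)"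
proof (induction n)
  case 0
  then show ?case using assms by simp
next
  case (Suc n)
  have "ln ((a + real n) / (a + real n + 1)) \<le> (a + real n) / (a + real n + 1) - 1"
    using assms by (intro ln_le_minus_one) simp
  also have "\<dots> = - (1 / (a + real n + 1))" using assms by (simp add: field_simps)
  also have "ln ((a + real n) / (a + real n + 1)) = ln (a + real n) - ln (a + real n + 1)"
    using assms by (simp add: ln_div)
  finally show ?case using Suc by (simp add: add_ac)
qed

lemma sum_inverse_ge_ln:
  assumes "a \<ge> (1::real)"
  shows "ln (a + real n) - ln a \<le> (\<Sum>k\<le>n. 1 / (a + real k))"
proof -
  have "ln (a + real n + 1) - ln a \<le> (\<Sum>k\<le>n. 1 / (a + real k))"
  proof (induction n)
    case 0
    have "ln ((a + 1) / a) \<le> (a + 1) / a - 1" using assms by (intro ln_le_minus_one) simp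
    also have "\<dots> = 1 / a" using assms by (simp add: field_simps)
    finally show ?case using assms by (simp add: ln_div)
  next
    case (Suc n)
    have "ln ((a + real n + 2) / (a + real n + 1)) \<le> (a + real n + 2) / (a + real n + 1) - 1"
      using assms by (intro ln_le_minus_one) simp
    also have "\<dots> = 1 / (a + real n + 1)" using assms by (simp add: field_simps)
    also have "ln ((a + real n + 2) / (a + real n + 1)) = ln (a + real n + 2) - ln (a + real n + 1)"
      using assms by (simp add: ln_div)
    finally show ?case using Suc by (simp add: add_ac)
  qed
  moreover have "ln (a + real n) \<le> ln (a + real n + 1)" using assms by simp
  ultimately show ?thesis by linarith
qed

lemma norm_one_plus_le_exp: "norm (1 + w) \<le> exp (Re w + (norm w)\<^sup>2 / 2)"
proof -
  have "(norm (1 + w))\<^sup>2 = 1 + (2 * Re w + (norm w)\<^sup>2)"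
    unfolding cmod_power2 by (simp add: power2_eq_square algebra_simps)
  also have "\<dots> \<le> exp (2 * Re w + (norm w)\<^sup>2)" by (rule exp_ge_add_one_self)
  also have "\<dots> = (exp (Re w + (norm w)\<^sup>2 / 2))\<^sup>2" by (simp add: power2_eq_square exp_add[symmetric])
  finally show ?thesis by (rule power2_le_imp_le) simp
qed

text \<open>The sum grows like Re h times a logarithm, with an error independent of n. The imaginary
  part of v enters only when Re h is negative, because then a lower bound of Re (1 / (v + k)) is
  needed.\<close>

lemma Re_divide_sum_bound:
  assumes a: "Re v \<ge> 1"
  shows "(\<Sum>k\<le>n. Re (h / (v + of_nat k))) \<le>
    Re h * (ln (Re v + real n) - ln (Re v)) + 3 * norm h + (if Re h < 0 then 2 * norm h * (Im v)\<^sup>2 else 0)"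
proof -
  define a y where "a = Re v" and "y = Im v"
  have a1: "a \<ge> 1" using a unfolding a_def .
  define q where "q k = (a + real k)\<^sup>2 + y\<^sup>2" for k
  have q: "q k \<ge> (real k + 1)\<^sup>2 + y\<^sup>2" "q k > 0" for k
  proof -
    have "(real k + 1)\<^sup>2 \<le> (a + real k)\<^sup>2" using a1 by (intro power_mono) auto
    then show "q k \<ge> (real k + 1)\<^sup>2 + y\<^sup>2" unfolding q_def by simp
    moreover have "(real k + 1)\<^sup>2 + y\<^sup>2 > 0" by (intro add_pos_nonneg) auto
    ultimately show "q k > 0" by linarith
  qed
  have split: "Re (h / (v + of_nat k)) = Re h * ((a + real k) / q k) + Im h * y / q k" for k
    unfolding q_def a_def y_def by (simp add: Re_divide add_divide_distrib distrib_left)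
  have im: "(\<Sum>k\<le>n. Im h * y / q k) \<le> 2 * norm h"
  proof -
    have "Im h * y / q k \<le> norm h * (\<bar>y\<bar> / ((real k + 1)\<^sup>2 + y\<^sup>2))" for k
    proof -
      have "Im h * y \<le> norm h * \<bar>y\<bar>"
      proof -
        have "Im h * y \<le> \<bar>Im h\<bar> * \<bar>y\<bar>" unfolding abs_mult[symmetric] by (rule abs_ge_self)
        also have "\<dots> \<le> norm h * \<bar>y\<bar>" using abs_Im_le_cmod[of h] by (intro mult_right_mono) auto
        finally show ?thesis .
      qed
      then have "Im h * y / q k \<le> norm h * \<bar>y\<bar> / q k" using q by (intro divide_right_mono) (auto simp: less_imp_le)
      also have "\<dots> \<le> norm h * \<bar>y\<bar> / ((real k + 1)\<^sup>2 + y\<^sup>2)"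
        using q[of k] by (intro divide_left_mono mult_nonneg_nonneg mult_pos_pos) (auto intro: add_pos_nonneg)
      finally show ?thesis by simp
    qed
    then have "(\<Sum>k\<le>n. Im h * y / q k) \<le> (\<Sum>k\<le>n. norm h * (\<bar>y\<bar> / ((real k + 1)\<^sup>2 + y\<^sup>2)))" by (intro sum_mono)
    also have "\<dots> \<le> norm h * 2" unfolding sum_distrib_left[symmetric] by (intro mult_left_mono sum_imag_le) simp
    finally show ?thesis by simp
  qed
  have up: "(a + real k) / q k \<le> 1 / (a + real k)" for k
  proof -
    have "(a + real k) * (a + real k) \<le> q k" unfolding q_def power2_eq_square by simp
    then show ?thesis using q(2)[of k] a1 by (simp add: field_simps)
  qed
  have low: "1 / (a + real k) - y\<^sup>2 / (real k + 1)\<^sup>2 \<le> (a + real k) / q k" for k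
  proof -
    have ak: "a + real k \<ge> 1" using a1 by simp
    have "1 / (a + real k) - (a + real k) / q k = y\<^sup>2 / ((a + real k) * q k)"
      using ak q(2)[of k] unfolding q_def by (simp add: field_simps power2_eq_square)
    also have "\<dots> \<le> y\<^sup>2 / (real k + 1)\<^sup>2"
    proof (intro divide_left_mono mult_pos_pos)
      have "(real k + 1)\<^sup>2 \<le> q k" using q(1)[of k] zero_le_power2[of y] by linarith
      also have "\<dots> \<le> (a + real k) * q k" using ak q(2)[of k] mult_right_mono[of 1 "a + real k" "q k"] by simp
      finally show "(real k + 1)\<^sup>2 \<le> (a + real k) * q k" .
    qed (use ak q(2)[of k] in auto)
    finally show ?thesis by linarith
  qed
  have re: "(\<Sum>k\<le>n. Re h * ((a + real k) / q k)) \<le> Re h * (ln (a + real n) - ln a) + norm h +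
     (if Re h < 0 then 2 * norm h * y\<^sup>2 else 0)"
  proof (cases "Re h < 0")
    case False
    have "(\<Sum>k\<le>n. (a + real k) / q k) \<le> (\<Sum>k\<le>n. 1 / (a + real k))" by (intro sum_mono up)
    also have "\<dots> \<le> 1 + (ln (a + real n) - ln a)" by (rule sum_inverse_le_ln[OF a1])
    finally have "Re h * (\<Sum>k\<le>n. (a + real k) / q k) \<le> Re h * (1 + (ln (a + real n) - ln a))"
      using False by (intro mult_left_mono) auto
    then show ?thesis using False complex_Re_le_cmod[of h] unfolding sum_distrib_left[symmetric] by (simp add: distrib_left)
  next
    case True
    have "ln (a + real n) - ln a - 2 * y\<^sup>2 \<le> (\<Sum>k\<le>n. 1 / (a + real k)) - y\<^sup>2 * (\<Sum>k\<le>n. 1 / (real k + 1)\<^sup>2)"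
      using sum_inverse_ge_ln[OF a1, of n] mult_left_mono[OF sum_inverse_square_le[of n] zero_le_power2[of y]] by linarith
    also have "\<dots> = (\<Sum>k\<le>n. 1 / (a + real k) - y\<^sup>2 / (real k + 1)\<^sup>2)"
      by (simp add: sum_subtractf sum_distrib_left)
    also have "\<dots> \<le> (\<Sum>k\<le>n. (a + real k) / q k)" by (intro sum_mono low)
    finally have "Re h * (\<Sum>k\<le>n. (a + real k) / q k) \<le> Re h * (ln (a + real n) - ln a - 2 * y\<^sup>2)"
      using True by (intro mult_left_mono_neg) auto
    also have "\<dots> = Re h * (ln (a + real n) - ln a) + 2 * (- Re h) * y\<^sup>2" by (simp add: algebra_simps)
    also have "2 * (- Re h) * y\<^sup>2 \<le> 2 * norm h * y\<^sup>2"
      using abs_Re_le_cmod[of h] by (intro mult_right_mono) auto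
    finally show ?thesis using norm_ge_zero[of h] unfolding sum_distrib_left[symmetric] if_P[OF True] by linarith
  qed
  have "(\<Sum>k\<le>n. Re (h / (v + of_nat k))) = (\<Sum>k\<le>n. Re h * ((a + real k) / q k)) + (\<Sum>k\<le>n. Im h * y / q k)"
    unfolding split by (rule sum.distrib)
  then show ?thesis using im re unfolding a_def y_def by linarith
qed

text \<open>In the limit formula \<open>rGamma_series\<close> the ratio of the two sides is the
  product of 1 + h / (v + k) times n to the power - h. The inequality norm (1 + w) at most exp (Re w
  + norm w ^ 2 / 2) turns the product into the sums just bounded, and n tends to infinity. The
  absence of Im v for Re h nonnegative is essential for the vertical growth below.\<close>

lemma norm_rGamma_add_le:
  assumes v: "Re v \<ge> 1"
  shows "norm (rGamma (v + h)) \<le>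
    exp (3 * norm h + (norm h)\<^sup>2 + (if Re h < 0 then 2 * norm h * (Im v)\<^sup>2 else 0)) * Re v powr (- Re h) * norm (rGamma v)"
proof -
  define B where "B = 3 * norm h + (norm h)\<^sup>2 + (if Re h < 0 then 2 * norm h * (Im v)\<^sup>2 else 0)"
  have vk: "norm (v + of_nat k) \<ge> real k + 1" for k
    using complex_Re_le_cmod[of "v + of_nat k"] v by simp
  have vk0: "v + of_nat k \<noteq> 0" for k using vk[of k] by force
  have sq: "(\<Sum>k\<le>n. (norm (h / (v + of_nat k)))\<^sup>2 / 2) \<le> (norm h)\<^sup>2" for n
  proof -
    have "(norm (h / (v + of_nat k)))\<^sup>2 / 2 \<le> (norm h)\<^sup>2 / 2 * (1 / (real k + 1)\<^sup>2)" for k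
    proof -
      have "(norm (h / (v + of_nat k)))\<^sup>2 = (norm h)\<^sup>2 / (norm (v + of_nat k))\<^sup>2" by (simp add: norm_divide power_divide)
      also have "\<dots> \<le> (norm h)\<^sup>2 / (real k + 1)\<^sup>2"
        using vk[of k] by (intro divide_left_mono power_mono mult_pos_pos zero_less_power) (auto simp: vk0)
      finally show ?thesis by simp
    qed
    then have "(\<Sum>k\<le>n. (norm (h / (v + of_nat k)))\<^sup>2 / 2) \<le> (\<Sum>k\<le>n. (norm h)\<^sup>2 / 2 * (1 / (real k + 1)\<^sup>2))" by (intro sum_mono)
    also have "\<dots> \<le> (norm h)\<^sup>2 / 2 * 2" unfolding sum_distrib_left[symmetric] by (intro mult_left_mono sum_inverse_square_le) simp
    finally show ?thesis by simp
  qed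
  have bound: "norm (rGamma_series (v + h) n) \<le> norm (rGamma_series v n) * exp (Re h * (ln (Re v + real n) - ln (real n)) - Re h * ln (Re v) + B)"
    if n: "n \<ge> 1" for n
  proof -
    have "pochhammer (v + h) (n + 1) = (\<Prod>k\<le>n. v + h + of_nat k)"
      by (simp add: pochhammer_Suc_prod lessThan_Suc_atMost atLeast0AtMost add_ac)
    also have "\<dots> = (\<Prod>k\<le>n. (v + of_nat k) * (1 + h / (v + of_nat k)))"
      using vk0 by (intro prod.cong refl) (simp add: field_simps)
    also have "\<dots> = pochhammer v (n + 1) * (\<Prod>k\<le>n. 1 + h / (v + of_nat k))"
      by (simp add: prod.distrib pochhammer_Suc_prod atLeast0AtMost)
    finally have "rGamma_series (v + h) n = rGamma_series v n * (\<Prod>k\<le>n. 1 + h / (v + of_nat k)) * exp (- (h * of_real (ln (of_nat n))))"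
      unfolding rGamma_series_def by (simp add: exp_minus exp_add distrib_right field_simps)
    then have "norm (rGamma_series (v + h) n) = norm (rGamma_series v n) * ((\<Prod>k\<le>n. norm (1 + h / (v + of_nat k))) * exp (- (Re h * ln (real n))))"
      by (simp add: norm_mult prod_norm[symmetric])
    also have "\<dots> \<le> norm (rGamma_series v n) * ((\<Prod>k\<le>n. exp (Re (h / (v + of_nat k)) + (norm (h / (v + of_nat k)))\<^sup>2 / 2)) * exp (- (Re h * ln (real n))))"
      by (intro mult_left_mono mult_right_mono prod_mono conjI norm_one_plus_le_exp norm_ge_zero) auto
    also have "\<dots> = norm (rGamma_series v n) * exp ((\<Sum>k\<le>n. Re (h / (v + of_nat k))) + (\<Sum>k\<le>n. (norm (h / (v + of_nat k)))\<^sup>2 / 2) - Re h * ln (real n))"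
    proof -
      have "(\<Prod>k\<le>n. exp (Re (h / (v + of_nat k)) + (norm (h / (v + of_nat k)))\<^sup>2 / 2))
        = exp ((\<Sum>k\<le>n. Re (h / (v + of_nat k))) + (\<Sum>k\<le>n. (norm (h / (v + of_nat k)))\<^sup>2 / 2))"
        unfolding sum.distrib[symmetric] by (simp only: exp_sum finite_atMost)
      then show ?thesis by (simp only: exp_add[symmetric] diff_conv_add_uminus)
    qed
    also have "\<dots> \<le> norm (rGamma_series v n) * exp (Re h * (ln (Re v + real n) - ln (real n)) - Re h * ln (Re v) + B)"
      using Re_divide_sum_bound[OF v, where n = n and h = h] sq[of n]
      unfolding B_def by (intro mult_left_mono iffD2[OF exp_le_cancel_iff]) (auto simp: algebra_simps)
    finally show ?thesis .
  qed
  have lim: "(\<lambda>n. ln (Re v + real n) - ln (real n)) \<longlonglongrightarrow> 0"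
  proof (rule Lim_transform_eventually)
    have "(\<lambda>n. ln (1 + Re v / real n)) \<longlonglongrightarrow> ln (1 + 0)"
      by (intro tendsto_intros lim_const_over_n) simp
    then show "(\<lambda>n. ln (1 + Re v / real n)) \<longlonglongrightarrow> 0" by simp
    show "\<forall>\<^sub>F n in sequentially. ln (1 + Re v / real n) = ln (Re v + real n) - ln (real n)"
    proof (rule eventually_sequentiallyI[of 1])
      fix n :: nat assume "1 \<le> n"
      then have "1 + Re v / real n = (Re v + real n) / real n" by (simp add: field_simps)
      then show "ln (1 + Re v / real n) = ln (Re v + real n) - ln (real n)"
        using v \<open>1 \<le> n\<close> by (simp add: ln_div)
    qed
  qed
  have "norm (rGamma (v + h)) \<le> norm (rGamma v) * exp (Re h * 0 - Re h * ln (Re v) + B)"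
  proof (rule tendsto_le[OF sequentially_bot])
    show "(\<lambda>n. norm (rGamma_series (v + h) n)) \<longlonglongrightarrow> norm (rGamma (v + h))" by (intro tendsto_intros rGamma_series_LIMSEQ)
    show "(\<lambda>n. norm (rGamma_series v n) * exp (Re h * (ln (Re v + real n) - ln (real n)) - Re h * ln (Re v) + B))
       \<longlonglongrightarrow> norm (rGamma v) * exp (Re h * 0 - Re h * ln (Re v) + B)"
      by (intro tendsto_intros rGamma_series_LIMSEQ lim)
    show "\<forall>\<^sub>F n in sequentially. norm (rGamma_series (v + h) n) \<le>
        norm (rGamma_series v n) * exp (Re h * (ln (Re v + real n) - ln (real n)) - Re h * ln (Re v) + B)"
      using bound by (intro eventually_sequentiallyI[of 1]) auto
  qed
  also have "\<dots> = exp B * Re v powr (- Re h) * norm (rGamma v)"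
    using v by (simp add: powr_def exp_add exp_diff exp_minus field_simps)
  finally show ?thesis unfolding B_def .
qed

lemma powr_le_of_bounds:
  fixes x B t R :: real
  assumes "1 / B \<le> x" "x \<le> B" "B \<ge> 1" "\<bar>t\<bar> \<le> R"
  shows "x powr t \<le> B powr R"
proof -
  have "0 < 1 / B" using assms(3) by simp
  then have x: "x > 0" using assms(1) by linarith
  have "ln x \<le> ln B" using x assms by simp
  moreover have "ln (1 / B) \<le> ln x" using x assms by (intro ln_mono) auto
  then have "- ln B \<le> ln x" using assms(3) by (simp add: ln_div)
  ultimately have "\<bar>ln x\<bar> \<le> ln B" by linarith
  then have "\<bar>t\<bar> * \<bar>ln x\<bar> \<le> R * ln B" using assms(4) by (intro mult_mono) auto
  moreover have "t * ln x \<le> \<bar>t\<bar> * \<bar>ln x\<bar>" unfolding abs_mult[symmetric] by (rule abs_ge_self)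
  ultimately have "t * ln x \<le> R * ln B" by linarith
  then show ?thesis using x assms(3) by (simp add: powr_def)
qed

lemma norm_sin_le: "norm (sin (z::complex)) \<le> exp \<bar>Im z\<bar>"
proof -
  have "norm (sin z) = norm (exp (\<i> * z) - exp (- (\<i> * z))) / 2" unfolding sin_exp_eq by (simp add: norm_divide norm_mult)
  also have "norm (exp (\<i> * z) - exp (- (\<i> * z))) \<le> norm (exp (\<i> * z)) + norm (exp (- (\<i> * z)))" by (rule norm_triangle_ineq4)
  also have "\<dots> = exp (- Im z) + exp (Im z)" by (simp add: norm_exp_eq_Re)
  also have "\<dots> \<le> exp \<bar>Im z\<bar> + exp \<bar>Im z\<bar>" by (intro add_mono) auto
  finally show ?thesis by simp
qed

lemma norm_sin_ge:
  assumes "\<bar>Im z\<bar> \<ge> 1"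
  shows "exp \<bar>Im z\<bar> / 4 \<le> norm (sin (z::complex))"
proof -
  have "norm (sin z) = norm (exp (\<i> * z) - exp (- (\<i> * z))) / 2" unfolding sin_exp_eq by (simp add: norm_divide norm_mult)
  moreover have "norm (exp (\<i> * z) - exp (- (\<i> * z))) \<ge> \<bar>norm (exp (\<i> * z)) - norm (exp (- (\<i> * z)))\<bar>" by (rule norm_triangle_ineq3)
  moreover have "norm (exp (\<i> * z)) = exp (- Im z)" "norm (exp (- (\<i> * z))) = exp (Im z)" by (simp_all add: norm_exp_eq_Re)
  moreover have "\<bar>exp (- Im z) - exp (Im z)\<bar> \<ge> exp \<bar>Im z\<bar> - exp (- \<bar>Im z\<bar>)" by (cases "Im z \<ge> 0") auto
  moreover have "exp (- \<bar>Im z\<bar>) \<le> exp \<bar>Im z\<bar> / 2"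
  proof -
    have "exp (- \<bar>Im z\<bar>) \<le> 1" by simp
    moreover have "1 + \<bar>Im z\<bar> \<le> exp \<bar>Im z\<bar>" by (rule exp_ge_add_one_self)
    ultimately show ?thesis using assms by linarith
  qed
  ultimately show ?thesis by linarith
qed

lemma norm_pochhammer_le: "norm (pochhammer (u::complex) k) \<le> (norm u + real k) ^ k"
proof (induction k)
  case (Suc k)
  have "norm (pochhammer u (Suc k)) = norm (pochhammer u k) * norm (u + of_nat k)" by (simp add: pochhammer_Suc norm_mult)
  also have "\<dots> \<le> (norm u + real k) ^ k * (norm u + real k)"
    using norm_triangle_ineq[of u "of_nat k"] Suc by (intro mult_mono) auto
  also have "\<dots> = (norm u + real k) ^ Suc k" by simp
  also have "\<dots> \<le> (norm u + real (Suc k)) ^ Suc k" by (intro power_mono) auto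
  finally show ?case .
qed simp

lemma norm_rGamma_add_le_const:
  assumes "Re v \<ge> 1" "Re h \<ge> 0"
  shows "norm (rGamma (v + h)) \<le> exp (3 * norm h + (norm h)\<^sup>2) * norm (rGamma v)"
proof -
  have "norm (rGamma (v + h)) \<le> exp (3 * norm h + (norm h)\<^sup>2) * Re v powr (- Re h) * norm (rGamma v)"
    using norm_rGamma_add_le[OF assms(1), of h] assms(2) by simp
  also have "\<dots> \<le> exp (3 * norm h + (norm h)\<^sup>2) * 1 * norm (rGamma v)"
    using assms powr_mono[of "- Re h" 0 "Re v"] by (intro mult_right_mono mult_left_mono) auto
  finally show ?thesis by simp
qed

lemma norm_rGamma_reflect: "norm (rGamma w) * norm (rGamma (1 - w :: complex)) = norm (sin (of_real pi * w)) / pi"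
  unfolding norm_mult[symmetric] rGamma_reflection_complex by (simp add: norm_divide)

lemma rGamma_nonzero_Re: "Re w > 0 \<Longrightarrow> rGamma (w::complex) \<noteq> 0"
  unfolding rGamma_eq_zero_iff by (auto elim!: nonpos_Ints_cases)

lemma exp_pi_shift: "exp (pi * \<bar>y + e\<bar>) \<le> exp (pi * \<bar>e\<bar>) * exp (pi * \<bar>y\<bar>)"
proof -
  have "pi * \<bar>y + e\<bar> \<le> pi * \<bar>e\<bar> + pi * \<bar>y\<bar>" unfolding distrib_left[symmetric] by (intro mult_left_mono) auto
  then show ?thesis by (simp flip: exp_add)
qed

text \<open>The point of the bound is its uniformity in Re v, which later makes it uniform over the
  lattice. The reflection formula gives size exp (pi |Im v|) to the product of \<open>rGamma\<close>
  at v - c and at 1 - (v - c); the argument 1 + v differs from v - c by 1 + c, which has positive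
  real part, and such a shift costs only a constant.\<close>

lemma rGamma_pair_upper:
  assumes c: "Re c \<ge> 0"
  shows "\<exists>C m. C \<ge> 0 \<and> (\<forall>v. \<bar>Im v\<bar> \<ge> 1 + \<bar>Im c\<bar> \<longrightarrow>
    norm (rGamma (1 + v) * rGamma (1 + c - v)) \<le> C * (1 + \<bar>Im v\<bar>) ^ m * exp (pi * \<bar>Im v\<bar>))"
proof -
  define K where "K = exp (3 * norm (1 + c) + (norm (1 + c))\<^sup>2)"
  define k where "k = nat \<lceil>Re c\<rceil> + 2"
  define D where "D = 3 + Re c + real k"
  define C where "C = K * D ^ k * (exp (pi * \<bar>Im c\<bar>) / pi)"
  have K: "K \<ge> 0" unfolding K_def by simp
  have k: "real k \<ge> Re c + 2" unfolding k_def by linarith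
  have D: "D \<ge> 1" unfolding D_def using c by simp
  \<comment> \<open>Far to the right the shift from v - c to 1 + v is covered by
    \<open>norm_rGamma_add_le_const\<close> directly.\<close>
  have A: "norm (rGamma (1 + v) * rGamma (1 + c - v)) \<le> C * (1 + \<bar>Im v\<bar>) ^ k * exp (pi * \<bar>Im v\<bar>)"
    if v: "Re v \<ge> Re c + 1" for v
  proof -
    have 1: "norm (rGamma (1 + v)) \<le> K * norm (rGamma (v - c))"
      using norm_rGamma_add_le_const[of "v - c" "1 + c"] v c unfolding K_def by (simp add: algebra_simps)
    have "norm (rGamma (1 + v)) * norm (rGamma (1 + c - v)) \<le> K * norm (rGamma (v - c)) * norm (rGamma (1 - (v - c)))"
      using 1 by (intro mult_mono) (auto simp: K algebra_simps)
    also have "\<dots> = K * (norm (sin (of_real pi * (v - c))) / pi)" unfolding mult.assoc norm_rGamma_reflect ..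
    also have "\<dots> \<le> K * (exp (pi * \<bar>Im v\<bar>) * exp (pi * \<bar>Im c\<bar>) / pi)"
      using norm_sin_le[of "of_real pi * (v - c)"] exp_pi_shift[of "Im v" "- Im c"] K
      by (intro mult_left_mono divide_right_mono) (auto simp: abs_mult mult.commute)
    also have "\<dots> \<le> C * (1 + \<bar>Im v\<bar>) ^ k * exp (pi * \<bar>Im v\<bar>)"
    proof -
      have "1 * 1 \<le> D ^ k * (1 + \<bar>Im v\<bar>) ^ k" using D by (intro mult_mono one_le_power) auto
      then have "K * (exp (pi * \<bar>Im v\<bar>) * exp (pi * \<bar>Im c\<bar>) / pi) * (1 * 1)
         \<le> K * (exp (pi * \<bar>Im v\<bar>) * exp (pi * \<bar>Im c\<bar>) / pi) * (D ^ k * (1 + \<bar>Im v\<bar>) ^ k)"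
        using K by (intro mult_left_mono) auto
      then show ?thesis unfolding C_def by (simp add: mult_ac)
    qed
    finally show ?thesis by (simp add: norm_mult)
  qed
  \<comment> \<open>In the middle strip both arguments are first moved k steps to the right. The
    Pochhammer symbol of 1 + v is at most polynomial, and that of v - c is at least 1 in modulus
    because its imaginary part is.\<close>
  have B: "norm (rGamma (1 + v) * rGamma (1 + c - v)) \<le> C * (1 + \<bar>Im v\<bar>) ^ k * exp (pi * \<bar>Im v\<bar>)"
    if v: "- 1 < Re v" "Re v < Re c + 1" "\<bar>Im v\<bar> \<ge> 1 + \<bar>Im c\<bar>" for v
  proof -
    define u where "u = v - c + of_nat k"
    have u: "Re u \<ge> 1" unfolding u_def using v k by simp
    have "norm (rGamma (1 + v)) = norm (pochhammer (1 + v) k) * norm (rGamma (u + (1 + c)))"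
      unfolding u_def by (subst pochhammer_rGamma[of "1 + v" k]) (simp add: norm_mult algebra_simps)
    also have "\<dots> \<le> (norm (1 + v) + real k) ^ k * (K * norm (rGamma u))"
      unfolding K_def using norm_rGamma_add_le_const[OF u, of "1 + c"] c
      by (intro mult_mono norm_pochhammer_le) auto
    also have "\<dots> \<le> (D * (1 + \<bar>Im v\<bar>)) ^ k * (K * norm (rGamma u))"
    proof (intro mult_right_mono power_mono)
      have "norm (1 + v) \<le> \<bar>Re (1 + v)\<bar> + \<bar>Im (1 + v)\<bar>" by (rule cmod_le)
      also have "\<dots> \<le> (2 + Re c) + \<bar>Im v\<bar>" using v by simp
      finally have "norm (1 + v) + real k \<le> D + \<bar>Im v\<bar>" unfolding D_def by simp
      also have "\<dots> \<le> D + D * \<bar>Im v\<bar>" using D mult_right_mono[of 1 D "\<bar>Im v\<bar>"] by simp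
      finally show "norm (1 + v) + real k \<le> D * (1 + \<bar>Im v\<bar>)" by (simp add: distrib_left)
    qed (use K in auto)
    finally have 1: "norm (rGamma (1 + v)) \<le> (D * (1 + \<bar>Im v\<bar>)) ^ k * (K * norm (rGamma u))" .
    have p: "norm (pochhammer (v - c) k) \<ge> 1"
    proof -
      have "norm (pochhammer (v - c) k) = (\<Prod>i<k. norm (v - c + of_nat i))"
        unfolding pochhammer_prod prod_norm[symmetric] atLeast0LessThan ..
      moreover have "norm (v - c + of_nat i) \<ge> 1" for i
        using abs_Im_le_cmod[of "v - c + of_nat i"] v(3) by simp
      ultimately show ?thesis by (simp add: prod_ge_1)
    qed
    have "norm (rGamma (v - c)) = norm (pochhammer (v - c) k) * norm (rGamma u)"
      unfolding u_def by (subst pochhammer_rGamma[of "v - c" k]) (simp add: norm_mult)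
    then have 2: "norm (rGamma u) \<le> norm (rGamma (v - c))" using p mult_right_mono[OF p, of "norm (rGamma u)"] by simp
    have "norm (rGamma (1 + v)) * norm (rGamma (1 + c - v))
       \<le> (D * (1 + \<bar>Im v\<bar>)) ^ k * (K * norm (rGamma (v - c))) * norm (rGamma (1 - (v - c)))"
    proof (intro mult_mono)
      have "(D * (1 + \<bar>Im v\<bar>)) ^ k * (K * norm (rGamma u)) \<le> (D * (1 + \<bar>Im v\<bar>)) ^ k * (K * norm (rGamma (v - c)))"
        using 2 K D by (intro mult_left_mono) auto
      then show "norm (rGamma (1 + v)) \<le> (D * (1 + \<bar>Im v\<bar>)) ^ k * (K * norm (rGamma (v - c)))" using 1 by linarith
    qed (use K D in \<open>auto simp: algebra_simps\<close>)
    also have "\<dots> = (D * (1 + \<bar>Im v\<bar>)) ^ k * K * (norm (rGamma (v - c)) * norm (rGamma (1 - (v - c))))" by (simp only: mult.assoc)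
    also have "\<dots> = (D * (1 + \<bar>Im v\<bar>)) ^ k * K * (norm (sin (of_real pi * (v - c))) / pi)" unfolding norm_rGamma_reflect ..
    also have "\<dots> \<le> (D * (1 + \<bar>Im v\<bar>)) ^ k * K * (exp (pi * \<bar>Im v\<bar>) * exp (pi * \<bar>Im c\<bar>) / pi)"
      using norm_sin_le[of "of_real pi * (v - c)"] exp_pi_shift[of "Im v" "- Im c"] K D
      by (intro mult_left_mono divide_right_mono) (auto simp: abs_mult mult.commute)
    also have "\<dots> = C * (1 + \<bar>Im v\<bar>) ^ k * exp (pi * \<bar>Im v\<bar>)" unfolding C_def by (simp add: power_mult_distrib mult_ac)
    finally show ?thesis by (simp add: norm_mult)
  qed
  have final: "norm (rGamma (1 + v) * rGamma (1 + c - v)) \<le> C * exp (pi * \<bar>Im c\<bar>) * (1 + \<bar>Im c\<bar>) ^ k * (1 + \<bar>Im v\<bar>) ^ k * exp (pi * \<bar>Im v\<bar>)"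
    if v: "\<bar>Im v\<bar> \<ge> 1 + \<bar>Im c\<bar>" for v
  proof -
    have C0: "C \<ge> 0" unfolding C_def using K D by simp
    have big: "C * (1 + \<bar>Im v\<bar>) ^ k * exp (pi * \<bar>Im v\<bar>) \<le> C * exp (pi * \<bar>Im c\<bar>) * (1 + \<bar>Im c\<bar>) ^ k * (1 + \<bar>Im v\<bar>) ^ k * exp (pi * \<bar>Im v\<bar>)"
    proof -
      have "1 * 1 \<le> exp (pi * \<bar>Im c\<bar>) * (1 + \<bar>Im c\<bar>) ^ k" by (intro mult_mono one_le_power) auto
      then have "C * (1 + \<bar>Im v\<bar>) ^ k * exp (pi * \<bar>Im v\<bar>) * (1 * 1) \<le> C * (1 + \<bar>Im v\<bar>) ^ k * exp (pi * \<bar>Im v\<bar>) * (exp (pi * \<bar>Im c\<bar>) * (1 + \<bar>Im c\<bar>) ^ k)"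
        using C0 by (intro mult_left_mono) auto
      then show ?thesis by (simp add: mult_ac)
    qed
    consider "Re v \<ge> Re c + 1" | "- 1 < Re v" "Re v < Re c + 1" | "Re v \<le> - 1" by linarith
    then show ?thesis
    proof cases
      case 1
      then show ?thesis using A[of v] big by linarith
    next
      case 2
      then show ?thesis using B[of v] v big by linarith
    next
      case 3
      \<comment> \<open>The substitution of c - v for v exchanges the two factors and maps the left
        region to the right one.\<close>
      have "norm (rGamma (1 + (c - v)) * rGamma (1 + c - (c - v))) \<le> C * (1 + \<bar>Im (c - v)\<bar>) ^ k * exp (pi * \<bar>Im (c - v)\<bar>)"
        using 3 by (intro A) simp
      also have "C * (1 + \<bar>Im (c - v)\<bar>) ^ k * exp (pi * \<bar>Im (c - v)\<bar>) \<le> C * ((1 + \<bar>Im c\<bar>) * (1 + \<bar>Im v\<bar>)) ^ k * (exp (pi * \<bar>Im c\<bar>) * exp (pi * \<bar>Im v\<bar>))"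
      proof (intro mult_mono mult_left_mono power_mono)
        show "1 + \<bar>Im (c - v)\<bar> \<le> (1 + \<bar>Im c\<bar>) * (1 + \<bar>Im v\<bar>)"
        proof -
          have "(1 + \<bar>Im c\<bar>) * (1 + \<bar>Im v\<bar>) = 1 + \<bar>Im c\<bar> + \<bar>Im v\<bar> + \<bar>Im c\<bar> * \<bar>Im v\<bar>" by (simp add: algebra_simps)
          moreover have "0 \<le> \<bar>Im c\<bar> * \<bar>Im v\<bar>" by simp
          moreover have "\<bar>Im (c - v)\<bar> \<le> \<bar>Im c\<bar> + \<bar>Im v\<bar>" by simp
          ultimately show ?thesis by linarith
        qed
        show "exp (pi * \<bar>Im (c - v)\<bar>) \<le> exp (pi * \<bar>Im c\<bar>) * exp (pi * \<bar>Im v\<bar>)"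
          using exp_pi_shift[of "Im c" "- Im v"] by (simp add: mult.commute)
      qed (use C0 in auto)
      finally have "norm (rGamma (1 + (c - v)) * rGamma (1 + c - (c - v))) \<le> C * ((1 + \<bar>Im c\<bar>) * (1 + \<bar>Im v\<bar>)) ^ k * (exp (pi * \<bar>Im c\<bar>) * exp (pi * \<bar>Im v\<bar>))" .
      moreover have "1 + (c - v) = 1 + c - v" "1 + c - (c - v) = 1 + v" by simp_all
      ultimately show ?thesis by (simp only: power_mult_distrib mult_ac)
    qed
  qed
  have "0 \<le> C * exp (pi * \<bar>Im c\<bar>) * (1 + \<bar>Im c\<bar>) ^ k" unfolding C_def using K D by simp
  then show ?thesis using final by blast
qed

text \<open>Moving s - B right by k gives 1 + A + s + h, with k chosen so that Re h is nonnegative.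
  Hence \<open>rGamma\<close> at s - B is at most a polynomial times \<open>rGamma\<close> at 1 + A
  + s, and the reflection formula with the lower bound for the sine finishes.\<close>

lemma rGamma_pair_lower:
  shows "\<exists>C m. C \<ge> 0 \<and> (\<forall>s. Re (1 + A + s) \<ge> 1 \<longrightarrow> \<bar>Re s\<bar> \<le> 1 \<longrightarrow> \<bar>Im s\<bar> \<ge> 1 + \<bar>Im B\<bar> \<longrightarrow>
    exp (pi * \<bar>Im s\<bar>) \<le> C * (1 + \<bar>Im s\<bar>) ^ m * norm (rGamma (1 + A + s) * rGamma (1 + B - s)))"
proof -
  define k where "k = nat \<lceil>Re (1 + A + B)\<rceil>"
  define h where "h = of_nat k - (1 + A + B)"
  define K where "K = exp (3 * norm h + (norm h)\<^sup>2)"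
  define D where "D = 1 + norm B + real k + 1"
  have h: "Re h \<ge> 0" unfolding h_def k_def by simp linarith
  have K: "K \<ge> 0" unfolding K_def by simp
  have D: "D \<ge> 1" unfolding D_def by simp
  have main: "exp (pi * \<bar>Im s\<bar>) \<le> (4 * pi * exp (pi * \<bar>Im B\<bar>) * D ^ k * K) * (1 + \<bar>Im s\<bar>) ^ k * norm (rGamma (1 + A + s) * rGamma (1 + B - s))"
    if s: "Re (1 + A + s) \<ge> 1" "\<bar>Re s\<bar> \<le> 1" "\<bar>Im s\<bar> \<ge> 1 + \<bar>Im B\<bar>" for s
  proof -
    have "norm (rGamma (s - B)) = norm (pochhammer (s - B) k) * norm (rGamma ((1 + A + s) + h))"
      unfolding h_def by (subst pochhammer_rGamma[of "s - B" k]) (simp add: norm_mult algebra_simps)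
    also have "\<dots> \<le> (norm (s - B) + real k) ^ k * (K * norm (rGamma (1 + A + s)))"
      unfolding K_def using norm_rGamma_add_le_const[OF s(1) h] by (intro mult_mono norm_pochhammer_le) auto
    also have "\<dots> \<le> (D * (1 + \<bar>Im s\<bar>)) ^ k * (K * norm (rGamma (1 + A + s)))"
    proof (intro mult_right_mono power_mono)
      have "norm (s - B) \<le> norm s + norm B" by (rule norm_triangle_ineq4)
      moreover have "norm s \<le> 1 + \<bar>Im s\<bar>" using cmod_le[of s] s(2) by linarith
      ultimately have "norm (s - B) + real k \<le> D + \<bar>Im s\<bar>" unfolding D_def by linarith
      also have "\<dots> \<le> D + D * \<bar>Im s\<bar>" using D mult_right_mono[of 1 D "\<bar>Im s\<bar>"] by simp
      finally show "norm (s - B) + real k \<le> D * (1 + \<bar>Im s\<bar>)" by (simp add: distrib_left)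
    qed (use K in auto)
    finally have 1: "norm (rGamma (s - B)) \<le> (D * (1 + \<bar>Im s\<bar>)) ^ k * (K * norm (rGamma (1 + A + s)))" .
    have "exp (pi * \<bar>Im s\<bar>) \<le> exp (pi * \<bar>Im B\<bar>) * exp (pi * \<bar>Im (s - B)\<bar>)"
      using exp_pi_shift[of "Im (s - B)" "Im B"] by simp
    also have "exp (pi * \<bar>Im (s - B)\<bar>) \<le> 4 * norm (sin (of_real pi * (s - B)))"
    proof -
      have "1 * 1 \<le> pi * \<bar>Im (s - B)\<bar>" using s(3) pi_ge_two by (intro mult_mono) auto
      then show ?thesis using norm_sin_ge[of "of_real pi * (s - B)"] by (simp add: abs_mult)
    qed
    also have "norm (sin (of_real pi * (s - B))) = pi * (norm (rGamma (s - B)) * norm (rGamma (1 + B - s)))"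
      using norm_rGamma_reflect[of "s - B"] by (simp add: algebra_simps field_simps)
    finally have "exp (pi * \<bar>Im s\<bar>) \<le> exp (pi * \<bar>Im B\<bar>) * (4 * (pi * (norm (rGamma (s - B)) * norm (rGamma (1 + B - s)))))" by simp
    also have "\<dots> \<le> exp (pi * \<bar>Im B\<bar>) * (4 * (pi * ((D * (1 + \<bar>Im s\<bar>)) ^ k * (K * norm (rGamma (1 + A + s))) * norm (rGamma (1 + B - s)))))"
      using 1 by (intro mult_left_mono mult_right_mono) auto
    finally show ?thesis by (simp add: norm_mult power_mult_distrib mult_ac)
  qed
  have "0 \<le> 4 * pi * exp (pi * \<bar>Im B\<bar>) * D ^ k * K" using K D by simp
  then show ?thesis using main by blast
qed

section \<open>The case q = 1\<close>

definition weight_one :: "int \<Rightarrow> real" where "weight_one l = (1 + \<bar>of_int l\<bar>)\<^sup>2"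

text \<open>The bracket is linear, so its square grows like the weight (1 + |l|)^2. Doubling the
  argument costs only a constant, that is w times 1 / (1 + |l|); the factor \<open>eta_one\<close>
  also supplies the exponent -1 that makes the series converge for every positive
  \<open>\<sigma>\<close>.\<close>

definition eta_one :: "int \<Rightarrow> real" where "eta_one l = 1 / (1 + \<bar>of_int l\<bar>)"

lemma weight_one_powr: "weight_one l powr t = (1 + \<bar>of_int l\<bar>) powr (2 * t)"
proof -
  have "weight_one l = (1 + \<bar>of_int l\<bar>) powr 2" unfolding weight_one_def by simp
  then show ?thesis by (simp only: powr_powr)
qed

lemma gamma_like_rGamma: "gamma_like rGamma (\<lambda>u. u) (\<lambda>s. s\<^sup>2) weight_one eta_one"
proof
  fix u :: complex
  show "rGamma u = u * rGamma (u + 1)" by (simp add: rGamma_plus1)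
  show "\<exists>m. u + of_nat m = 0" if "rGamma u = 0"
    using that unfolding rGamma_eq_zero_iff by (elim nonpos_Ints_cases') auto
  show "Re u = 0" if "u = 0" using that by simp
next
  show "rGamma holomorphic_on UNIV" by (rule holomorphic_rGamma)
next
  fix s t :: complex
  show "(s + t) * (s - t) = s\<^sup>2 - t\<^sup>2" by (simp add: power2_eq_square algebra_simps)
next
  fix b1 b2 b3 b4 s :: complex
  show "(b1 + s) * (b2 + s) * (b3 + s) * (b4 + s) - (b1 - s) * (b2 - s) * (b3 - s) * (b4 - s)
        = 2 * s * ((b1 + b4) * (b2 + b4) * (b3 + b4) - (b1 + b2 + b3 + b4) * ((b4 + s) * (b4 - s)))"
    by algebra
next
  fix l m :: int
  show "1 \<le> weight_one l" unfolding weight_one_def by (rule one_le_power) simp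
  show "weight_one (- l) = weight_one l" unfolding weight_one_def by simp
  show "weight_one (l + m) \<le> weight_one l * weight_one m"
    unfolding weight_one_def power_mult_distrib[symmetric]
  proof (rule power_mono)
    have "0 \<le> \<bar>real_of_int l\<bar> * \<bar>real_of_int m\<bar>" by simp
    moreover have "\<bar>real_of_int (l + m)\<bar> \<le> \<bar>real_of_int l\<bar> + \<bar>real_of_int m\<bar>" by simp
    moreover have "(1 + \<bar>real_of_int l\<bar>) * (1 + \<bar>real_of_int m\<bar>) = 1 + \<bar>real_of_int l\<bar> + \<bar>real_of_int m\<bar> + \<bar>real_of_int l\<bar> * \<bar>real_of_int m\<bar>"
      by (simp add: algebra_simps)
    ultimately show "1 + \<bar>real_of_int (l + m)\<bar> \<le> (1 + \<bar>real_of_int l\<bar>) * (1 + \<bar>real_of_int m\<bar>)" by linarith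
  qed simp
  show "0 \<le> eta_one l" unfolding eta_one_def by simp
next
  have "weight_one (2 * l) powr (1/2) \<le> 2 * (weight_one l * eta_one l)" for l
    unfolding weight_one_powr by (simp add: weight_one_def eta_one_def power2_eq_square)
  then show "\<exists>C. \<forall>l. weight_one (2 * l) powr (1/2) \<le> C * (weight_one l * eta_one l)" by blast
next
  fix \<sigma> :: real assume \<sigma>: "\<sigma> > 0"
  have eq: "weight_one l powr (- \<sigma>) * eta_one l = (1 + \<bar>of_int l\<bar>) powr (- 1 - 2 * \<sigma>)" for l
  proof -
    have "eta_one l = (1 + \<bar>of_int l\<bar>) powr (- 1)" unfolding eta_one_def by (simp add: powr_minus_divide)
    moreover have "2 * - \<sigma> + - 1 = - 1 - 2 * \<sigma>" by simp
    ultimately show ?thesis unfolding weight_one_powr by (simp only: powr_add[symmetric])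
  qed
  have "summable (\<lambda>n. real n powr (- 1 - 2 * \<sigma>))" using \<sigma> by (simp add: summable_real_powr_iff)
  then have "summable (\<lambda>n. real (Suc n) powr (- 1 - 2 * \<sigma>))" by (subst summable_Suc_iff)
  then have "(\<lambda>n. real (Suc n) powr (- 1 - 2 * \<sigma>)) summable_on UNIV"
    by (subst summable_on_UNIV_nonneg_real_iff) auto
  then show "(\<lambda>l. weight_one l powr - \<sigma> * eta_one l) summable_on UNIV"
    unfolding eq by (intro summable_on_int) (simp_all add: add.commute)
next
  fix u :: complex
  have "norm (u + of_int l) \<le> (1 + norm u) * weight_one l powr (1/2)" for l
  proof -
    have "norm (u + of_int l) \<le> norm u + \<bar>of_int l\<bar>" using norm_triangle_ineq[of u "of_int l"] by simp
    moreover have "(1 + norm u) * (1 + \<bar>real_of_int l\<bar>) = norm u + \<bar>of_int l\<bar> + 1 + norm u * \<bar>of_int l\<bar>" by (simp add: algebra_simps)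
    moreover have "0 \<le> norm u * \<bar>real_of_int l\<bar>" by simp
    ultimately have "norm (u + of_int l) \<le> (1 + norm u) * (1 + \<bar>real_of_int l\<bar>)" by linarith
    then show ?thesis unfolding weight_one_powr by simp
  qed
  then show "\<exists>C. \<forall>l. norm (u + of_int l) \<le> C * weight_one l powr (1/2)" by blast
next
  fix R :: real
  define B where "B = 2 + R"
  define E where "E = exp (3 * R + R\<^sup>2 + 2 * R * R\<^sup>2)"
  have "norm (rGamma (u + of_nat l + h)) \<le> E * B powr R * weight_one (int l) powr (- Re h / 2) * norm (rGamma (u + of_nat l))"
    if A: "norm u \<le> R \<and> norm h \<le> R \<and> 1 \<le> Re u + real l" for u h l
  proof -
    have R: "R \<ge> 0" using A norm_ge_zero order_trans by blast
    define x where "x = Re u + real l"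
    have x: "x \<ge> 1" unfolding x_def using A by simp
    have "norm (rGamma (u + of_nat l + h)) \<le>
      exp (3 * norm h + (norm h)\<^sup>2 + (if Re h < 0 then 2 * norm h * (Im (u + of_nat l))\<^sup>2 else 0)) * Re (u + of_nat l) powr (- Re h)
      * norm (rGamma (u + of_nat l))"
      using A by (intro norm_rGamma_add_le) simp
    also have "Re (u + of_nat l) = x" unfolding x_def by simp
    also have "exp (3 * norm h + (norm h)\<^sup>2 + (if Re h < 0 then 2 * norm h * (Im (u + of_nat l))\<^sup>2 else 0)) * x powr (- Re h)
       * norm (rGamma (u + of_nat l)) \<le> E * (B powr R * (1 + real l) powr (- Re h)) * norm (rGamma (u + of_nat l))"
    proof (intro mult_right_mono mult_mono)
      have "(Im (u + of_nat l))\<^sup>2 \<le> R\<^sup>2"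
        using A abs_Im_le_cmod[of u] by (intro power2_le_iff_abs_le[THEN iffD2]) (auto simp: R)
      then have "(if Re h < 0 then 2 * norm h * (Im (u + of_nat l))\<^sup>2 else 0) \<le> 2 * R * R\<^sup>2"
        using A R by (auto intro!: mult_mono)
      moreover have "(norm h)\<^sup>2 \<le> R\<^sup>2" using A by (intro power_mono) auto
      ultimately show "exp (3 * norm h + (norm h)\<^sup>2 + (if Re h < 0 then 2 * norm h * (Im (u + of_nat l))\<^sup>2 else 0)) \<le> E"
        unfolding E_def using A by simp
      have ReU: "\<bar>Re u\<bar> \<le> R" using A abs_Re_le_cmod[of u] by linarith
      \<comment> \<open>The real part x of u + l and 1 + l are comparable up to the factor B in both
        directions, so their powers with exponent bounded by R are comparable too.\<close>
      have "x / (1 + real l) \<le> B"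
      proof -
        define t where "t = R * real l"
        have "0 \<le> t" unfolding t_def using R by simp
        then have "x \<le> 2 + R + t + 2 * real l" using ReU R unfolding x_def by linarith
        also have "\<dots> = B * (1 + real l)" unfolding B_def t_def by (simp add: algebra_simps)
        finally show ?thesis by (simp add: divide_le_eq)
      qed
      moreover have "1 / B \<le> x / (1 + real l)"
      proof -
        have "1 + real l \<le> 1 + x + R" unfolding x_def using ReU by simp
        also have "\<dots> \<le> x + x + R * x" using x R mult_left_mono[of 1 x R] by simp
        also have "\<dots> = B * x" unfolding B_def by (simp add: algebra_simps)
        finally show ?thesis using R unfolding B_def by (simp add: field_simps)
      qed
      ultimately have "(x / (1 + real l)) powr (- Re h) \<le> B powr R"
        using A R abs_Re_le_cmod[of h] by (intro powr_le_of_bounds) (auto simp: B_def)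
      then show "x powr - Re h \<le> B powr R * (1 + real l) powr - Re h"
        using x by (simp add: powr_divide divide_le_eq)
    qed (auto simp: E_def)
    also have "(1 + real l) powr (- Re h) = weight_one (int l) powr (- Re h / 2)" unfolding weight_one_powr by simp
    finally show ?thesis by (simp add: mult_ac)
  qed
  then show "\<exists>C. \<forall>u h. \<forall>l::nat. norm u \<le> R \<and> norm h \<le> R \<and> 1 \<le> Re u + real l \<longrightarrow>
     norm (rGamma (u + of_nat l + h)) \<le> C * weight_one (int l) powr (- Re h / 2) * norm (rGamma (u + of_nat l))" by blast
qed simp_all

lemma prod_growth:
  fixes e :: "'s \<Rightarrow> real" and p :: "'s \<Rightarrow> real" and f :: "'i \<Rightarrow> 's \<Rightarrow> real"
  assumes "finite I" and "\<And>s. s \<in> X \<Longrightarrow> 0 \<le> e s" "\<And>s. s \<in> X \<Longrightarrow> 0 \<le> p s" "\<And>i s. s \<in> X \<Longrightarrow> 0 \<le> f i s"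
    and "\<And>i. i \<in> I \<Longrightarrow> \<exists>C m. C \<ge> 0 \<and> (\<forall>s\<in>X. e s \<le> C * p s ^ m * f i s)"
  shows "\<exists>C m. C \<ge> 0 \<and> (\<forall>s\<in>X. e s ^ card I \<le> C * p s ^ m * (\<Prod>i\<in>I. f i s))"
  using assms(1,5)
proof (induction rule: finite_induct)
  case empty
  then show ?case by (intro exI[of _ 1] exI[of _ 0]) simp
next
  case (insert i I)
  obtain C m where C: "C \<ge> 0" "\<And>s. s \<in> X \<Longrightarrow> e s \<le> C * p s ^ m * f i s" using insert.prems[of i] by blast
  obtain D k where D: "D \<ge> 0" "\<And>s. s \<in> X \<Longrightarrow> e s ^ card I \<le> D * p s ^ k * (\<Prod>i\<in>I. f i s)" using insert by blast
  have "e s ^ card (insert i I) \<le> (C * D) * p s ^ (m + k) * (\<Prod>i\<in>insert i I. f i s)" if s: "s \<in> X" for s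
  proof -
    have "e s ^ card (insert i I) = e s * e s ^ card I" using insert.hyps by simp
    also have "\<dots> \<le> (C * p s ^ m * f i s) * (D * p s ^ k * (\<Prod>i\<in>I. f i s))"
      using C(1) assms(2-4) s by (intro mult_mono C(2) D(2)) (auto intro!: mult_nonneg_nonneg)
    also have "\<dots> = (C * D) * p s ^ (m + k) * (\<Prod>i\<in>insert i I. f i s)"
      using insert.hyps by (simp add: power_add mult_ac)
    finally show ?thesis .
  qed
  then show ?case using C(1) D(1) by (intro exI[of _ "C * D"] exI[of _ "m + k"]) auto
qed

interpretation one: gamma_like rGamma "\<lambda>u. u" "\<lambda>s. s\<^sup>2" weight_one eta_one
  by (rule gamma_like_rGamma)

text \<open>The modulus of W (-1/2) is constant along the lattice in each coordinate, being a value
  of \<open>theta\<close>. Replacing the parameters a + s and b - s by -1/2 therefore gives a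
  convergent majorant free of s. The quotient consists of two pairs of reciprocal gamma functions
  per coordinate, each pair with s cancelling in the sum of its arguments, and
  \<open>rGamma_pair_upper\<close> bounds them uniformly in the lattice point.\<close>

lemma S_growth_rGamma:
  assumes adm: "one.admissible n z" and c0: "Re (a + b) \<ge> 0" and dec: "one.decay n g (c + d - 1) > 0"
  shows "\<exists>C m y0. C \<ge> 0 \<and> (\<forall>s. \<bar>Im s\<bar> \<ge> y0 \<longrightarrow>
     norm (one.S n g (a + s) (b - s) c d z) \<le> C * (1 + \<bar>Im s\<bar>) ^ m * exp (pi * \<bar>Im s\<bar>) ^ (2 * n))"
proof -
  obtain C m where C: "C \<ge> 0" "\<And>v. \<bar>Im v\<bar> \<ge> 1 + \<bar>Im (a + b)\<bar> \<Longrightarrow>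
      norm (rGamma (1 + v) * rGamma (1 + (a + b) - v)) \<le> C * (1 + \<bar>Im v\<bar>) ^ m * exp (pi * \<bar>Im v\<bar>)"
    using rGamma_pair_upper[OF c0] by blast
  define D where "D = \<bar>Im a\<bar> + (\<Sum>j\<in>{1..n}. \<bar>Im (z j)\<bar>)"
  define y0 where "y0 = 1 + \<bar>Im (a + b)\<bar> + D"
  define u where "u s = C * (1 + D) ^ m * exp (pi * D) * ((1 + \<bar>Im s\<bar>) ^ m * exp (pi * \<bar>Im s\<bar>))" for s :: complex
  define \<tau> where "\<tau> j = norm (one.theta (1 / 2 + z j))" for j
  have D0: "D \<ge> 0" unfolding D_def by (intro add_nonneg_nonneg sum_nonneg) auto
  have pair: "norm (rGamma (1 + v) * rGamma (1 + (a + b) - v)) \<le> u s"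
    if "\<bar>Im s\<bar> \<ge> y0" "\<bar>Im v - Im s\<bar> \<le> D" for v s
  proof -
    have "norm (rGamma (1 + v) * rGamma (1 + (a + b) - v)) \<le> C * (1 + \<bar>Im v\<bar>) ^ m * exp (pi * \<bar>Im v\<bar>)"
      using that unfolding y0_def by (intro C(2)) linarith
    also have "\<dots> \<le> C * ((1 + D) * (1 + \<bar>Im s\<bar>)) ^ m * (exp (pi * D) * exp (pi * \<bar>Im s\<bar>))"
    proof (intro mult_mono mult_left_mono power_mono)
      have v: "\<bar>Im v\<bar> \<le> D + \<bar>Im s\<bar>" using that(2) by linarith
      have "(1 + D) * (1 + \<bar>Im s\<bar>) = 1 + D + \<bar>Im s\<bar> + D * \<bar>Im s\<bar>" by (simp add: algebra_simps)
      moreover have "D * \<bar>Im s\<bar> \<ge> 0" using D0 by simp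
      ultimately show "1 + \<bar>Im v\<bar> \<le> (1 + D) * (1 + \<bar>Im s\<bar>)" using v by linarith
      have "pi * \<bar>Im v\<bar> \<le> pi * D + pi * \<bar>Im s\<bar>" unfolding distrib_left[symmetric] using v by (intro mult_left_mono) auto
      then show "exp (pi * \<bar>Im v\<bar>) \<le> exp (pi * D) * exp (pi * \<bar>Im s\<bar>)" unfolding exp_add[symmetric] by simp
    qed (use C(1) D0 in auto)
    finally show ?thesis unfolding u_def by (simp only: power_mult_distrib mult_ac)
  qed
  have u0: "u s \<ge> 0" for s unfolding u_def using C(1) D0 by simp
  have W_half: "norm (one.W (- 1 / 2) (one.shifted z l j)) = \<tau> j" for l j
  proof -
    have "one.W (- 1 / 2) (one.shifted z l j) = one.theta (1 / 2 + z j + of_int (l j))"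
      unfolding one.W_def one.theta_def one.shifted_def by (simp add: algebra_simps)
    then show ?thesis unfolding \<tau>_def by (simp add: one.norm_theta_int)
  qed
  have \<tau>: "\<tau> j > 0" if j: "j \<in> {1..n}" for j
  proof -
    have nz2: "one.nz (2 * z j)" using adm j unfolding one.admissible_def by blast
    \<comment> \<open>Twice 1/2 + z j + l is 2 z j plus an odd integer.\<close>
    have "one.nz (1 / 2 + z j)"
      unfolding one.nz_def
    proof
      fix l :: int
      have "2 * z j + of_int (1 + 2 * l) \<noteq> 0" using nz2 unfolding one.nz_def by blast
      moreover have "2 * (1 / 2 + z j + of_int l) = 2 * z j + of_int (1 + 2 * l)" by (simp add: algebra_simps)
      ultimately show "1 / 2 + z j + of_int l \<noteq> 0" by (metis mult_zero_right)
    qed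
    then show ?thesis unfolding \<tau>_def using one.nz_theta by simp
  qed
  define Ph where "Ph l = norm (one.Phi n g (- 1 / 2) (- 1 / 2) c d (one.shifted z l))" for l
  define T where "T = (\<Prod>j\<in>{1..n}. \<tau> j ^ 2)"
  have T: "T > 0" unfolding T_def by (intro prod_pos zero_less_power \<tau>)
  have "one.decay n g (- 1 / 2 + (- 1 / 2) + c + d) > 0" proof -
    have "- 1 / 2 + (- 1 / 2) + c + d = c + d - 1" by simp
    then show ?thesis using dec by (simp only:)
  qed
  from one.Phi_abs_summable[OF adm this] have Ph: "Ph summable_on int_vectors n" unfolding Ph_def .
  have bound: "norm (one.Phi n g (a + s) (b - s) c d (one.shifted z l)) \<le> Ph l * (u s ^ (2 * n) / T)"
    if y: "\<bar>Im s\<bar> \<ge> y0" for s l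
  proof -
    define x where "x = one.shifted z l"
    have Wne: "one.W (- 1 / 2) (x j) \<noteq> 0" if "j \<in> {1..n}" for j
      using \<tau>[OF that] W_half[of l j] unfolding x_def by auto
    have sg: "one.sg (a + s) (b - s) c d (x j) = one.sg (- 1 / 2) (- 1 / 2) c d (x j) *
       (one.W (a + s) (x j) * one.W (b - s) (x j) / (one.W (- 1 / 2) (x j))\<^sup>2)" if "j \<in> {1..n}" for j
      unfolding one.sg_def using Wne[OF that] by (simp add: power2_eq_square)
    have sgs: "(\<Prod>j\<in>{1..n}. one.sg (a + s) (b - s) c d (x j)) = (\<Prod>j\<in>{1..n}. one.sg (- 1 / 2) (- 1 / 2) c d (x j)) *
       (\<Prod>j\<in>{1..n}. one.W (a + s) (x j) * one.W (b - s) (x j) / (one.W (- 1 / 2) (x j))\<^sup>2)"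
      unfolding prod.distrib[symmetric] by (intro prod.cong refl sg)
    have "one.Phi n g (a + s) (b - s) c d x = one.Phi n g (- 1 / 2) (- 1 / 2) c d x *
       (\<Prod>j\<in>{1..n}. one.W (a + s) (x j) * one.W (b - s) (x j) / (one.W (- 1 / 2) (x j))\<^sup>2)"
      unfolding one.Phi_def sgs by (simp only: mult.assoc)
    then have "norm (one.Phi n g (a + s) (b - s) c d x) = Ph l *
       (\<Prod>j\<in>{1..n}. norm (one.W (a + s) (x j) * one.W (b - s) (x j)) / \<tau> j ^ 2)"
      unfolding Ph_def x_def W_half[of l, symmetric] by (simp only: norm_mult prod_norm[symmetric] norm_divide norm_power)
    also have "\<dots> \<le> Ph l * (\<Prod>j\<in>{1..n}. u s ^ 2 / \<tau> j ^ 2)"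
    proof (intro mult_left_mono prod_mono conjI divide_right_mono)
      fix j assume j: "j \<in> {1..n}"
      have Dj: "\<bar>Im a\<bar> + \<bar>Im (z j)\<bar> \<le> D" unfolding D_def using member_le_sum[OF j, of "\<lambda>j. \<bar>Im (z j)\<bar>"] by simp
      have Imx: "Im (x j) = Im (z j)" unfolding x_def one.shifted_def by simp
      have "one.W (a + s) (x j) * one.W (b - s) (x j) = (rGamma (1 + (a + s + x j)) * rGamma (1 + (a + b) - (a + s + x j))) *
         (rGamma (1 + (a + s - x j)) * rGamma (1 + (a + b) - (a + s - x j)))"
        unfolding one.W_def by (simp add: algebra_simps)
      also have "norm \<dots> \<le> u s * u s"
        unfolding norm_mult[of "_ * _" "_ * _"] using y Dj Imx u0 by (intro mult_mono pair) auto
      finally show "norm (one.W (a + s) (x j) * one.W (b - s) (x j)) \<le> u s ^ 2" by (simp add: power2_eq_square)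
    qed (auto simp: Ph_def)
    also have "(\<Prod>j\<in>{1..n}. u s ^ 2 / \<tau> j ^ 2) = u s ^ (2 * n) / T" unfolding T_def by (simp add: prod_dividef power_mult)
    finally show ?thesis unfolding x_def .
  qed
  define \<Sigma> where "\<Sigma> = infsum Ph (int_vectors n)"
  have \<Sigma>: "\<Sigma> \<ge> 0" unfolding \<Sigma>_def by (intro infsum_nonneg) (simp add: Ph_def)
  define K where "K = \<Sigma> / T * (C * (1 + D) ^ m * exp (pi * D)) ^ (2 * n)"
  have "norm (one.S n g (a + s) (b - s) c d z) \<le> K * (1 + \<bar>Im s\<bar>) ^ (m * (2 * n)) * exp (pi * \<bar>Im s\<bar>) ^ (2 * n)"
    if y: "\<bar>Im s\<bar> \<ge> y0" for s
  proof -
    have hs: "((\<lambda>l. Ph l * (u s ^ (2 * n) / T)) has_sum (\<Sigma> * (u s ^ (2 * n) / T))) (int_vectors n)"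
      unfolding \<Sigma>_def using Ph by (intro has_sum_cmult_left has_sum_infsum)
    have "(\<lambda>l. one.Phi n g (a + s) (b - s) c d (one.shifted z l)) summable_on int_vectors n"
      by (rule abs_summable_summable, rule Infinite_Sum.abs_summable_on_comparison_test'[OF has_sum_imp_summable[OF hs]])
        (rule bound[OF y])
    then have "norm (one.S n g (a + s) (b - s) c d z) \<le> \<Sigma> * (u s ^ (2 * n) / T)"
      unfolding one.S_def by (intro norm_infsum_le[OF has_sum_infsum hs] bound[OF y])
    also have "\<dots> = K * (1 + \<bar>Im s\<bar>) ^ (m * (2 * n)) * exp (pi * \<bar>Im s\<bar>) ^ (2 * n)"
      unfolding K_def u_def by (simp add: power_mult_distrib power_mult mult_ac)
    finally show ?thesis .
  qed
  moreover have "K \<ge> 0" unfolding K_def using \<Sigma> T C(1) D0 by simp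
  ultimately show ?thesis by blast
qed

text \<open>For each i the product contains two pairs depending on s, one with c and one with d.
  Thus 2n exponentials are gained from below, as many as the upper bound of the sum
  contains.\<close>

lemma R_growth_rGamma:
  assumes gen: "one.generic n g z" and reg: "one.region n g (a - 2) (b - 2) c d" and n: "n \<ge> 1"
  shows "\<exists>C m y0. C \<ge> 0 \<and> (\<forall>s. \<bar>Re s\<bar> \<le> 1 \<longrightarrow> \<bar>Im s\<bar> \<ge> y0 \<longrightarrow>
     exp (pi * \<bar>Im s\<bar>) ^ (2 * n) \<le> C * (1 + \<bar>Im s\<bar>) ^ m * norm (one.R n g (a + s) (b - s) c d))"
proof -
  define y0 where "y0 = 1 + (\<Sum>i<n. \<bar>Im (of_nat i * g + b + c)\<bar> + \<bar>Im (of_nat i * g + b + d)\<bar>)"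
  define X where "X = {s. \<bar>Re s\<bar> \<le> 1 \<and> \<bar>Im s\<bar> \<ge> y0}"
  define f1 where "f1 i s = norm (rGamma (1 + (of_nat i * g + a + c) + s) * rGamma (1 + (of_nat i * g + b + c) - s))" for i :: nat and s
  define f2 where "f2 i s = norm (rGamma (1 + (of_nat i * g + a + d) + s) * rGamma (1 + (of_nat i * g + b + d) - s))" for i :: nat and s
  have rg: "Re a \<ge> one.big n g + 2" "Re b \<ge> one.big n g + 2" "Re c \<ge> one.big n g" "Re d \<ge> one.big n g"
    using reg unfolding one.region_def by auto
  have K0: "one.big n g > 0" by (rule one.big_pos)
  have pos: "Re (1 + (of_nat i * g + e) + s) \<ge> 1" if "i < n" "Re e \<ge> one.big n g + 2" "\<bar>Re s\<bar> \<le> 1" for i e s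
    using one.Re_add_nat_mult[of i n g] that K0 by simp
  have Im_le: "\<bar>Im s\<bar> \<ge> 1 + \<bar>Im (of_nat i * g + b + c)\<bar>" "\<bar>Im s\<bar> \<ge> 1 + \<bar>Im (of_nat i * g + b + d)\<bar>" if "s \<in> X" "i < n" for i s
  proof -
    have "\<bar>Im (of_nat i * g + b + c)\<bar> + \<bar>Im (of_nat i * g + b + d)\<bar> \<le> (\<Sum>i<n. \<bar>Im (of_nat i * g + b + c)\<bar> + \<bar>Im (of_nat i * g + b + d)\<bar>)"
      using that(2) by (intro member_le_sum) auto
    then show "\<bar>Im s\<bar> \<ge> 1 + \<bar>Im (of_nat i * g + b + c)\<bar>" "\<bar>Im s\<bar> \<ge> 1 + \<bar>Im (of_nat i * g + b + d)\<bar>"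
      using that(1) unfolding X_def y0_def by (auto simp del: plus_complex.sel times_complex.sel)
  qed
  have F1: "\<exists>C m. C \<ge> 0 \<and> (\<forall>s\<in>X. exp (pi * \<bar>Im s\<bar>) \<le> C * (1 + \<bar>Im s\<bar>) ^ m * f1 i s)" if i: "i < n" for i
  proof -
    obtain C m where C: "C \<ge> 0" "\<And>s. Re (1 + (of_nat i * g + a + c) + s) \<ge> 1 \<Longrightarrow> \<bar>Re s\<bar> \<le> 1 \<Longrightarrow>
        \<bar>Im s\<bar> \<ge> 1 + \<bar>Im (of_nat i * g + b + c)\<bar> \<Longrightarrow> exp (pi * \<bar>Im s\<bar>) \<le> C * (1 + \<bar>Im s\<bar>) ^ m * f1 i s"
      using rGamma_pair_lower[of "of_nat i * g + a + c" "of_nat i * g + b + c"] unfolding f1_def by blast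
    have "exp (pi * \<bar>Im s\<bar>) \<le> C * (1 + \<bar>Im s\<bar>) ^ m * f1 i s" if s: "s \<in> X" for s
    proof (rule C(2)[OF _ _ Im_le(1)[OF s i]])
      show "Re (1 + (of_nat i * g + a + c) + s) \<ge> 1" using pos[OF i, of "a + c" s] rg K0 s unfolding X_def by (simp add: add.assoc)
      show "\<bar>Re s\<bar> \<le> 1" using s unfolding X_def by simp
    qed
    then show ?thesis using C(1) by blast
  qed
  have F2: "\<exists>C m. C \<ge> 0 \<and> (\<forall>s\<in>X. exp (pi * \<bar>Im s\<bar>) \<le> C * (1 + \<bar>Im s\<bar>) ^ m * f2 i s)" if i: "i < n" for i
  proof -
    obtain C m where C: "C \<ge> 0" "\<And>s. Re (1 + (of_nat i * g + a + d) + s) \<ge> 1 \<Longrightarrow> \<bar>Re s\<bar> \<le> 1 \<Longrightarrow>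
        \<bar>Im s\<bar> \<ge> 1 + \<bar>Im (of_nat i * g + b + d)\<bar> \<Longrightarrow> exp (pi * \<bar>Im s\<bar>) \<le> C * (1 + \<bar>Im s\<bar>) ^ m * f2 i s"
      using rGamma_pair_lower[of "of_nat i * g + a + d" "of_nat i * g + b + d"] unfolding f2_def by blast
    have "exp (pi * \<bar>Im s\<bar>) \<le> C * (1 + \<bar>Im s\<bar>) ^ m * f2 i s" if s: "s \<in> X" for s
    proof (rule C(2)[OF _ _ Im_le(2)[OF s i]])
      show "Re (1 + (of_nat i * g + a + d) + s) \<ge> 1" using pos[OF i, of "a + d" s] rg K0 s unfolding X_def by (simp add: add.assoc)
      show "\<bar>Re s\<bar> \<le> 1" using s unfolding X_def by simp
    qed
    then show ?thesis using C(1) by blast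
  qed
  have "\<exists>C m. C \<ge> 0 \<and> (\<forall>s\<in>X. exp (pi * \<bar>Im s\<bar>) ^ card {..<n} \<le> C * (1 + \<bar>Im s\<bar>) ^ m * (\<Prod>i<n. f1 i s))"
    by (intro prod_growth F1) (simp_all add: f1_def)
  then obtain C1 m1 where C1: "C1 \<ge> 0" "\<And>s. s \<in> X \<Longrightarrow> exp (pi * \<bar>Im s\<bar>) ^ n \<le> C1 * (1 + \<bar>Im s\<bar>) ^ m1 * (\<Prod>i<n. f1 i s)"
    unfolding card_lessThan by blast
  have "\<exists>C m. C \<ge> 0 \<and> (\<forall>s\<in>X. exp (pi * \<bar>Im s\<bar>) ^ card {..<n} \<le> C * (1 + \<bar>Im s\<bar>) ^ m * (\<Prod>i<n. f2 i s))"
    by (intro prod_growth F2) (simp_all add: f2_def)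
  then obtain C2 m2 where C2: "C2 \<ge> 0" "\<And>s. s \<in> X \<Longrightarrow> exp (pi * \<bar>Im s\<bar>) ^ n \<le> C2 * (1 + \<bar>Im s\<bar>) ^ m2 * (\<Prod>i<n. f2 i s)"
    unfolding card_lessThan by blast
  define Q where "Q = norm ((\<Prod>i<n. rGamma 1 * rGamma (1 + of_nat (Suc i) * g) / rGamma (1 + g)) *
    (\<Prod>i<n. rGamma (1 + of_nat i * g + a + b) * rGamma (1 + of_nat i * g + c + d) / rGamma (1 + (of_nat n - 1 + of_nat i) * g + a + b + c + d)))"
  have R_eq: "norm (one.R n g (a + s) (b - s) c d) = Q * ((\<Prod>i<n. f1 i s) * (\<Prod>i<n. f2 i s))" for s
  proof -
    define den where "den i = rGamma (1 + (of_nat n - 1 + of_nat i) * g + a + b + c + d)" for i :: nat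
    define p1 where "p1 i = rGamma (1 + (of_nat i * g + a + c) + s) * rGamma (1 + (of_nat i * g + b + c) - s)" for i :: nat
    define p2 where "p2 i = rGamma (1 + (of_nat i * g + a + d) + s) * rGamma (1 + (of_nat i * g + b + d) - s)" for i :: nat
    have e: "1 + of_nat i * g + (a + s) + (b - s) = 1 + of_nat i * g + a + b"
      "1 + of_nat i * g + (a + s) + c = 1 + (of_nat i * g + a + c) + s" "1 + of_nat i * g + (a + s) + d = 1 + (of_nat i * g + a + d) + s"
      "1 + of_nat i * g + (b - s) + c = 1 + (of_nat i * g + b + c) - s" "1 + of_nat i * g + (b - s) + d = 1 + (of_nat i * g + b + d) - s"
      "1 + (of_nat n - 1 + of_nat i) * g + (a + s) + (b - s) + c + d = 1 + (of_nat n - 1 + of_nat i) * g + a + b + c + d" for i :: nat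
      by (simp_all add: algebra_simps)
    have "one.R n g (a + s) (b - s) c d = (\<Prod>i<n. rGamma 1 * rGamma (1 + of_nat (Suc i) * g) / rGamma (1 + g)) *
      (\<Prod>i<n. (rGamma (1 + of_nat i * g + a + b) * rGamma (1 + of_nat i * g + c + d) / den i) * (p1 i * p2 i))"
      unfolding one.R_def e p1_def p2_def den_def by (intro arg_cong2[where f = "(*)"] prod.cong refl) (simp add: mult_ac)
    also have "\<dots> = (\<Prod>i<n. rGamma 1 * rGamma (1 + of_nat (Suc i) * g) / rGamma (1 + g)) *
      (\<Prod>i<n. (rGamma (1 + of_nat i * g + a + b) * rGamma (1 + of_nat i * g + c + d) / den i)) * ((\<Prod>i<n. p1 i) * (\<Prod>i<n. p2 i))"
      by (simp only: prod.distrib mult.assoc)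
    finally show ?thesis unfolding Q_def f1_def f2_def p1_def p2_def den_def norm_mult by (simp only: prod_norm[symmetric] norm_mult)
  qed
  have "one.region n g (a + 0) (b - 0) c d" using rg K0 unfolding one.region_def by simp
  from one.R_region_nonzero[OF gen this] have "Q \<noteq> 0" using R_eq[of 0] by auto
  moreover have "Q \<ge> 0" unfolding Q_def by (rule norm_ge_zero)
  ultimately have Q: "Q > 0" by simp
  have "exp (pi * \<bar>Im s\<bar>) ^ (2 * n) \<le> (C1 * C2 / Q) * (1 + \<bar>Im s\<bar>) ^ (m1 + m2) * norm (one.R n g (a + s) (b - s) c d)"
    if s: "\<bar>Re s\<bar> \<le> 1" "\<bar>Im s\<bar> \<ge> y0" for s
  proof -
    have X: "s \<in> X" using s unfolding X_def by simp
    have "exp (pi * \<bar>Im s\<bar>) ^ (2 * n) = exp (pi * \<bar>Im s\<bar>) ^ n * exp (pi * \<bar>Im s\<bar>) ^ n" by (simp add: mult_2 power_add)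
    also have "\<dots> \<le> (C1 * (1 + \<bar>Im s\<bar>) ^ m1 * (\<Prod>i<n. f1 i s)) * (C2 * (1 + \<bar>Im s\<bar>) ^ m2 * (\<Prod>i<n. f2 i s))"
      using C1(1) by (intro mult_mono C1(2) C2(2) X) (auto simp: f1_def intro!: mult_nonneg_nonneg prod_nonneg)
    also have "\<dots> = (C1 * C2 / Q) * (1 + \<bar>Im s\<bar>) ^ (m1 + m2) * norm (one.R n g (a + s) (b - s) c d)"
      unfolding R_eq using Q by (simp add: power_add mult_ac)
    finally show ?thesis .
  qed
  moreover have "C1 * C2 / Q \<ge> 0" using C1(1) C2(1) Q by simp
  ultimately show ?thesis by blast
qed

text \<open>The exponential factors of the upper bound for the sum and of the lower bound for the
  product cancel, and only powers of 1 + |Im s| remain.\<close>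

lemma gamma_like_growth_rGamma: "gamma_like_growth rGamma (\<lambda>u. u) (\<lambda>s. s\<^sup>2) weight_one eta_one"
proof (intro gamma_like_growth.intro gamma_like_rGamma gamma_like_growth_axioms.intro)
  fix n g z a b c d
  assume adm: "one.admissible n z" and gen: "one.generic n g z" and n: "n \<ge> 1" and reg: "one.region n g (a - 2) (b - 2) c d"
  have K0: "one.big n g \<ge> 4" using one.big_ge[of n g] by simp
  have c0: "Re (a + b) \<ge> 0" using reg K0 unfolding one.region_def by simp
  have "one.decay n g (c + d - 1) > 2 * real n + 1" using reg K0 unfolding one.region_def by (intro one.decay_big) simp
  then have dec: "one.decay n g (c + d - 1) > 0" by simp
  obtain C m y0 where C: "C \<ge> 0" "\<And>s. \<bar>Im s\<bar> \<ge> y0 \<Longrightarrow>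
     norm (one.S n g (a + s) (b - s) c d z) \<le> C * (1 + \<bar>Im s\<bar>) ^ m * exp (pi * \<bar>Im s\<bar>) ^ (2 * n)"
    using S_growth_rGamma[OF adm c0 dec] by blast
  obtain D k y1 where D: "D \<ge> 0" "\<And>s. \<bar>Re s\<bar> \<le> 1 \<Longrightarrow> \<bar>Im s\<bar> \<ge> y1 \<Longrightarrow>
     exp (pi * \<bar>Im s\<bar>) ^ (2 * n) \<le> D * (1 + \<bar>Im s\<bar>) ^ k * norm (one.R n g (a + s) (b - s) c d)"
    using R_growth_rGamma[OF gen reg n] by blast
  have "norm (one.S n g (a + s) (b - s) c d z) \<le> (C * D) * (1 + \<bar>Im s\<bar>) ^ (m + k) * norm (one.R n g (a + s) (b - s) c d)"
    if s: "\<bar>Re s\<bar> \<le> 1" "\<bar>Im s\<bar> \<ge> max y0 y1" for s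
  proof -
    have "norm (one.S n g (a + s) (b - s) c d z) \<le> C * (1 + \<bar>Im s\<bar>) ^ m * exp (pi * \<bar>Im s\<bar>) ^ (2 * n)" using s by (intro C(2)) simp
    also have "\<dots> \<le> C * (1 + \<bar>Im s\<bar>) ^ m * (D * (1 + \<bar>Im s\<bar>) ^ k * norm (one.R n g (a + s) (b - s) c d))"
      using C(1) s by (intro mult_left_mono D(2)) auto
    finally show ?thesis by (simp add: power_add mult_ac)
  qed
  then show "\<exists>C m y0. \<forall>s. \<bar>Re s\<bar> \<le> 1 \<longrightarrow> y0 \<le> \<bar>Im s\<bar> \<longrightarrow>
      norm (one.S n g (a + s) (b - s) c d z) \<le> C * (1 + \<bar>Im s\<bar>) ^ m * norm (one.R n g (a + s) (b - s) c d)" by blast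
qed

section \<open>The case q < 1\<close>

lemma laurent_four:
  fixes x1 x2 x3 x4 y :: "'a::field"
  assumes nz: "x1 \<noteq> 0" "x2 \<noteq> 0" "x3 \<noteq> 0" "x4 \<noteq> 0" "y \<noteq> 0"
  shows "(1 / (x1 * y) - x1 * y) * (1 / (x2 * y) - x2 * y) * (1 / (x3 * y) - x3 * y) * (1 / (x4 * y) - x4 * y)
    - (1 / (x1 / y) - x1 / y) * (1 / (x2 / y) - x2 / y) * (1 / (x3 / y) - x3 / y) * (1 / (x4 / y) - x4 / y)
    = (1 / (y * y) - y * y) * ((1 / (x1 * x4) - x1 * x4) * (1 / (x2 * x4) - x2 * x4) * (1 / (x3 * x4) - x3 * x4)
        - (1 / (x1 * x2 * x3 * x4) - x1 * x2 * x3 * x4) * ((1 / (x4 * y) - x4 * y) * (1 / (x4 / y) - x4 / y)))"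
    (is "?l = ?r")
proof -
  have p: "1 / (x * z) - x * z = (1 - x\<^sup>2 * z\<^sup>2) / (x * z)" if "x \<noteq> 0" "z \<noteq> 0" for x z :: 'a
    using that by (simp add: field_simps power2_eq_square)
  have m: "1 / (x / z) - x / z = (z\<^sup>2 - x\<^sup>2) / (x * z)" if "x \<noteq> 0" "z \<noteq> 0" for x z :: 'a
    using that by (simp add: field_simps power2_eq_square)
  \<comment> \<open>After clearing denominators only squares occur, and the identity becomes
    polynomial in them.\<close>
  define A1 A2 A3 A4 t where "A1 = x1\<^sup>2" and "A2 = x2\<^sup>2" and "A3 = x3\<^sup>2" and "A4 = x4\<^sup>2" and "t = y\<^sup>2"
  note ds = A1_def[symmetric] A2_def[symmetric] A3_def[symmetric] A4_def[symmetric] t_def[symmetric]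
  define D where "D = x1 * x2 * x3 * x4 * (y * y * y * y)"
  have D: "D \<noteq> 0" "A4 \<noteq> 0" "t \<noteq> 0" unfolding D_def A4_def t_def using nz by simp_all
  have den: "x1 * y * (x2 * y) * (x3 * y) * (x4 * y) = D" unfolding D_def by (simp only: mult_ac)
  have l: "?l = ((1 - A1 * t) * (1 - A2 * t) * (1 - A3 * t) * (1 - A4 * t) - (t - A1) * (t - A2) * (t - A3) * (t - A4)) / D"
    unfolding p[OF nz(1,5)] p[OF nz(2,5)] p[OF nz(3,5)] p[OF nz(4,5)] m[OF nz(1,5)] m[OF nz(2,5)] m[OF nz(3,5)] m[OF nz(4,5)] ds times_divide_times_eq den
    by (rule diff_divide_distrib[symmetric])
  have x: "1 / (x1 * x2 * x3 * x4) - x1 * x2 * x3 * x4 = (1 - A1 * A2 * A3 * A4) / (x1 * x2 * x3 * x4)"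
    using nz unfolding A1_def A2_def A3_def A4_def by (simp add: field_simps power2_eq_square)
  have yy: "1 / (y * y) - y * y = (1 - t * t) / t" using nz unfolding t_def by (simp add: field_simps power2_eq_square)
  have f1: "(1 - A1 * A4) / (x1 * x4) * ((1 - A2 * A4) / (x2 * x4)) * ((1 - A3 * A4) / (x3 * x4)) =
     t * t * ((1 - A1 * A4) * (1 - A2 * A4) * (1 - A3 * A4)) / (D * A4)"
    using nz unfolding D_def A4_def t_def by (simp add: power2_eq_square mult_ac)
  have f2: "(1 - A1 * A2 * A3 * A4) / (x1 * x2 * x3 * x4) * ((1 - A4 * t) / (x4 * y) * ((t - A4) / (x4 * y))) =
     t * ((1 - A1 * A2 * A3 * A4) * (1 - A4 * t) * (t - A4)) / (D * A4)"
    using nz unfolding D_def A4_def t_def by (simp add: power2_eq_square mult_ac)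
  have "?r = (1 - t * t) / t * (t * t * ((1 - A1 * A4) * (1 - A2 * A4) * (1 - A3 * A4)) / (D * A4) -
      t * ((1 - A1 * A2 * A3 * A4) * (1 - A4 * t) * (t - A4)) / (D * A4))"
    unfolding x yy p[OF nz(1,4)] p[OF nz(2,4)] p[OF nz(3,4)] p[OF nz(4,5)] m[OF nz(4,5)] ds f1 f2 ..
  also have "\<dots> = ((1 - t * t) * (t * ((1 - A1 * A4) * (1 - A2 * A4) * (1 - A3 * A4)) - (1 - A1 * A2 * A3 * A4) * (1 - A4 * t) * (t - A4))) / (D * A4)"
    unfolding diff_divide_distrib[symmetric] using D(3) by (simp add: right_diff_distrib[symmetric] mult.assoc)
  also have "(1 - t * t) * (t * ((1 - A1 * A4) * (1 - A2 * A4) * (1 - A3 * A4)) - (1 - A1 * A2 * A3 * A4) * (1 - A4 * t) * (t - A4))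
     = ((1 - A1 * t) * (1 - A2 * t) * (1 - A3 * t) * (1 - A4 * t) - (t - A1) * (t - A2) * (t - A3) * (t - A4)) * A4"
    by (simp add: algebra_simps)
  finally show ?thesis unfolding l using D by simp
qed

context
  fixes q :: real
  assumes q: "0 < q" "q < 1"
begin

lemma qpochhammer_inf_convergent: "convergent_prod (\<lambda>k. 1 - a * of_real q ^ k :: complex)"
proof -
  have "summable (\<lambda>k. norm a * q ^ k)" using q by (intro summable_mult summable_geometric) auto
  then have "summable (\<lambda>k. norm ((1 - a * of_real q ^ k) - 1))" using q by (simp add: norm_mult norm_power)
  then show ?thesis using abs_convergent_prod_conv_summable abs_convergent_prod_imp_convergent_prod by blast
qed

lemma qpochhammer_inf_rec: "qpochhammer_inf a q = (1 - a) * qpochhammer_inf (a * of_real q) q"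
proof -
  define f where "f k = 1 - a * of_real q ^ k" for k
  have "prodinf f = (\<Prod>k<1. f k) * (\<Prod>k. f (k + 1))"
    using has_prod_ignore_initial_segment'[of f 1] qpochhammer_inf_convergent[of a] unfolding f_def
    by (intro has_prod_unique[symmetric]) simp
  then show ?thesis unfolding qpochhammer_inf_def f_def by (simp add: mult_ac)
qed

lemma qpochhammer_inf_zero:
  assumes "qpochhammer_inf a q = 0"
  shows "\<exists>k. a * of_real q ^ k = 1"
  using prodinf_nonzero[OF qpochhammer_inf_convergent[of a]] assms unfolding qpochhammer_inf_def
  by (metis eq_iff_diff_eq_0)

lemma qpochhammer_inf_holomorphic: "(\<lambda>a. qpochhammer_inf a q) holomorphic_on UNIV"
proof (rule holomorphic_uniform_sequence[where f = "\<lambda>N a. \<Prod>k<N. 1 - a * of_real q ^ k"])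
  show "(\<lambda>a. \<Prod>k<N. 1 - a * of_real q ^ k) holomorphic_on UNIV" for N by (intro holomorphic_intros)
  fix x :: complex
  define A where "A = cball x 1"
  have "uniformly_convergent_on A (\<lambda>N a. \<Prod>k<N. 1 - a * of_real q ^ k)"
  proof (rule uniformly_convergent_on_prod')
    show "continuous_on A (\<lambda>a. 1 - a * of_real q ^ k)" for k by (intro continuous_intros)
    show "compact A" unfolding A_def by simp
    show "uniformly_convergent_on A (\<lambda>N a. \<Sum>k<N. norm (1 - a * of_real q ^ k - 1))"
    proof (rule Weierstrass_m_test'_ev)
      show "summable (\<lambda>k. (norm x + 1) * q ^ k)" using q by (intro summable_mult summable_geometric) auto
      show "\<forall>\<^sub>F k in sequentially. \<forall>a\<in>A. norm (norm (1 - a * of_real q ^ k - 1)) \<le> (norm x + 1) * q ^ k"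
      proof (intro always_eventually allI ballI)
        fix k a assume "a \<in> A"
        then have "norm a \<le> norm x + 1"
          unfolding A_def using norm_triangle_ineq4[of x "x - a"] by (simp add: dist_norm)
        then show "norm (norm (1 - a * of_real q ^ k - 1)) \<le> (norm x + 1) * q ^ k"
          using q by (simp add: norm_mult norm_power mult_right_mono)
      qed
    qed
  qed
  then obtain l where l: "uniform_limit A (\<lambda>N a. \<Prod>k<N. 1 - a * of_real q ^ k) l sequentially"
    unfolding uniformly_convergent_on_def by blast
  have "l a = qpochhammer_inf a q" if "a \<in> A" for a
  proof -
    have "(\<lambda>N. \<Prod>k<N. 1 - a * of_real q ^ k) \<longlonglongrightarrow> l a" by (rule tendsto_uniform_limitI[OF l that])
    moreover have "(\<lambda>N. \<Prod>k<N. 1 - a * of_real q ^ k) \<longlonglongrightarrow> qpochhammer_inf a q"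
      unfolding qpochhammer_inf_def LIMSEQ_lessThan_iff_atMost
      by (rule convergent_prod_LIMSEQ[OF qpochhammer_inf_convergent])
    ultimately show ?thesis by (rule LIMSEQ_unique)
  qed
  then have "uniform_limit A (\<lambda>N a. \<Prod>k<N. 1 - a * of_real q ^ k) (\<lambda>a. qpochhammer_inf a q) sequentially"
    using uniform_limit_cong'[of A _ _ l "\<lambda>a. qpochhammer_inf a q"] l by fastforce
  then show "\<exists>d>0. cball x d \<subseteq> UNIV \<and> uniform_limit (cball x d) (\<lambda>N a. \<Prod>k<N. 1 - a * of_real q ^ k) (\<lambda>a. qpochhammer_inf a q) sequentially"
    unfolding A_def by (intro exI[of _ 1]) simp
qed simp

definition lq :: complex where "lq = of_real (ln q)"

lemma ln_q_neg: "ln q < 0" using q by simp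

lemma qfac_exp: "qfac q u = qpochhammer_inf (exp (lq * u)) q"
  unfolding qfac_def lq_def using q by (simp add: powr_def Ln_of_real mult.commute)

lemma exp_lq: "exp (lq * (u + of_nat k)) = exp (lq * u) * of_real q ^ k"
proof -
  have "exp lq = of_real q" unfolding lq_def using q by (simp add: exp_of_real)
  then show ?thesis by (simp add: distrib_left exp_add mult.commute[of lq "of_nat k"] exp_of_nat_mult)
qed

lemma qfac_rec: "qfac q u = (1 - exp (lq * u)) * qfac q (u + 1)"
  unfolding qfac_exp using qpochhammer_inf_rec[of "exp (lq * u)"] exp_lq[of u 1] by simp

text \<open>The bare symbol has the recurrence factor 1 - q^u, which is not odd. The Gaussian factor
  q^(u (u - 1) / 4) symmetrises it to q^(-u/2) - q^(u/2).\<close>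

definition Fq :: "complex \<Rightarrow> complex" where
  "Fq u = exp (lq * (u * (u - 1) / 4)) * qfac q u"

definition brq :: "complex \<Rightarrow> complex" where
  "brq u = exp (- (lq * u / 2)) - exp (lq * u / 2)"

definition Yq :: "complex \<Rightarrow> complex" where
  "Yq s = exp (lq * s) + exp (- (lq * s))"

text \<open>This is q^(-|l|), the order of the square of \<open>brq\<close> along the
  integers.\<close>

definition weight_q :: "int \<Rightarrow> real" where
  "weight_q l = exp (- (ln q * \<bar>of_int l\<bar>))"

lemma brq_eq: "brq u = exp (- (lq * u / 2)) * (1 - exp (lq * u))"
proof -
  have "- (lq * u / 2) + lq * u = lq * u / 2" by (simp add: field_simps)
  then show ?thesis unfolding brq_def right_diff_distrib exp_add[symmetric] by (simp only: mult_1_right)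
qed

lemma weight_q_powr: "weight_q l powr t = exp (- (t * ln q * \<bar>of_int l\<bar>))"
  unfolding weight_q_def powr_def by simp

lemma brq_four:
  "brq (b1 + s) * brq (b2 + s) * brq (b3 + s) * brq (b4 + s)
    - brq (b1 - s) * brq (b2 - s) * brq (b3 - s) * brq (b4 - s)
    = brq (2 * s) * (brq (b1 + b4) * brq (b2 + b4) * brq (b3 + b4)
        - brq (b1 + b2 + b3 + b4) * (brq (b4 + s) * brq (b4 - s)))"
proof -
  define E where "E u = exp (lq * u / 2)" for u
  have E_add: "E (u + v) = E u * E v" for u v unfolding E_def exp_add[symmetric] by (simp only: distrib_left add_divide_distrib)
  have E_diff: "E (u - v) = E u / E v" for u v unfolding E_def exp_diff[symmetric] by (simp only: right_diff_distrib diff_divide_distrib)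
  have E2: "E (2 * u) = E u * E u" for u using E_add[of u u] by (simp only: mult_2)
  have br: "brq u = 1 / E u - E u" for u unfolding brq_def E_def exp_minus by (simp only: inverse_eq_divide)
  have nz: "E u \<noteq> 0" for u unfolding E_def by simp
  show ?thesis unfolding br E_add E_diff E2 by (rule laurent_four) (rule nz)+
qed

lemma gamma_like_Fq: "gamma_like Fq brq Yq weight_q (\<lambda>_. 1)"
proof
  fix u :: complex
  have "Fq u = exp (lq * (u * (u - 1) / 4)) * ((1 - exp (lq * u)) * qfac q (u + 1))" unfolding Fq_def qfac_rec[of u] ..
  moreover have "exp (lq * (u * (u - 1) / 4)) = exp (- (lq * u / 2)) * exp (lq * ((u + 1) * (u + 1 - 1) / 4))"
    unfolding exp_add[symmetric] by (intro arg_cong[where f = exp]) (simp add: field_simps)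
  ultimately show "Fq u = brq u * Fq (u + 1)" unfolding brq_eq Fq_def by (simp add: mult_ac)
  show "\<exists>m. brq (u + of_nat m) = 0" if "Fq u = 0"
  proof -
    have "qpochhammer_inf (exp (lq * u)) q = 0" using that unfolding Fq_def qfac_exp by simp
    then obtain k where "exp (lq * u) * of_real q ^ k = 1" using qpochhammer_inf_zero by blast
    then have "brq (u + of_nat k) = 0" unfolding brq_eq exp_lq by simp
    then show ?thesis by blast
  qed
  show "Re u = 0" if "brq u = 0"
  proof -
    have "exp (lq * u) = 1" using that unfolding brq_eq by simp
    then have "norm (exp (lq * u)) = 1" by simp
    then show ?thesis using ln_q_neg unfolding norm_exp_eq_Re lq_def by simp
  qed
  show "brq (- u) = - brq u" unfolding brq_def by simp
next
  show "Fq holomorphic_on UNIV"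
    unfolding Fq_def qfac_exp
    by (intro holomorphic_intros holomorphic_on_compose[OF _ holomorphic_on_subset[OF qpochhammer_inf_holomorphic], unfolded o_def]) auto
next
  fix s t :: complex
  show "brq (s + t) * brq (s - t) = Yq s - Yq t"
    unfolding brq_def Yq_def by (simp add: algebra_simps exp_add[symmetric]) (simp add: field_simps)
next
  fix b1 b2 b3 b4 s :: complex
  show "brq (b1 + s) * brq (b2 + s) * brq (b3 + s) * brq (b4 + s)
    - brq (b1 - s) * brq (b2 - s) * brq (b3 - s) * brq (b4 - s)
    = brq (2 * s) * (brq (b1 + b4) * brq (b2 + b4) * brq (b3 + b4)
        - brq (b1 + b2 + b3 + b4) * (brq (b4 + s) * brq (b4 - s)))" by (rule brq_four)
next
  fix l m :: int
  show "1 \<le> weight_q l" unfolding weight_q_def using ln_q_neg by (simp add: mult_nonpos_nonneg)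
  show "weight_q (- l) = weight_q l" unfolding weight_q_def by simp
  have "- ln q * \<bar>real_of_int (l + m)\<bar> \<le> - ln q * (\<bar>real_of_int l\<bar> + \<bar>real_of_int m\<bar>)"
    using ln_q_neg by (intro mult_left_mono) auto
  then show "weight_q (l + m) \<le> weight_q l * weight_q m"
    unfolding weight_q_def exp_add[symmetric] by (simp add: algebra_simps)
  show "0 \<le> (1::real)" by simp
next
  have "weight_q (2 * l) powr (1/2) \<le> 1 * (weight_q l * 1)" for l
    unfolding weight_q_powr by (simp add: weight_q_def abs_mult)
  then show "\<exists>C. \<forall>l. weight_q (2 * l) powr (1/2) \<le> C * (weight_q l * 1)" by blast
next
  fix \<sigma> :: real assume \<sigma>: "\<sigma> > 0"
  define r where "r = exp (\<sigma> * ln q)"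
  have r: "0 < r" "r < 1" unfolding r_def using \<sigma> ln_q_neg by (simp_all add: mult_pos_neg)
  have "summable (\<lambda>n. r ^ n)" using r by (intro summable_geometric) auto
  then have s: "(\<lambda>n. r ^ n) summable_on UNIV" using r by (subst summable_on_UNIV_nonneg_real_iff) auto
  have e: "weight_q (int n) powr - \<sigma> * 1 = r ^ n" "weight_q (- int n) powr - \<sigma> * 1 = r ^ n" for n
    unfolding weight_q_powr r_def by (simp_all add: exp_of_nat_mult[symmetric] mult_ac)
  show "(\<lambda>l. weight_q l powr - \<sigma> * 1) summable_on UNIV"
    by (rule summable_on_int) (use s in \<open>simp_all only: e\<close>)
next
  fix u :: complex
  define C where "C = norm (exp (- (lq * u / 2))) + norm (exp (lq * u / 2))"
  have "norm (brq (u + of_int l)) \<le> C * weight_q l powr (1/2)" for l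
  proof -
    have n1: "norm (exp (- (lq * of_int l / 2))) = exp (- (ln q * of_int l / 2))" "norm (exp (lq * of_int l / 2)) = exp (ln q * of_int l / 2)"
      unfolding lq_def norm_exp_eq_Re by simp_all
    have le: "- (ln q * of_int l / 2) \<le> - (1/2 * ln q * \<bar>of_int l\<bar>)" "ln q * of_int l / 2 \<le> - (1/2 * ln q * \<bar>of_int l\<bar>)"
      using ln_q_neg mult_left_mono[of "of_int l" "\<bar>real_of_int l\<bar>" "- ln q"] mult_left_mono[of "- of_int l" "\<bar>real_of_int l\<bar>" "- ln q"] by auto
    have "norm (brq (u + of_int l)) \<le> norm (exp (- (lq * (u + of_int l) / 2))) + norm (exp (lq * (u + of_int l) / 2))"
      unfolding brq_def by (rule norm_triangle_ineq4)
    also have "exp (- (lq * (u + of_int l) / 2)) = exp (- (lq * u / 2)) * exp (- (lq * of_int l / 2))"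
      unfolding exp_add[symmetric] by (simp only: distrib_left add_divide_distrib minus_add_distrib)
    also have "exp (lq * (u + of_int l) / 2) = exp (lq * u / 2) * exp (lq * of_int l / 2)"
      unfolding exp_add[symmetric] by (simp only: distrib_left add_divide_distrib)
    also have "norm (exp (- (lq * u / 2)) * exp (- (lq * of_int l / 2))) + norm (exp (lq * u / 2) * exp (lq * of_int l / 2))
       \<le> norm (exp (- (lq * u / 2))) * weight_q l powr (1/2) + norm (exp (lq * u / 2)) * weight_q l powr (1/2)"
      unfolding norm_mult n1 weight_q_powr using le by (intro add_mono mult_left_mono iffD2[OF exp_le_cancel_iff]) auto
    finally show ?thesis unfolding C_def by (simp add: distrib_right)
  qed
  then show "\<exists>C. \<forall>l. norm (brq (u + of_int l)) \<le> C * weight_q l powr (1/2)" by blast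
next
  fix R :: real
  have cont: "continuous_on A (\<lambda>a. qpochhammer_inf a q)" for A
    using holomorphic_on_imp_continuous_on[OF qpochhammer_inf_holomorphic] continuous_on_subset by blast
  have "bounded ((\<lambda>a. qpochhammer_inf a q) ` cball 0 (exp (- (ln q * R))))"
    by (intro compact_imp_bounded compact_continuous_image cont) auto
  then obtain B where "\<forall>x\<in>(\<lambda>a. qpochhammer_inf a q) ` cball 0 (exp (- (ln q * R))). norm x \<le> B"
    unfolding bounded_iff by blast
  then have B: "norm (qpochhammer_inf a q) \<le> B" if "norm a \<le> exp (- (ln q * R))" for a
    using that by simp
  \<comment> \<open>The zeros of the infinite product are the points q^(-k), all of modulus at least
    1, so it is bounded away from zero on the disc of radius q, where q^v lies for Re v at least
    1.\<close>
  have "\<exists>a0\<in>cball 0 q. \<forall>a\<in>cball 0 q. norm (qpochhammer_inf a0 q) \<le> norm (qpochhammer_inf a q)"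
    using q by (intro continuous_attains_inf continuous_on_norm cont) auto
  then obtain a0 where a0: "norm a0 \<le> q" "\<And>a. norm a \<le> q \<Longrightarrow> norm (qpochhammer_inf a0 q) \<le> norm (qpochhammer_inf a q)" by auto
  define b where "b = norm (qpochhammer_inf a0 q)"
  have b: "b > 0"
  proof -
    have "a0 * of_real q ^ k \<noteq> 1" for k
    proof -
      have "norm (a0 * of_real q ^ k) \<le> q * 1" unfolding norm_mult norm_power using q a0(1) by (intro mult_mono power_le_one) auto
      then show ?thesis using q by (metis mult.right_neutral norm_one not_le)
    qed
    then show ?thesis unfolding b_def using qpochhammer_inf_zero by auto
  qed
  define E where "E = exp (- ln q * (3 * R\<^sup>2 + R))"
  have "norm (Fq (u + of_nat l + h)) \<le> (E * (B / b)) * weight_q (int l) powr (- Re h / 2) * norm (Fq (u + of_nat l))"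
    if A: "norm u \<le> R \<and> norm h \<le> R \<and> 1 \<le> Re u + real l" for u h l
  proof -
    have R: "R \<ge> 0" using A norm_ge_zero order_trans by blast
    define v where "v = u + of_nat l"
    have Rv: "Re v \<ge> 1" unfolding v_def using A by simp
    have "exp (lq * ((v + h) * (v + h - 1) / 4)) = exp (lq * ((2 * v * h + h * h - h) / 4)) * exp (lq * (v * (v - 1) / 4))"
      unfolding exp_add[symmetric] by (intro arg_cong[where f = exp]) (simp add: field_simps)
    \<comment> \<open>Only the term l h / 2 of the exponent depends on l; it yields the power of the
      weight.\<close>
    also have "exp (lq * ((2 * v * h + h * h - h) / 4)) = exp (lq * ((2 * u * h + h * h - h) / 4)) * exp (lq * of_nat l * h / 2)"
      unfolding exp_add[symmetric] v_def by (intro arg_cong[where f = exp]) (simp add: field_simps)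
    finally have e: "exp (lq * ((v + h) * (v + h - 1) / 4)) = exp (lq * ((2 * u * h + h * h - h) / 4)) * exp (lq * of_nat l * h / 2) * exp (lq * (v * (v - 1) / 4))" .
    have n1: "norm (exp (lq * ((2 * u * h + h * h - h) / 4))) \<le> E"
    proof -
      have "norm (2 * u * h + h * h - h) \<le> 2 * (norm u * norm h) + norm h * norm h + norm h"
        using norm_triangle_ineq4[of "2 * u * h + h * h" h] norm_triangle_ineq[of "2 * u * h" "h * h"] by (simp add: norm_mult)
      also have "\<dots> \<le> 2 * (R * R) + R * R + R" using A R by (intro add_mono mult_left_mono mult_mono) auto
      also have "\<dots> = 3 * R\<^sup>2 + R" by (simp add: power2_eq_square)
      finally have nb: "norm (2 * u * h + h * h - h) \<le> 3 * R\<^sup>2 + R" .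
      have "Re (lq * ((2 * u * h + h * h - h) / 4)) \<le> norm (lq * ((2 * u * h + h * h - h) / 4))" by (rule complex_Re_le_cmod)
      also have "\<dots> = - ln q * (norm (2 * u * h + h * h - h) / 4)" unfolding lq_def using ln_q_neg by (simp add: norm_mult norm_divide)
      also have "\<dots> \<le> - ln q * (3 * R\<^sup>2 + R)" using nb ln_q_neg norm_ge_zero[of "2 * u * h + h * h - h"] by (intro mult_left_mono) linarith+
      finally show ?thesis unfolding E_def norm_exp_eq_Re by simp
    qed
    have n2: "norm (exp (lq * of_nat l * h / 2)) = weight_q (int l) powr (- Re h / 2)"
      unfolding weight_q_powr norm_exp_eq_Re lq_def by (simp add: mult_ac)
    have hi: "norm (qfac q (v + h)) \<le> B"
      unfolding qfac_exp
    proof (rule B)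
      have "Re (v + h) \<ge> - R" using Rv A R abs_Re_le_cmod[of h] unfolding plus_complex.sel by linarith
      then have "ln q * Re (v + h) \<le> ln q * (- R)" using ln_q_neg by (intro mult_left_mono_neg) auto
      then show "norm (exp (lq * (v + h))) \<le> exp (- (ln q * R))" unfolding norm_exp_eq_Re lq_def by simp
    qed
    have lo: "b \<le> norm (qfac q v)"
      unfolding qfac_exp b_def
    proof (rule a0(2))
      have "ln q * Re v \<le> ln q * 1" using Rv ln_q_neg by (intro mult_left_mono_neg) auto
      then have "exp (ln q * Re v) \<le> exp (ln q)" by simp
      then show "norm (exp (lq * v)) \<le> q" unfolding norm_exp_eq_Re lq_def using q by simp
    qed
    have "norm (qfac q (v + h)) \<le> B / b * norm (qfac q v)"
    proof -
      have "B \<ge> 0" using hi norm_ge_zero order_trans by blast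
      then have "B / b * b \<le> B / b * norm (qfac q v)" using lo b by (intro mult_left_mono) auto
      then show ?thesis using hi b by simp
    qed
    then have "norm (Fq (v + h)) \<le> (E * weight_q (int l) powr (- Re h / 2) * norm (exp (lq * (v * (v - 1) / 4)))) * (B / b * norm (qfac q v))"
      unfolding Fq_def norm_mult e n2 using n1 by (intro mult_mono mult_right_mono) (auto simp: E_def)
    then show ?thesis unfolding v_def[symmetric] Fq_def[of v] norm_mult by (simp only: mult_ac)
  qed
  then show "\<exists>C. \<forall>u h. \<forall>l::nat. norm u \<le> R \<and> norm h \<le> R \<and> 1 \<le> Re u + real l \<longrightarrow>
     norm (Fq (u + of_nat l + h)) \<le> C * weight_q (int l) powr (- Re h / 2) * norm (Fq (u + of_nat l))" by blast
qed

end

section \<open>Vertical growth for q < 1 from an imaginary quasi-period\<close>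

lemma bounded_ratio_of_period:
  fixes h :: "complex \<Rightarrow> complex"
  assumes cont: "continuous_on {s. \<bar>Re s\<bar> < 2} h" and t: "t > 0" and per: "\<And>s. h (s + \<i> * of_real t) = h s"
  shows "\<exists>C. \<forall>s. \<bar>Re s\<bar> \<le> 1 \<longrightarrow> norm (h s) \<le> C"
proof -
  define K where "K = cbox (Complex (-1) 0) (Complex 1 t)"
  have K: "K = {s. \<bar>Re s\<bar> \<le> 1 \<and> 0 \<le> Im s \<and> Im s \<le> t}" unfolding K_def in_cbox_complex_iff set_eq_iff by auto
  have "continuous_on K h" by (rule continuous_on_subset[OF cont]) (auto simp: K)
  then have "bounded (h ` K)" unfolding K_def by (intro compact_imp_bounded compact_continuous_image) auto
  then obtain C where C: "\<And>s. s \<in> K \<Longrightarrow> norm (h s) \<le> C" unfolding bounded_iff by auto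
  have perk: "h (s + of_nat k * (\<i> * of_real t)) = h s" for s k
  proof (induction k)
    case (Suc k)
    have "s + of_nat (Suc k) * (\<i> * of_real t) = (s + of_nat k * (\<i> * of_real t)) + \<i> * of_real t" by (simp add: algebra_simps)
    then show ?case using per Suc by (simp only:)
  qed simp
  have peri: "h (s + of_int k * (\<i> * of_real t)) = h s" for s k
  proof (cases "k \<ge> 0")
    case True
    then obtain j where "k = int j" using nonneg_int_cases by blast
    then show ?thesis using perk[of s j] by simp
  next
    case False
    then obtain j where "k = - int j" using int_cases2 by (metis of_nat_0_le_iff)
    then show ?thesis using perk[of "s + of_int k * (\<i> * of_real t)" j] by simp
  qed
  have "norm (h s) \<le> C" if "\<bar>Re s\<bar> \<le> 1" for s
  proof -
    define k where "k = - \<lfloor>Im s / t\<rfloor>"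
    have "of_int \<lfloor>Im s / t\<rfloor> * t \<le> Im s" "Im s < (of_int \<lfloor>Im s / t\<rfloor> + 1) * t"
      using floor_divide_lower[OF t] floor_divide_upper[OF t] by blast+
    then have "s + of_int k * (\<i> * of_real t) \<in> K" using that unfolding K k_def by (simp add: algebra_simps)
    then show ?thesis using C peri[of s k] by metis
  qed
  then show ?thesis by blast
qed

context
  fixes q :: real
  assumes q: "0 < q" "q < 1"
begin

interpretation Q: gamma_like "Fq q" "brq q" "Yq q" "weight_q q" "\<lambda>_. 1"
  by (rule gamma_like_Fq[OF q])

definition period :: real where "period = 2 * pi / (- ln q)"

lemma period_pos: "period > 0"
  unfolding period_def using q by (intro divide_pos_pos) auto

lemma lq_period: "lq q * (\<i> * of_real period) = - (2 * of_real pi * \<i>)"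
  unfolding lq_def[OF q] period_def using q by (simp add: field_simps)

lemma Fq_period: "Fq q (u + \<i> * of_real period) =
  exp (lq q * (2 * (\<i> * of_real period) * u + (\<i> * of_real period)\<^sup>2 - \<i> * of_real period) / 4) * Fq q u"
proof -
  define p where "p = \<i> * complex_of_real period"
  have "exp (lq q * (u + p)) = exp (lq q * u) * exp (lq q * p)" by (simp add: distrib_left exp_add)
  also have "exp (lq q * p) = 1" unfolding p_def lq_period by (simp add: exp_minus)
  finally have "qfac q (u + p) = qfac q u" unfolding qfac_exp[OF q] by simp
  moreover have "exp (lq q * ((u + p) * (u + p - 1) / 4)) = exp (lq q * (2 * p * u + p\<^sup>2 - p) / 4) * exp (lq q * (u * (u - 1) / 4))"
    unfolding exp_add[symmetric] by (intro arg_cong[where f = exp]) (simp add: field_simps power2_eq_square)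
  ultimately show ?thesis unfolding Fq_def[OF q] p_def by (simp add: mult_ac)
qed

text \<open>A translation by the imaginary period multiplies \<open>Fq\<close> by the exponential of
  an affine function. Moving two arguments up and two down leaves a multiplier that depends only on
  the difference of their sums.\<close>

lemma Fq_period_four:
  defines "p \<equiv> \<i> * of_real period"
  shows "Fq q (u1 + p) * Fq q (u2 + p) * (Fq q (v1 - p) * Fq q (v2 - p)) =
    exp (lq q * p * (u1 + u2 - v1 - v2 + 2 * p) / 2) * (Fq q u1 * Fq q u2 * (Fq q v1 * Fq q v2))"
proof -
  define M where "M u = exp (lq q * (2 * p * u + p\<^sup>2 - p) / 4)" for u
  have up: "Fq q (u + p) = M u * Fq q u" for u unfolding M_def p_def by (rule Fq_period)
  have down: "Fq q v = M (v - p) * Fq q (v - p)" for v using up[of "v - p"] by simp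
  have "exp (lq q * p * (u1 + u2 - v1 - v2 + 2 * p) / 2) * (M (v1 - p) * M (v2 - p)) = M u1 * M u2"
    unfolding M_def exp_add[symmetric] by (intro arg_cong[where f = exp]) (simp add: field_simps power2_eq_square)
  then show ?thesis unfolding up[of u1] up[of u2] down[of v1] down[of v2] by (simp add: mult_ac)
qed

text \<open>Under the imaginary period the sum and the product acquire the same multiplier
  \<open>\<mu>\<close>, so their quotient is periodic. It is then bounded by its maximum over one
  compact rectangle, which is growth with exponent 0.\<close>

lemma gamma_like_growth_Fq: "gamma_like_growth (Fq q) (brq q) (Yq q) (weight_q q) (\<lambda>_. 1)"
proof (intro gamma_like_growth.intro gamma_like_Fq q gamma_like_growth_axioms.intro)
  fix n g z a b c d
  assume adm: "Q.admissible n z" and gen: "Q.generic n g z" and n: "n \<ge> 1" and reg: "Q.region n g (a - 2) (b - 2) c d"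
  define p where "p = \<i> * complex_of_real period"
  define \<mu> where "\<mu> s = exp (lq q * p * ((a + s) - (b - s) + p)) ^ n" for s
  have \<mu>0: "\<mu> s \<noteq> 0" for s unfolding \<mu>_def by simp
  \<comment> \<open>The multiplier is free of x; hence it is the same for all terms of the series
    and can be taken out of the sum.\<close>
  have WW: "Q.W (A + p) x * Q.W (B - p) x = exp (lq q * p * (A - B + p)) * (Q.W A x * Q.W B x)" for A B x
  proof -
    have "Q.W (A + p) x * Q.W (B - p) x = Fq q ((1 + A + x) + p) * Fq q ((1 + A - x) + p) * (Fq q ((1 + B + x) - p) * Fq q ((1 + B - x) - p))"
      unfolding Q.W_def by (simp add: algebra_simps)
    also have "\<dots> = exp (lq q * p * ((1 + A + x) + (1 + A - x) - (1 + B + x) - (1 + B - x) + 2 * p) / 2) * (Q.W A x * Q.W B x)"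
      unfolding p_def Fq_period_four Q.W_def ..
    also have "lq q * p * ((1 + A + x) + (1 + A - x) - (1 + B + x) - (1 + B - x) + 2 * p) / 2 = lq q * p * (A - B + p)"
      by (simp add: field_simps)
    finally show ?thesis .
  qed
  have S_per: "Q.S n g (a + (s + p)) (b - (s + p)) c d z = \<mu> s * Q.S n g (a + s) (b - s) c d z" for s
  proof -
    have sg: "Q.sg (a + (s + p)) (b - (s + p)) c d x = exp (lq q * p * ((a + s) - (b - s) + p)) * Q.sg (a + s) (b - s) c d x" for x
      using WW[of "a + s" x "b - s"] unfolding Q.sg_def by (simp add: algebra_simps)
    have "Q.Phi n g (a + (s + p)) (b - (s + p)) c d x = \<mu> s * Q.Phi n g (a + s) (b - s) c d x" for x
      unfolding Q.Phi_def sg \<mu>_def by (simp add: prod.distrib mult_ac)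
    then show ?thesis unfolding Q.S_def by (simp add: infsum_cmult_right')
  qed
  have R_per: "Q.R n g (a + (s + p)) (b - (s + p)) c d = \<mu> s * Q.R n g (a + s) (b - s) c d" for s
  proof -
    define A B where "A = a + s" and "B = b - s"
    have e: "a + (s + p) = A + p" "b - (s + p) = B - p" unfolding A_def B_def by simp_all
    have t: "Fq q (1 + of_nat i * g + (A + p) + (B - p)) * Fq q (1 + of_nat i * g + (A + p) + c) * Fq q (1 + of_nat i * g + (A + p) + d) *
            Fq q (1 + of_nat i * g + (B - p) + c) * Fq q (1 + of_nat i * g + (B - p) + d) * Fq q (1 + of_nat i * g + c + d) /
            Fq q (1 + (of_nat n - 1 + of_nat i) * g + (A + p) + (B - p) + c + d) =
      exp (lq q * p * (A - B + p)) * (Fq q (1 + of_nat i * g + A + B) * Fq q (1 + of_nat i * g + A + c) * Fq q (1 + of_nat i * g + A + d) *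
            Fq q (1 + of_nat i * g + B + c) * Fq q (1 + of_nat i * g + B + d) * Fq q (1 + of_nat i * g + c + d) /
            Fq q (1 + (of_nat n - 1 + of_nat i) * g + A + B + c + d))" for i :: nat
    proof -
      define u1 u2 v1 v2 where "u1 = 1 + of_nat i * g + A + c" and "u2 = 1 + of_nat i * g + A + d"
        and "v1 = 1 + of_nat i * g + B + c" and "v2 = 1 + of_nat i * g + B + d"
      have h: "1 + of_nat i * g + (A + p) + c = u1 + p" "1 + of_nat i * g + (A + p) + d = u2 + p"
         "1 + of_nat i * g + (B - p) + c = v1 - p" "1 + of_nat i * g + (B - p) + d = v2 - p"
         "1 + of_nat i * g + (A + p) + (B - p) = 1 + of_nat i * g + A + B"
         "1 + (of_nat n - 1 + of_nat i) * g + (A + p) + (B - p) + c + d = 1 + (of_nat n - 1 + of_nat i) * g + A + B + c + d"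
        unfolding u1_def u2_def v1_def v2_def by (simp_all add: algebra_simps)
      have "lq q * p * (u1 + u2 - v1 - v2 + 2 * p) / 2 = lq q * p * (A - B + p)"
        unfolding u1_def u2_def v1_def v2_def by (simp add: field_simps)
      then have "Fq q (u1 + p) * Fq q (u2 + p) * (Fq q (v1 - p) * Fq q (v2 - p)) =
        exp (lq q * p * (A - B + p)) * (Fq q u1 * Fq q u2 * (Fq q v1 * Fq q v2))"
        by (simp only: Fq_period_four[folded p_def])
      moreover have "x * y1 * y2 * y3 * y4 * w / r = e * (x * z1 * z2 * z3 * z4 * w / r)"
        if "y1 * y2 * (y3 * y4) = e * (z1 * z2 * (z3 * z4))" for x y1 y2 y3 y4 z1 z2 z3 z4 w r e :: complex
      proof -
        have "x * y1 * y2 * y3 * y4 * w / r = y1 * y2 * (y3 * y4) * (x * w / r)" by (simp add: mult_ac)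
        then show ?thesis unfolding that by (simp add: mult_ac)
      qed
      ultimately show ?thesis unfolding h u1_def[symmetric] u2_def[symmetric] v1_def[symmetric] v2_def[symmetric] by blast
    qed
    show ?thesis
      unfolding e unfolding Q.R_def t \<mu>_def A_def[symmetric] B_def[symmetric]
        prod.distrib[of "\<lambda>_. exp (lq q * p * (A - B + p))"] prod_constant card_lessThan by (rule mult.left_commute)
  qed
  define h where "h s = Q.S n g (a + s) (b - s) c d z / Q.R n g (a + s) (b - s) c d" for s
  have regs: "Q.region n g (a + s) (b - s) c d" if "\<bar>Re s\<bar> < 2" for s
    using reg that unfolding Q.region_def by auto
  have "h holomorphic_on {s. \<bar>Re s\<bar> < 2}"
  proof -
    have "open {s. \<bar>Re s\<bar> < 2}" by (intro open_Collect_less continuous_intros)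
    moreover have "Q.decay n g ((a + s) + (b - s) + c + d) > 0" if "\<bar>Re s\<bar> < 2" for s
      using Q.decay_region[OF regs[OF that]] by simp
    moreover have "Fq q (1 + g) \<noteq> 0" using gen n unfolding Q.generic_def by force
    ultimately show ?thesis
      unfolding h_def using Q.R_region_nonzero[OF gen regs]
      by (intro holomorphic_on_divide Q.S_holomorphic[OF adm] Q.R_holomorphic holomorphic_intros) auto
  qed
  then have cont: "continuous_on {s. \<bar>Re s\<bar> < 2} h" by (rule holomorphic_on_imp_continuous_on)
  have "h (s + \<i> * of_real period) = h s" for s
    unfolding h_def p_def[symmetric] S_per R_per using \<mu>0[of s] by simp
  from bounded_ratio_of_period[OF cont period_pos this]
  obtain C where C: "\<And>s. \<bar>Re s\<bar> \<le> 1 \<Longrightarrow> norm (h s) \<le> C" by blast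
  have "norm (Q.S n g (a + s) (b - s) c d z) \<le> C * (1 + \<bar>Im s\<bar>) ^ 0 * norm (Q.R n g (a + s) (b - s) c d)" if "\<bar>Re s\<bar> \<le> 1" for s
    using C[OF that] Q.R_region_nonzero[OF gen regs, of s] that unfolding h_def by (simp add: norm_divide field_simps)
  then show "\<exists>C m y0. \<forall>s. \<bar>Re s\<bar> \<le> 1 \<longrightarrow> y0 \<le> \<bar>Im s\<bar> \<longrightarrow>
      norm (Q.S n g (a + s) (b - s) c d z) \<le> C * (1 + \<bar>Im s\<bar>) ^ m * norm (Q.R n g (a + s) (b - s) c d)" by blast
qed

end

section \<open>Removal of the Gaussian factor and of the genericity of g\<close>

definition reflected :: "(complex \<Rightarrow> complex) \<Rightarrow> complex \<Rightarrow> complex \<Rightarrow> complex" where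
  "reflected F c u = F (1 + c + u) * F (1 + c - u)"

text \<open>The summand \<open>Phi\<close> freed from the locale, so that it can also be formed with
  the bare q-Pochhammer symbol, whose recurrence factor is not odd.\<close>

definition term_of :: "(complex \<Rightarrow> complex) \<Rightarrow> nat \<Rightarrow> complex \<Rightarrow> complex \<Rightarrow> complex \<Rightarrow> complex \<Rightarrow> complex \<Rightarrow> (nat \<Rightarrow> complex) \<Rightarrow> complex" where
  "term_of F n g a b c d x =
    (\<Prod>j\<in>{1..n}. \<Prod>k\<in>{j+1..n}. reflected F g (x j + x k) * reflected F g (x j - x k) /
        (reflected F 0 (x j + x k) * reflected F 0 (x j - x k))) *
    (\<Prod>j\<in>{1..n}. reflected F a (x j) * reflected F b (x j) * reflected F c (x j) * reflected F d (x j) / reflected F 0 (2 * x j))"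

lemma (in gamma_like) Phi_eq_term_of: "Phi n g a b c d x = term_of F n g a b c d x"
  unfolding Phi_def pr_def sg_def W_def term_of_def reflected_def ..

text \<open>What remains of all Gaussian factors: a constant that does not involve the summation
  variable.\<close>

definition gauge :: "complex \<Rightarrow> nat \<Rightarrow> complex \<Rightarrow> complex \<Rightarrow> complex \<Rightarrow> complex \<Rightarrow> complex \<Rightarrow> complex" where
  "gauge L n g a b c d = (\<Prod>j\<in>{1..n}. exp (L * (g\<^sup>2 + g)) ^ (n - j) *
      exp (L * ((a\<^sup>2 + b\<^sup>2 + c\<^sup>2 + d\<^sup>2) + (a + b + c + d)) / 2))"

lemma gauge_nonzero: "gauge L n g a b c d \<noteq> 0"
  unfolding gauge_def by simp

text \<open>Each reflected product acquires a factor E c V u with V Gaussian in u. The factors V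
  cancel, in the pairs by matching arguments and in the single factors because V (2u) is the fourth
  power of V u.\<close>

lemma term_of_gauge:
  assumes "\<And>u. F u = exp (L * (u * (u - 1) / 4)) * F0 u"
  shows "term_of F n g a b c d x = gauge L n g a b c d * term_of F0 n g a b c d x"
proof -
  define E where "E c = exp (L * (c\<^sup>2 + c) / 2)" for c
  define V where "V u = exp (L * u\<^sup>2 / 2)" for u
  have VE: "V u \<noteq> 0" "E u \<noteq> 0" "E 0 = 1" for u unfolding V_def E_def by simp_all
  have r: "reflected F c u = E c * V u * reflected F0 c u" for c u
  proof -
    have "E c * V u = exp (L * ((1 + c + u) * (1 + c + u - 1) / 4)) * exp (L * ((1 + c - u) * (1 + c - u - 1) / 4))"
      unfolding E_def V_def exp_add[symmetric]
      by (intro arg_cong[where f = exp]) (simp add: field_simps power2_eq_square)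
    then show ?thesis unfolding reflected_def assms by (simp add: mult_ac)
  qed
  have V4: "V (2 * u) = V u * V u * V u * V u" for u
    unfolding V_def exp_add[symmetric] by (intro arg_cong[where f = exp]) (simp add: field_simps power2_eq_square)
  have e: "exp (L * (g\<^sup>2 + g)) = E g * E g"
    unfolding E_def exp_add[symmetric] by (intro arg_cong[where f = exp]) (simp add: field_simps)
  have p: "reflected F g s * reflected F g t / (reflected F 0 s * reflected F 0 t) =
      exp (L * (g\<^sup>2 + g)) * (reflected F0 g s * reflected F0 g t / (reflected F0 0 s * reflected F0 0 t))" for s t
    unfolding r e using VE by simp
  have s: "reflected F a u * reflected F b u * reflected F c u * reflected F d u / reflected F 0 (2 * u) =
      E a * E b * E c * E d * (reflected F0 a u * reflected F0 b u * reflected F0 c u * reflected F0 d u / reflected F0 0 (2 * u))" for u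
    unfolding r V4 using VE by simp
  have e4: "exp (L * ((a\<^sup>2 + b\<^sup>2 + c\<^sup>2 + d\<^sup>2) + (a + b + c + d)) / 2) = E a * E b * E c * E d"
    unfolding E_def exp_add[symmetric] by (intro arg_cong[where f = exp]) (simp add: field_simps)
  show ?thesis
    unfolding term_of_def gauge_def p s e4 prod.distrib[of "\<lambda>_. exp (L * (g\<^sup>2 + g))"] prod.distrib prod_constant card_atLeastAtMost
    by (simp add: mult_ac)
qed

text \<open>The passage to the dual parameters is orthogonal, so their squares add up to those of a,
  b, c, d. The quadratic terms in x j cancel, and the linear term x j, at the components of
  \<open>rhohat\<close>, supplies the contributions of g and of (a + b + c + d) / 2. Hence the
  constant is the one of \<open>term_of_gauge\<close>.\<close>

lemma quot_gauge:
  assumes F: "\<And>u. F u = exp (L * (u * (u - 1) / 4)) * F0 u"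
    and h: "h1 = (a + b + c + d) / 2" "h2 = (a + b - c - d) / 2" "h3 = (a - b + c - d) / 2" "h4 = (a - b - c + d) / 2"
    and x: "\<And>j. j \<in> {1..n} \<Longrightarrow> x j = of_nat (n - j) * g + h1"
  shows "quot F n g h1 h2 h3 h4 x = gauge L n g a b c d * quot F0 n g h1 h2 h3 h4 x"
proof -
  define E where "E c = exp (L * c\<^sup>2 / 2)" for c
  define V where "V u = exp (L * (u * (u - 1) / 4))" for u
  have V: "V u \<noteq> 0" for u unfolding V_def by simp
  have Fm: "F (1 - c + u) * F (1 + c + u) = E c * (V (1 + u) * V (1 + u)) * (F0 (1 - c + u) * F0 (1 + c + u))" for c u
  proof -
    have "E c * (V (1 + u) * V (1 + u)) = V (1 - c + u) * V (1 + c + u)"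
      unfolding E_def V_def exp_add[symmetric] by (intro arg_cong[where f = exp]) (simp add: field_simps power2_eq_square)
    then show ?thesis unfolding F V_def[symmetric] by (simp add: mult_ac)
  qed
  have p: "F (1 - g + s + t) * F (1 - g + s - t) * F (1 + g + s + t) * F (1 + g + s - t) / (F (1 + s + t) * F (1 + s - t))\<^sup>2 =
     exp (L * g\<^sup>2) * (F0 (1 - g + s + t) * F0 (1 - g + s - t) * F0 (1 + g + s + t) * F0 (1 + g + s - t) / (F0 (1 + s + t) * F0 (1 + s - t))\<^sup>2)" for s t
  proof -
    have "F (1 - g + s + t) * F (1 - g + s - t) * F (1 + g + s + t) * F (1 + g + s - t) =
        (F (1 - g + (s + t)) * F (1 + g + (s + t))) * (F (1 - g + (s - t)) * F (1 + g + (s - t)))"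
      by (simp add: algebra_simps)
    also have "\<dots> = E g * E g * (V (1 + s + t) * V (1 + s - t))\<^sup>2 *
        (F0 (1 - g + s + t) * F0 (1 - g + s - t) * F0 (1 + g + s + t) * F0 (1 + g + s - t))"
      unfolding Fm by (simp add: algebra_simps power2_eq_square)
    also have "E g * E g = exp (L * g\<^sup>2)" unfolding E_def exp_add[symmetric] by simp
    finally show ?thesis unfolding F[of "1 + s + t"] F[of "1 + s - t"] V_def[symmetric]
      using V[of "1 + s + t"] V[of "1 + s - t"] by (simp add: power_mult_distrib)
  qed
  have s: "F (1 - h1 + u) * F (1 - h2 + u) * F (1 - h3 + u) * F (1 - h4 + u) *
         F (1 + h1 + u) * F (1 + h2 + u) * F (1 + h3 + u) * F (1 + h4 + u) / (F (1 + 2 * u))\<^sup>2 =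
      exp (L * ((a\<^sup>2 + b\<^sup>2 + c\<^sup>2 + d\<^sup>2) / 2 + u)) *
      (F0 (1 - h1 + u) * F0 (1 - h2 + u) * F0 (1 - h3 + u) * F0 (1 - h4 + u) *
         F0 (1 + h1 + u) * F0 (1 + h2 + u) * F0 (1 + h3 + u) * F0 (1 + h4 + u) / (F0 (1 + 2 * u))\<^sup>2)" for u
  proof -
    define P where "P G = G (1 - h1 + u) * G (1 - h2 + u) * G (1 - h3 + u) * G (1 - h4 + u) *
         G (1 + h1 + u) * G (1 + h2 + u) * G (1 + h3 + u) * G (1 + h4 + u)" for G :: "complex \<Rightarrow> complex"
    have P: "P G = (G (1 - h1 + u) * G (1 + h1 + u)) * (G (1 - h2 + u) * G (1 + h2 + u)) *
       (G (1 - h3 + u) * G (1 + h3 + u)) * (G (1 - h4 + u) * G (1 + h4 + u))" for G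
      unfolding P_def by (simp only: mult_ac)
    have "P F = E h1 * E h2 * E h3 * E h4 * V (1 + u) ^ 8 * P F0"
      unfolding P Fm by (simp add: mult_ac power_numeral_reduce)
    also have "E h1 * E h2 * E h3 * E h4 * V (1 + u) ^ 8 = exp (L * ((a\<^sup>2 + b\<^sup>2 + c\<^sup>2 + d\<^sup>2) / 2 + u)) * (V (1 + 2 * u))\<^sup>2"
      unfolding E_def V_def exp_of_nat_mult[symmetric] exp_add[symmetric] h
      by (intro arg_cong[where f = exp]) (simp add: field_simps power2_eq_square)
    finally have "P F = exp (L * ((a\<^sup>2 + b\<^sup>2 + c\<^sup>2 + d\<^sup>2) / 2 + u)) * (V (1 + 2 * u))\<^sup>2 * P F0" .
    then show ?thesis unfolding P_def[symmetric] F[of "1 + 2 * u"] V_def[symmetric]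
      using V[of "1 + 2 * u"] by (simp add: power_mult_distrib)
  qed
  have "gauge L n g a b c d = (\<Prod>j\<in>{1..n}. exp (L * g\<^sup>2) ^ (n - j) * exp (L * ((a\<^sup>2 + b\<^sup>2 + c\<^sup>2 + d\<^sup>2) / 2 + x j)))"
    unfolding gauge_def
  proof (intro prod.cong refl)
    fix j assume "j \<in> {1..n}"
    show "exp (L * (g\<^sup>2 + g)) ^ (n - j) * exp (L * ((a\<^sup>2 + b\<^sup>2 + c\<^sup>2 + d\<^sup>2) + (a + b + c + d)) / 2) =
        exp (L * g\<^sup>2) ^ (n - j) * exp (L * ((a\<^sup>2 + b\<^sup>2 + c\<^sup>2 + d\<^sup>2) / 2 + x j))"
      unfolding x[OF \<open>j \<in> {1..n}\<close>] h(1) exp_of_nat_mult[symmetric] exp_add[symmetric]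
      by (intro arg_cong[where f = exp]) (simp add: field_simps)
  qed
  then show ?thesis
    unfolding quot_def p s prod.distrib[of "\<lambda>_. exp (L * g\<^sup>2)"] prod.distrib prod_constant card_atLeastAtMost
    by (simp add: mult_ac)
qed

text \<open>Near g, but off g, all values are generic, so \<open>S_eq_R\<close> and
  \<open>quot_eq_R\<close> identify the sum with the quotient. The sum is continuous in g and hence
  is the limit of the quotient, also where the quotient at g itself has a removable
  singularity.\<close>

lemma (in gamma_like_growth) sum_term_of:
  assumes F0: "\<And>u. F u = exp (L * (u * (u - 1) / 4)) * F0 u"
    and adm: "admissible n z" and dec: "decay n g (a + b + c + d) > 0"
    and h: "h1 = (a + b + c + d) / 2" "h2 = (a + b - c - d) / 2" "h3 = (a - b + c - d) / 2" "h4 = (a - b - c + d) / 2"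
  defines "x \<equiv> \<lambda>g j. of_nat (n - j) * g + h1"
  defines "T \<equiv> \<lambda>g. \<Sum>\<^sub>\<infinity>l\<in>int_vectors n. term_of F0 n g a b c d (shifted z l)"
  shows "(\<lambda>l. norm (term_of F0 n g a b c d (shifted z l))) summable_on int_vectors n"
    and "((\<lambda>g. quot F0 n g h1 h2 h3 h4 (x g)) \<longlongrightarrow> T g) (at g)"
    and "(\<And>j k. j \<in> {1..n} \<Longrightarrow> k \<in> {j+1..n} \<Longrightarrow> F0 (1 + (x g j + x g k)) \<noteq> 0 \<and> F0 (1 + (x g j - x g k)) \<noteq> 0) \<Longrightarrow>
      (\<And>j. j \<in> {1..n} \<Longrightarrow> F0 (1 + 2 * x g j) \<noteq> 0) \<Longrightarrow> T g = quot F0 n g h1 h2 h3 h4 (x g)"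
proof -
  define K where "K g = gauge L n g a b c d" for g
  have K: "K g \<noteq> 0" for g unfolding K_def by (rule gauge_nonzero)
  have t: "term_of F0 n g a b c d y = inverse (K g) * Phi n g a b c d y" for g y
    unfolding Phi_eq_term_of term_of_gauge[OF F0] K_def using gauge_nonzero by simp
  show "(\<lambda>l. norm (term_of F0 n g a b c d (shifted z l))) summable_on int_vectors n"
    unfolding t norm_mult by (rule summable_on_cmult_right[OF Phi_abs_summable[OF adm dec]])
  have T: "T g = inverse (K g) * S n g a b c d z" for g
    unfolding T_def t S_def by (rule infsum_cmult_right')
  have "\<forall>\<^sub>F g in at g. T g = quot F0 n g h1 h2 h3 h4 (x g)"
    using eventually_generic[OF adm, of g] eventually_decay[OF dec]
  proof eventually_elim
    case (elim g)
    have "S n g a b c d z = quot F n g h1 h2 h3 h4 (x g)"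
      unfolding S_eq_R[OF adm elim] by (rule quot_eq_R[symmetric, OF _ elim(2) h]) (use elim(1) in \<open>auto simp: generic_def x_def\<close>)
    also have "\<dots> = K g * quot F0 n g h1 h2 h3 h4 (x g)"
      unfolding K_def by (rule quot_gauge[OF F0 h]) (simp add: x_def)
    finally show ?case unfolding T using K by simp
  qed
  moreover have "(T \<longlongrightarrow> T g) (at g)"
    unfolding T[abs_def]
  proof (intro tendsto_intros S_tendsto adm dec K)
    show "(K \<longlongrightarrow> K g) (at g)" unfolding K_def gauge_def by (intro tendsto_intros) simp_all
  qed
  ultimately show lim: "((\<lambda>g. quot F0 n g h1 h2 h3 h4 (x g)) \<longlongrightarrow> T g) (at g)"
    by (rule Lim_transform_eventually[rotated])
  have F0_tendsto: "((\<lambda>s. F0 (f s)) \<longlongrightarrow> F0 l) A" if "(f \<longlongrightarrow> l) A" for f :: "complex \<Rightarrow> complex" and l A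
  proof -
    have "F0 = (\<lambda>u. exp (- (L * (u * (u - 1) / 4))) * F u)" unfolding F0 by (simp add: exp_minus fun_eq_iff)
    moreover have "continuous_on UNIV (\<lambda>u. exp (- (L * (u * (u - 1) / 4))) * F u)" by (intro continuous_intros) simp
    ultimately have "continuous_on UNIV F0" by (simp only:)
    then show ?thesis using that by (simp add: continuous_on_eq_continuous_at isCont_tendsto_compose)
  qed
  \<comment> \<open>With nonzero denominators at g the quotient is continuous there, and uniqueness
    of limits gives the equality at g itself.\<close>
  assume nz: "\<And>j k. j \<in> {1..n} \<Longrightarrow> k \<in> {j+1..n} \<Longrightarrow> F0 (1 + (x g j + x g k)) \<noteq> 0 \<and> F0 (1 + (x g j - x g k)) \<noteq> 0"
    "\<And>j. j \<in> {1..n} \<Longrightarrow> F0 (1 + 2 * x g j) \<noteq> 0"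
  have xt: "((\<lambda>g. x g j) \<longlongrightarrow> x g j) (at g)" for j unfolding x_def by (intro tendsto_intros)
  have "((\<lambda>g. quot F0 n g h1 h2 h3 h4 (x g)) \<longlongrightarrow> quot F0 n g h1 h2 h3 h4 (x g)) (at g)"
    unfolding quot_def
  proof (intro tendsto_intros F0_tendsto xt)
  qed (use nz in \<open>auto simp: add.assoc add_diff_eq\<close>)
  with lim show "T g = quot F0 n g h1 h2 h3 h4 (x g)" by (intro tendsto_unique) auto
qed

section \<open>Translation into the C-functions of the theorem\<close>

definition cfac :: "real \<Rightarrow> complex \<Rightarrow> complex" where
  "cfac q = (if q = 1 then rGamma else qfac q)"

lemma Gamma_eq_inverse_rGamma: "Gamma u = inverse (rGamma u :: complex)"
  by (simp add: rGamma_inverse_Gamma)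

text \<open>In terms of reciprocals the formula for q = 1 is the one for q < 1. It holds without
  exception because \<open>Gamma\<close> at a pole and the inverse of 0 are both 0.\<close>

lemma Cplus_eq:
  "Cplus q n g gs x =
    (\<Prod>j\<in>{1..n}. \<Prod>k\<in>{j+1..n}. (cfac q (1 + x j + x k) * cfac q (1 + x j - x k)) /
         (cfac q (1 + g + x j + x k) * cfac q (1 + g + x j - x k))) *
    (\<Prod>j\<in>{1..n}. cfac q (1 + 2 * x j) / (\<Prod>r\<in>{1..4}. cfac q (1 + gs r + x j)))"
  unfolding Cplus_def cfac_def Gamma_eq_inverse_rGamma
  by (auto simp: divide_inverse mult_ac prod_inversef[unfolded comp_def] intro!: arg_cong2[where f = "(*)"] prod.cong)

lemma Cminus_eq:
  "Cminus q n g gs x =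
    (\<Prod>j\<in>{1..n}. \<Prod>k\<in>{j+1..n}. (cfac q (1 - g + x j + x k) * cfac q (1 - g + x j - x k)) /
         (cfac q (1 + x j + x k) * cfac q (1 + x j - x k))) *
    (\<Prod>j\<in>{1..n}. (\<Prod>r\<in>{1..4}. cfac q (1 - gs r + x j)) / cfac q (1 + 2 * x j))"
  unfolding Cminus_def cfac_def Gamma_eq_inverse_rGamma
  by (auto simp: divide_inverse mult_ac prod_inversef[unfolded comp_def] intro!: arg_cong2[where f = "(*)"] prod.cong)

context
  fixes a b c d :: nat
  assumes dist: "distinct [a, b, c, d]" and perm: "{a, b, c, d} = {1, 2, 3, 4}"
begin

lemma index_set: "{1..4} = {a, b, c, d}"
  unfolding perm by auto

lemma prod_four: "(\<Prod>r\<in>{1..4}. f r) = f a * f b * f c * f d" for f :: "nat \<Rightarrow> complex"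
  unfolding index_set using dist by (simp add: mult_ac)

lemma sum_four: "gs 1 + gs 2 + gs 3 + gs 4 = gs a + gs b + gs c + gs d" for gs :: "nat \<Rightarrow> complex"
proof -
  have "sum gs {1, 2, 3, 4} = sum gs {a, b, c, d}" unfolding perm ..
  then show ?thesis using dist by (simp add: add_ac)
qed

text \<open>Opposite arguments pair the symbols into reflected products. Inversion is multiplicative
  and involutive also at 0, so the equality persists where factors vanish.\<close>

lemma lhs_term_eq:
  "lhs_term q n g gs z l = term_of (cfac q) n g (gs a) (gs b) (gs c) (gs d) (\<lambda>j. z j + of_int (l j))"
proof -
  define x where "x j = z j + of_int (l j)" for j
  have m: "- z j - of_int (l j) = - x j" for j unfolding x_def by simp
  have p: "(cfac q (1 + s + t) * cfac q (1 + s - t)) / (cfac q (1 + g + s + t) * cfac q (1 + g + s - t)) *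
      ((cfac q (1 + - s + - t) * cfac q (1 + - s - - t)) / (cfac q (1 + g + - s + - t) * cfac q (1 + g + - s - - t))) =
      inverse (reflected (cfac q) g (s + t) * reflected (cfac q) g (s - t) / (reflected (cfac q) 0 (s + t) * reflected (cfac q) 0 (s - t)))" for s t
    unfolding reflected_def by (simp add: algebra_simps)
  have s: "cfac q (1 + 2 * s) / (cfac q (1 + gs a + s) * cfac q (1 + gs b + s) * cfac q (1 + gs c + s) * cfac q (1 + gs d + s)) *
     (cfac q (1 + 2 * - s) / (cfac q (1 + gs a + - s) * cfac q (1 + gs b + - s) * cfac q (1 + gs c + - s) * cfac q (1 + gs d + - s))) =
     inverse (reflected (cfac q) (gs a) s * reflected (cfac q) (gs b) s * reflected (cfac q) (gs c) s * reflected (cfac q) (gs d) s / reflected (cfac q) 0 (2 * s))" for s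
    unfolding reflected_def by (simp add: mult_ac)
  have "Cplus q n g gs x * Cplus q n g gs (\<lambda>j. - x j) = inverse (term_of (cfac q) n g (gs a) (gs b) (gs c) (gs d) x)"
  proof -
    have regroup: "(A * B) * (C * D) = (A * C) * (B * D)" for A B C D :: complex by (simp add: mult_ac)
    then show ?thesis
      unfolding Cplus_eq prod_four term_of_def inverse_mult_distrib prod_inversef[symmetric] comp_def
      by (subst regroup) (simp only: prod.distrib[symmetric] p s)
  qed
  then show ?thesis unfolding lhs_term_def m x_def[symmetric] by (simp add: divide_inverse)
qed

lemma rhs_quotient_eq:
  "rhs_quotient q n a b c d gs g = quot (cfac q) n g ((gs a + gs b + gs c + gs d) / 2) ((gs a + gs b - gs c - gs d) / 2)
    ((gs a - gs b + gs c - gs d) / 2) ((gs a - gs b - gs c + gs d) / 2) (\<lambda>j. of_nat (n - j) * g + (gs a + gs b + gs c + gs d) / 2)"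
proof -
  define h where "h = ghat a b c d gs"
  have h: "h a = (gs a + gs b + gs c + gs d) / 2" "h b = (gs a + gs b - gs c - gs d) / 2"
    "h c = (gs a - gs b + gs c - gs d) / 2" "h d = (gs a - gs b - gs c + gs d) / 2"
    unfolding h_def ghat_def using dist by auto
  have r: "rhohat n g (h a) = (\<lambda>j. of_nat (n - j) * g + h a)" unfolding rhohat_def by auto
  have "A * B / (C * D) = (A / C) * (B / D)" for A B C D :: complex by simp
  then show ?thesis
    unfolding rhs_quotient_def Let_def h_def[symmetric] r unfolding h[symmetric] Cplus_eq Cminus_eq prod_four quot_def
    by (simp only: prod_dividef[symmetric]) (simp add: power2_eq_square mult_ac)
qed

lemma rhohat_eq: "rhohat n g (ghat a b c d gs a) = (\<lambda>j. of_nat (n - j) * g + (gs a + gs b + gs c + gs d) / 2)"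
  unfolding rhohat_def ghat_def by auto

end

lemma quotient_defined_iff:
  "quotient_defined q n x \<longleftrightarrow>
    (\<forall>j\<in>{1..n}. \<forall>k\<in>{j+1..n}. cfac q (1 + (x j + x k)) \<noteq> 0 \<and> cfac q (1 + (x j - x k)) \<noteq> 0) \<and>
    (\<forall>j\<in>{1..n}. cfac q (1 + 2 * x j) \<noteq> 0)"
  unfolding quotient_defined_def cfac_def by (simp add: rGamma_eq_zero_iff)

lemma brq_nonzero:
  assumes q: "0 < q" "q < 1" and u: "u \<notin> Omega q"
  shows "brq q (u + of_int l) \<noteq> 0"
proof
  assume "brq q (u + of_int l) = 0"
  then have "exp (of_real (ln q) * (u + of_int l)) = 1" unfolding brq_eq[OF q] lq_def[OF q] by simp
  then obtain m :: int where "Re (of_real (ln q) * (u + of_int l)) = 0" "Im (of_real (ln q) * (u + of_int l)) = of_int (2 * m) * pi"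
    unfolding exp_eq_1 by blast
  then have m: "of_real (ln q) * (u + of_int l) = of_int (2 * m) * (of_real pi * \<i>)"
    by (intro complex_eqI) simp_all
  have shift: "u = of_int (- l) + X" if "u + of_int l = X" for X
    using that by auto
  define L where "L = complex_of_real (ln q)"
  have L: "L \<noteq> 0" unfolding L_def using q by simp
  have "u + of_int l = of_int (2 * m) * (of_real pi * \<i>) / L"
    using m L unfolding L_def by (simp add: field_simps)
  \<comment> \<open>The lattice is written with a division by the imaginary unit, which changes the
    sign of m.\<close>
  also have "\<dots> = of_int (- m) * (2 * of_real pi / (\<i> * L))"
    using L by (simp add: field_simps)
  finally have "u = of_int (- l) + of_int (- m) * (2 * of_real pi / (\<i> * of_real (ln q)))"
    unfolding L_def by (rule shift)
  then have "u \<in> Omega q" unfolding Omega_def using q by (subst if_not_P) blast+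
  then show False using u by blast
qed

theorem theorem2p1:
  fixes n :: nat and q :: real and g :: complex and gs :: "nat \<Rightarrow> complex"
    and a b c d :: nat and z :: "nat \<Rightarrow> complex"
  assumes "n \<ge> 1" and "0 < q" and "q \<le> 1"
    and "distinct [a, b, c, d]" and "{a, b, c, d} = {1, 2, 3, 4}"
    and "\<And>j. j \<in> {1..n} \<Longrightarrow> Re (1 + 2 * of_nat (n - j) * g + gs 1 + gs 2 + gs 3 + gs 4) > 0"
    and "\<And>j k. 1 \<le> j \<Longrightarrow> j < k \<Longrightarrow> k \<le> n \<Longrightarrow> z j + z k \<notin> Omega q \<and> z j - z k \<notin> Omega q"
    and "\<And>j. j \<in> {1..n} \<Longrightarrow> 2 * z j \<notin> Omega q"
  shows "(\<lambda>l. norm (lhs_term q n g gs z l)) summable_on int_vectors n \<and>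
    (quotient_defined q n (rhohat n g (ghat a b c d gs a)) \<longrightarrow>
       (\<Sum>\<^sub>\<infinity>l\<in>int_vectors n. lhs_term q n g gs z l) = rhs_quotient q n a b c d gs g) \<and>
    (rhs_quotient q n a b c d gs \<longlongrightarrow> (\<Sum>\<^sub>\<infinity>l\<in>int_vectors n. lhs_term q n g gs z l)) (at g)"
proof -
  obtain F br Y w \<eta> L where FL: "gamma_like_growth F br Y w \<eta>" "\<And>u. F u = exp (L * (u * (u - 1) / 4)) * cfac q u"
    and br: "\<And>u l. u \<notin> Omega q \<Longrightarrow> br (u + of_int l) \<noteq> 0"
  proof (cases "q = 1")
    case True
    \<comment> \<open>For q = 1 no Gaussian factor is present, so L = 0.\<close>
    have "rGamma u = exp (0 * (u * (u - 1) / 4)) * cfac q u" for u using True by (simp add: cfac_def)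
    moreover have "u + of_int l \<noteq> 0" if "u \<notin> Omega q" for u l
    proof
      assume "u + of_int l = 0"
      then have "u = of_int (- l)" by (simp add: eq_neg_iff_add_eq_0)
      then show False using \<open>u \<notin> Omega q\<close> True unfolding Omega_def by simp
    qed
    ultimately show thesis by (rule that[OF gamma_like_growth_rGamma])
  next
    case False
    then have q: "0 < q" "q < 1" using assms(2,3) by auto
    have "Fq q u = exp (lq q * (u * (u - 1) / 4)) * cfac q u" for u using False by (simp add: cfac_def Fq_def[OF q])
    then show thesis by (rule that[OF gamma_like_growth_Fq[OF q]]) (rule brq_nonzero[OF q])
  qed
  interpret gamma_like_growth F br Y w \<eta> by (rule FL(1))
  have adm: "admissible n z" unfolding admissible_def nz_def using assms(7,8) br by blast
  \<comment> \<open>The hypothesis is affine in n - j, so its extreme cases suffice: j = n when Re g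
    is nonnegative and j = 1 when it is negative.\<close>
  have dec: "decay n g (gs a + gs b + gs c + gs d) > 0"
  proof -
    have "Re (1 + (gs 1 + gs 2 + gs 3 + gs 4)) > 0" using assms(6)[of n] assms(1) by simp
    moreover have "Re (1 + 2 * of_nat (n - 1) * g + (gs 1 + gs 2 + gs 3 + gs 4)) > 0" using assms(6)[of 1] assms(1) by simp
    ultimately show ?thesis
      unfolding sum_four[OF assms(4,5)] decay_def neg_def by (cases "Re g \<ge> 0") (simp_all add: mult_ac)
  qed
  note st = sum_term_of[OF FL(2) adm dec refl refl refl refl]
  show ?thesis
    unfolding lhs_term_eq[OF assms(4,5)] rhs_quotient_eq[OF assms(4,5), abs_def] rhohat_eq[OF assms(4,5)] quotient_defined_iff
  proof (intro conjI impI, goal_cases)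
    case 1
    show ?case using st(1) unfolding shifted_def .
  next
    case 2
    show ?case by (rule st(3)[unfolded shifted_def]) (use 2 in auto)
  next
    case 3
    show ?case using st(2) unfolding shifted_def .
  qed
qed

end
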